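(* Let $\{k_{n}\}_{n\in\mathbb{N}}\subset[2,+\infty)$ be a sequence of real numbers with limit $+\infty$, and let $\mu$ and $\{\nu_{n}\}_{n\in\mathbb{N}}$ be measures in $\mathcal{P}_{\mathbb{T}}^{*}$ such that $\mu$ is $\boxtimes$-infinitely divisible and $\int_{\mathbb{T}}t\,d\nu_{n}(t)>0$ for every $n\in\mathbb{N}$. Suppose that the sequence $\{\nu_{n}^{\boxtimes k_{n}}\}_{n\in\mathbb{N}}$ converges weakly to $\mu$. Let $K\subset\mathbb{T}\setminus D_{\mu}$ be an arbitrary compact set. Then $\nu_{n}^{\boxtimes k_{n}}$ is absolutely continuous on $K$ (with respect to arclength measure) for sufficiently large $n$, and the densities $p_{n}$ of $\nu_{n}^{\boxtimes k_{n}}$ relative to arclength measure converge to the density $p_{\mu}$ of $\mu$ uniformly on $K$. If $D_{\mu}=\varnothing$, one can take $K=\mathbb{T}$.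
   Context: $\mathbb{T}$ is the unit circle, $\mathbb{D}$ the open unit disk, $\mathcal{P}_{\mathbb{T}}$ the set of Borel probability measures on $\mathbb{T}$, and $\mathcal{P}_{\mathbb{T}}^{*}$ the set of those $\mu\in\mathcal{P}_{\mathbb{T}}$ with $\int_{\mathbb{T}}t\,d\mu(t)\neq0$. For $\mu\in\mathcal{P}_{\mathbb{T}}$ put $\psi_{\mu}(z)=\int_{\mathbb{T}}\frac{tz}{1-tz}\,d\mu(t)$ and $\eta_{\mu}(z)=\frac{\psi_{\mu}(z)}{1+\psi_{\mu}(z)}$, $z\in\mathbb{D}$. (The functions $\eta_\mu$ are exactly the analytic maps $\mathbb{D}\to\mathbb{D}$ vanishing at $0$, and $\eta_\mu$ determines $\mu$.) For $\mu\in\mathcal{P}_{\mathbb{T}}^{*}$, $\eta_\mu$ has an analytic inverse $\eta_{\mu}^{\langle-1\rangle}$ near $0$, and for $\mu_1,\mu_2\in\mathcal{P}_{\mathbb{T}}^{*}$ the free multiplicative convolution $\mu=\mu_1\boxtimes\mu_2\in\mathcal{P}_{\mathbb{T}}^{*}$ is determined by $z\eta_{\mu}^{\langle-1\rangle}(z)=\eta_{\mu_{1}}^{\langle-1\rangle}(z)\eta_{\mu_{2}}^{\langle-1\rangle}(z)$ near $0$. A measure $\mu\in\mathcal{P}_{\mathbb{T}}^*$ is $\boxtimes$-infinitely divisible if for every $n\in\mathbb{N}$ it is the $\boxtimes$-convolution of $n$ copies of some measure; equivalently, $\eta_\mu^{\langle-1\rangle}$ has an analytic continuation $\Phi$ to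 $\mathbb{D}$ with $\Phi(0)=0$ and $|\Phi(z)|\ge|z|$; every such $\Phi$ arises in this way. Real convolution powers. Suppose $\int_{\mathbb{T}}t\,d\nu(t)>0$. If $\eta_\nu$ has no zeros in $\mathbb{D}\setminus\{0\}$ and $k>1$, let $\Phi(z)=z\left(z/\eta_{\nu}(z)\right)^{k-1}$, where the power is chosen with $\Phi'(0)>0$, let $\rho\in\mathcal{P}_{\mathbb{T}}^{*}$ be the $\boxtimes$-infinitely divisible measure for which $\Phi$ is the analytic continuation of $\eta_{\rho}^{\langle-1\rangle}$, and define $\nu^{\boxtimes k}$ by $\eta_{\nu^{\boxtimes k}}=\eta_{\nu}\circ\eta_{\rho}$. In general, for $k>2$, $\eta_{\nu\boxtimes\nu}$ has no zeros in $\mathbb{D}\setminus\{0\}$ and one defines $\nu^{\boxtimes k}=(\nu\boxtimes\nu)^{\boxtimes k/2}$; $\nu^{\boxtimes2}=\nu\boxtimes\nu$. (These agree with the usual powers for integer $k$.) If $\mu\in\mathcal{P}_{\mathbb{T}}^*$ is $\boxtimes$-infinitely divisible, $\eta_\mu$ extends to an injective continuous function on $\overline{\mathbb{D}}$. Define $D_\mu=\{\overline{t}:t\in\mathbb{T},\ \eta_\mu(t)=1\}$, which is empty or a singleton. The measure $\mu$ is absolutely continuous on $\mathbb{T}\setminus D_\mu$ relative to arclength measure $d\theta$, with continuous density $p_\mu(\xi)=\frac1{2\pi}\Re\frac{1+\eta_\mu(\overline{\xi})}{1-\eta_\mu(\overline{\xi})}$. For $k>2$, $\eta_{\nu^{\boxtimes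 k}}$ also extends continuously to $\overline{\mathbb{D}}$, and the density of $\nu^{\boxtimes k}$ is given by the same formula where $\eta_{\nu^{\boxtimes k}}(\overline\xi)\ne1$. *)

theory Defs
  imports "HOL-Probability.Probability" "HOL-Complex_Analysis.Complex_Analysis"
begin

definition circle_borel :: "complex measure" where
  "circle_borel = restrict_space borel (sphere 0 1)"

definition arclength :: "complex measure" where
  "arclength = distr (restrict_space lborel {0..<2*pi}) circle_borel cis"

definition circle_probs :: "complex measure set" where
  "circle_probs = {M. prob_space M \<and> sets M = sets circle_borel}"

definition circle_mean :: "complex measure \<Rightarrow> complex" where
  "circle_mean M = (LINT t|M. t)"

definition circle_probs_nz :: "complex measure set" where
  "circle_probs_nz = {M \<in> circle_probs. circle_mean M \<noteq> 0}"

definition pos_real :: "complex \<Rightarrow> bool" where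
  "pos_real z \<longleftrightarrow> Im z = 0 \<and> Re z > 0"

definition psi :: "complex measure \<Rightarrow> complex \<Rightarrow> complex" where
  "psi M z = (LINT t|M. t * z / (1 - t * z))"

definition eta :: "complex measure \<Rightarrow> complex \<Rightarrow> complex" where
  "eta M z = psi M z / (1 + psi M z)"

text \<open>Outside the open disk, the value is only meaningful at boundary points where the limit from
  inside exists, as is the case on the whole circle if \<open>M\<close> is infinitely divisible or a
  convolution power with exponent greater than 2.\<close>

definition eta_ext :: "complex measure \<Rightarrow> complex \<Rightarrow> complex" where
  "eta_ext M z = (if z \<in> ball 0 1 then eta M z else Lim (at z within ball 0 1) (eta M))"

definition eta_inverse_near_0 :: "complex measure \<Rightarrow> (complex \<Rightarrow> complex) \<Rightarrow> bool" where
  "eta_inverse_near_0 M g \<longleftrightarrow> g analytic_on {0} \<and> g 0 = 0 \<and>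
     (\<forall>\<^sub>F z in nhds 0. eta M (g z) = z) \<and> (\<forall>\<^sub>F z in nhds 0. g (eta M z) = z)"

text \<open>Convolutions and their powers are rendered as relations: \<open>is_free_conv M1 M2 M\<close> says
  that \<open>M\<close> is the free multiplicative convolution of \<open>M1\<close> and \<open>M2\<close>. There is at most one such
  \<open>M\<close>, because the inverse of \<open>eta M\<close> near 0 determines \<open>M\<close>.\<close>

definition is_free_conv :: "complex measure \<Rightarrow> complex measure \<Rightarrow> complex measure \<Rightarrow> bool" where
  "is_free_conv M1 M2 M \<longleftrightarrow>
     M1 \<in> circle_probs_nz \<and> M2 \<in> circle_probs_nz \<and> M \<in> circle_probs_nz \<and>
     (\<exists>g1 g2 g. eta_inverse_near_0 M1 g1 \<and> eta_inverse_near_0 M2 g2 \<and> eta_inverse_near_0 M g \<and>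
        (\<forall>\<^sub>F z in nhds 0. z * g z = g1 z * g2 z))"

inductive is_free_conv_copies :: "complex measure \<Rightarrow> nat \<Rightarrow> complex measure \<Rightarrow> bool"
  for N :: "complex measure" where
  "N \<in> circle_probs_nz \<Longrightarrow> is_free_conv_copies N 1 N"
| "is_free_conv_copies N n M' \<Longrightarrow> is_free_conv M' N M \<Longrightarrow> is_free_conv_copies N (Suc n) M"

definition free_inf_divisible :: "complex measure \<Rightarrow> bool" where
  "free_inf_divisible M \<longleftrightarrow> M \<in> circle_probs_nz \<and> (\<forall>n\<ge>1. \<exists>N. is_free_conv_copies N n M)"

text \<open>The convolution power of \<open>N\<close> with real exponent \<open>k > 1\<close> when \<open>eta N\<close> has no zeros in the
  punctured disk. Here \<open>L\<close> is a holomorphic logarithm of \<open>z / eta N z\<close> (with the singularity at 0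
  removed), so that \<open>\<Phi> z = z * (z / eta N z) powr (k - 1)\<close> for some holomorphic branch of the
  power; the branch is fixed by the sign of \<open>deriv \<Phi> 0\<close>.\<close>

definition is_free_power_zero_free ::
    "complex measure \<Rightarrow> real \<Rightarrow> complex measure \<Rightarrow> bool" where
  "is_free_power_zero_free N k M \<longleftrightarrow>
     N \<in> circle_probs_nz \<and> pos_real (circle_mean N) \<and>
     (\<forall>z\<in>ball 0 1 - {0}. eta N z \<noteq> 0) \<and> k > 1 \<and> M \<in> circle_probs_nz \<and>
     (\<exists>L \<Phi> \<rho>. L holomorphic_on ball 0 1 \<and>
        (\<forall>z\<in>ball 0 1 - {0}. exp (L z) = z / eta N z) \<and>
        \<Phi> = (\<lambda>z. z * exp (of_real (k - 1) * L z)) \<and>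
        pos_real (deriv \<Phi> 0) \<and>
        free_inf_divisible \<rho> \<and> eta_inverse_near_0 \<rho> \<Phi> \<and>
        (\<forall>z\<in>ball 0 1. eta M z = eta N (eta \<rho> z)))"

text \<open>The power for a general \<open>N\<close>, defined for \<open>k \<ge> 2\<close> only.\<close>

definition is_free_power :: "complex measure \<Rightarrow> real \<Rightarrow> complex measure \<Rightarrow> bool" where
  "is_free_power N k M \<longleftrightarrow> pos_real (circle_mean N) \<and>
     (k = 2 \<and> is_free_conv N N M \<or>
      k > 2 \<and> (\<exists>N2. is_free_conv N N N2 \<and> is_free_power_zero_free N2 (k / 2) M))"

definition circle_weak_conv :: "(nat \<Rightarrow> complex measure) \<Rightarrow> complex measure \<Rightarrow> bool" where
  "circle_weak_conv M_seq M \<longleftrightarrow>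
     (\<forall>f :: complex \<Rightarrow> real. continuous_on (sphere 0 1) f \<longrightarrow>
        (\<lambda>n. LINT t|M_seq n. f t) \<longlonglongrightarrow> (LINT t|M. f t))"

definition exceptional_set :: "complex measure \<Rightarrow> complex set" where
  "exceptional_set M = {cnj t |t. t \<in> sphere 0 1 \<and> eta_ext M t = 1}"

definition circle_density :: "complex measure \<Rightarrow> complex \<Rightarrow> real" where
  "circle_density M \<xi> =
     1 / (2 * pi) * Re ((1 + eta_ext M (cnj \<xi>)) / (1 - eta_ext M (cnj \<xi>)))"

definition abs_cont_on :: "complex set \<Rightarrow> complex measure \<Rightarrow> bool" where
  "abs_cont_on K M \<longleftrightarrow>
     absolutely_continuous (restrict_space arclength K) (restrict_space M K)"

definition has_arclength_density_on ::
    "complex set \<Rightarrow> complex measure \<Rightarrow> (complex \<Rightarrow> real) \<Rightarrow> bool" where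
  "has_arclength_density_on K M p \<longleftrightarrow> (\<forall>\<xi>\<in>K. p \<xi> \<ge> 0) \<and>
     p \<in> borel_measurable (restrict_space arclength K) \<and>
     restrict_space M K = density (restrict_space arclength K) (\<lambda>\<xi>. ennreal (p \<xi>))"

end

theory Submission
  imports Defs
begin

text \<open>
  The convolution power satisfies \<open>\<eta>(z) = w(z) exp (-u(w(z))/\<kappa>)\<close> with \<open>\<kappa> = k/2 - 1\<close>, where
  \<open>w = \<eta>\<^sub>\<rho>\<close> is the subordination function and \<open>u\<close> has nonnegative real part. Here \<open>w(z)\<close>
  is the fixed point of the self-map \<open>x \<mapsto> z exp (-u(x))\<close> of the disc.
  The Schwarz-Pick lemma bounds \<open>u(w(z))\<close> in terms of \<open>u(0)\<close>, so \<open>\<eta> - w \<rightarrow> 0\<close> uniformly as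
  \<open>\<kappa> \<rightarrow> \<infinity>\<close>, and by Montel's theorem the maps \<open>exp (-u)\<close> subconverge.

  Uniform convergence up to the boundary is the continuity of Denjoy-Wolff points: a limit \<open>\<tau>\<close> of
  fixed points, even if it lies on the circle, satisfies \<open>h (F x) \<le> h x\<close> with
  \<open>h x = |1 - \<tau>\<^sup>* x|\<^sup>2 / (1 - |x|\<^sup>2)\<close> for the limit map \<open>F\<close>. If two points had this
  property, the minimisers of the convex combinations of their functions \<open>h\<close> would be fixed points
  of \<open>F\<close>, and a self-map of the disc with two fixed points is the identity.
  The densities are then recovered from the boundary values by Poisson integrals.
\<close>

section \<open>Schwarz-Pick inequalities\<close>

text \<open>The obstacle is the boundary: the maps \<open>exp (- u)\<close> converge only inside the
  disc, while their fixed points \<open>w z\<close> may run into the circle, where neither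
  \<open>u\<close> nor its limits need have boundary values. Two features of fixed points compensate
  for this. The equation \<open>w * exp (u w) = z\<close> gives |w| exp (Re (u w)) <= 1, hence Re (u
  w) <= (1 - |w|) / |w|, and this decay towards the circle cancels the degenerating factor 1 - |w|^2
  of the Schwarz-Pick inequality. Moreover, at a fixed point that inequality carries 1 - |w|^2 on
  both sides, so it can be divided out before passing to the limit. The bound on u(0) comes from the
  means: the power has mean exp (- (1 + 1/\<kappa>) u(0)), and these means tend to the nonzero mean
  of \<mu>. The same bound keeps a limit G of \<open>exp (- u)\<close> from vanishing at 0, which is
  what prevents the limit map \<open>x \<mapsto> \<zeta> * G x\<close> from being the
  identity.\<close>

lemma cmod_power2_diff:
  fixes a b :: complex
  shows "(cmod (1 - cnj a * b))\<^sup>2 = (cmod (b - a))\<^sup>2 + (1 - (cmod a)\<^sup>2) * (1 - (cmod b)\<^sup>2)"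
  unfolding cmod_power2 by (simp add: power2_eq_square) algebra

lemma cmod_less_1_power2: "cmod z < 1 \<Longrightarrow> 0 < 1 - (cmod z)\<^sup>2"
  by (simp add: abs_square_less_1)

lemma cnj_mult_neq_1: "cmod a < 1 \<Longrightarrow> cmod b \<le> 1 \<Longrightarrow> 1 - cnj a * b \<noteq> 0"
  by (metis complex_mod_cnj eq_iff_diff_eq_0 mult_left_le norm_ge_zero norm_mult norm_one not_less order_trans)

text \<open>The sign change in front of \<open>Moebius_function\<close> turns it into (a - z) / (1 -
  cnj a z), which is its own inverse. One map thus serves both to move \<open>a\<close> to 0 and to
  move it back. The last property is cleared of denominators so that it combines with
  \<open>cmod_power2_diff\<close>.\<close>

lemma disc_involution:
  assumes "cmod a < 1"
  obtains \<phi> where "\<phi> holomorphic_on ball 0 1" "\<And>z. cmod z < 1 \<Longrightarrow> cmod (\<phi> z) < 1"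
    "\<And>z. cmod z < 1 \<Longrightarrow> \<phi> (\<phi> z) = z" "\<phi> 0 = a" "\<phi> a = 0"
    "\<And>z. cmod z < 1 \<Longrightarrow> (cmod (\<phi> z))\<^sup>2 * (cmod (1 - cnj a * z))\<^sup>2 = (cmod (z - a))\<^sup>2"
proof
  define \<phi> where "\<phi> = (\<lambda>z. - Moebius_function 0 a z)"
  have \<phi>: "\<phi> z = (a - z) / (1 - cnj a * z)" for z
    by (simp add: \<phi>_def Moebius_function_simple minus_divide_left)
  show "\<phi> holomorphic_on ball 0 1"
    unfolding \<phi>_def by (intro holomorphic_intros Moebius_function_holomorphic assms)
  show "cmod (\<phi> z) < 1" if "cmod z < 1" for z
    unfolding \<phi>_def using Moebius_function_norm_lt_1[OF assms that] by simp
  show "\<phi> (\<phi> z) = z" if "cmod z < 1" for z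
  proof -
    have nz: "1 - cnj a * z \<noteq> 0" "1 - cnj a * a \<noteq> 0"
      using cnj_mult_neq_1 assms that by (auto simp: less_imp_le)
    have "a - \<phi> z = z * (1 - cnj a * a) / (1 - cnj a * z)"
      using nz by (simp add: \<phi> field_simps)
    moreover have "1 - cnj a * \<phi> z = (1 - cnj a * a) / (1 - cnj a * z)"
      using nz by (simp add: \<phi> field_simps)
    ultimately show ?thesis
      using nz by (simp add: \<phi>[of "\<phi> z"])
  qed
  show "\<phi> 0 = a" "\<phi> a = 0" by (auto simp: \<phi>)
  show "(cmod (\<phi> z))\<^sup>2 * (cmod (1 - cnj a * z))\<^sup>2 = (cmod (z - a))\<^sup>2" if "cmod z < 1" for z
    using cnj_mult_neq_1[of a z] assms that by (simp add: \<phi> norm_divide power_divide norm_minus_commute)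
qed

text \<open>Conjugating \<open>f\<close> by the involutions at \<open>w\<close> and
  \<open>f w\<close> produces a self-map fixing 0, to which the Schwarz lemma applies. The product
  form without quotients is chosen so that, at a fixed point \<open>w\<close>, a factor 1 - |w|^2
  can be cancelled on both sides.\<close>

lemma Schwarz_Pick:
  assumes "f holomorphic_on ball 0 1" and f1: "\<And>z. cmod z < 1 \<Longrightarrow> cmod (f z) < 1"
    and w: "cmod w < 1" and x: "cmod x < 1"
  shows "(cmod (1 - cnj (f w) * f x))\<^sup>2 * ((1 - (cmod w)\<^sup>2) * (1 - (cmod x)\<^sup>2))
    \<le> (cmod (1 - cnj w * x))\<^sup>2 * ((1 - (cmod (f w))\<^sup>2) * (1 - (cmod (f x))\<^sup>2))"
proof -
  obtain \<phi> where \<phi>: "\<phi> holomorphic_on ball 0 1" "\<And>z. cmod z < 1 \<Longrightarrow> cmod (\<phi> z) < 1"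
    "\<And>z. cmod z < 1 \<Longrightarrow> \<phi> (\<phi> z) = z" "\<phi> 0 = w" "\<phi> w = 0"
    "\<And>z. cmod z < 1 \<Longrightarrow> (cmod (\<phi> z))\<^sup>2 * (cmod (1 - cnj w * z))\<^sup>2 = (cmod (z - w))\<^sup>2"
    using disc_involution[OF w] by metis
  obtain \<psi> where \<psi>: "\<psi> holomorphic_on ball 0 1" "\<And>z. cmod z < 1 \<Longrightarrow> cmod (\<psi> z) < 1"
    "\<psi> (f w) = 0"
    "\<And>z. cmod z < 1 \<Longrightarrow> (cmod (\<psi> z))\<^sup>2 * (cmod (1 - cnj (f w) * z))\<^sup>2 = (cmod (z - f w))\<^sup>2"
    using disc_involution[OF f1[OF w]] by metis
  define g where "g = \<psi> \<circ> (f \<circ> \<phi>)"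
  have "g holomorphic_on ball 0 1"
    unfolding g_def by (intro holomorphic_on_compose_gen[where t="ball 0 1"] \<phi> \<psi> assms)
      (auto simp: \<phi> f1)
  moreover have "g 0 = 0" by (simp add: g_def \<phi> \<psi>)
  moreover have "cmod (g z) < 1" if "cmod z < 1" for z
    using that by (simp add: g_def \<phi> \<psi> f1)
  ultimately have "cmod (g (\<phi> x)) \<le> cmod (\<phi> x)"
    using Schwarz_Lemma(1) \<phi>(2)[OF x] by blast
  then have le: "(cmod (\<psi> (f x)))\<^sup>2 \<le> (cmod (\<phi> x))\<^sup>2"
    by (simp add: g_def \<phi> x power_mono)
  define A where "A = (cmod (1 - cnj w * x))\<^sup>2"
  define B where "B = (cmod (1 - cnj (f w) * f x))\<^sup>2"
  define P where "P = (1 - (cmod w)\<^sup>2) * (1 - (cmod x)\<^sup>2)"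
  define Q where "Q = (1 - (cmod (f w))\<^sup>2) * (1 - (cmod (f x))\<^sup>2)"
  \<comment> \<open>With A and B as denominators of the two pseudo-hyperbolic distances, the Schwarz
    lemma reads (B - Q) A <= (A - P) B; the products A B cancel.\<close>
  have "(cmod (\<phi> x))\<^sup>2 * A = A - P" "(cmod (\<psi> (f x)))\<^sup>2 * B = B - Q"
    unfolding A_def B_def P_def Q_def
    using \<phi>(6)[OF x] \<psi>(4)[OF f1[OF x]] cmod_power2_diff[of w x] cmod_power2_diff[of "f w" "f x"]
    by auto
  moreover have "A \<ge> 0" "B \<ge> 0" by (auto simp: A_def B_def)
  ultimately have "(B - Q) * A \<le> (A - P) * B"
    using mult_right_mono[OF le, of "A * B"] by (metis ab_semigroup_mult_class.mult_ac(1) mult.commute mult_nonneg_nonneg)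
  then have "B * P \<le> A * Q" by (simp add: algebra_simps)
  then show ?thesis by (simp add: A_def B_def P_def Q_def)
qed

text \<open>The Cayley transform (u - 1) / (u + 1) carries the right half-plane to the disc, where
  \<open>Schwarz_Pick\<close> applies.\<close>

lemma Schwarz_Pick_half_plane_strict:
  assumes u: "u holomorphic_on ball 0 1" and pos: "\<And>z. cmod z < 1 \<Longrightarrow> 0 < Re (u z)"
    and w: "cmod w < 1" and x: "cmod x < 1"
  shows "(cmod (u x - u w))\<^sup>2 * ((1 - (cmod w)\<^sup>2) * (1 - (cmod x)\<^sup>2))
    \<le> 4 * (Re (u w) * Re (u x)) * (cmod (x - w))\<^sup>2"
proof -
  define f where "f = (\<lambda>z. (u z - 1) / (u z + 1))"
  have nz: "u z + 1 \<noteq> 0" if "cmod z < 1" for z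
    using pos[OF that] by (auto simp: complex_eq_iff)
  have hol: "f holomorphic_on ball 0 1"
    unfolding f_def by (intro holomorphic_intros u) (use nz in auto)
  have sq: "(1 - (cmod (f z))\<^sup>2) * (cmod (u z + 1))\<^sup>2 = 4 * Re (u z)" if "cmod z < 1" for z
  proof -
    have "(1 - (cmod (f z))\<^sup>2) * (cmod (u z + 1))\<^sup>2 = (cmod (u z + 1))\<^sup>2 - (cmod (u z - 1))\<^sup>2"
      using nz[OF that] by (simp add: f_def norm_divide power_divide field_simps)
    also have "\<dots> = 4 * Re (u z)"
      unfolding cmod_power2 by (simp add: power2_eq_square algebra_simps)
    finally show ?thesis .
  qed
  have f1: "cmod (f z) < 1" if "cmod z < 1" for z
  proof -
    have "0 < (1 - (cmod (f z))\<^sup>2) * (cmod (u z + 1))\<^sup>2"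
      using sq[OF that] pos[OF that] by simp
    then have "0 < 1 - (cmod (f z))\<^sup>2"
      by (simp add: zero_less_mult_iff)
    then show ?thesis by (simp add: abs_square_less_1)
  qed
  define a b where "a = u w" and "b = u x"
  define A where "A = (cmod (a + 1))\<^sup>2"
  define B where "B = (cmod (b + 1))\<^sup>2"
  define P where "P = (1 - (cmod w)\<^sup>2) * (1 - (cmod x)\<^sup>2)"
  have AB: "A > 0" "B > 0" using nz w x by (auto simp: A_def B_def a_def b_def)
  have "1 - cnj (f w) * f x = 2 * (cnj a + b) / ((cnj a + 1) * (b + 1))"
  proof -
    have "cnj a + 1 \<noteq> 0" using nz[OF w] by (metis a_def complex_cnj_add complex_cnj_one complex_cnj_zero_iff)
    moreover have "b + 1 \<noteq> 0" using nz[OF x] by (simp add: b_def)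
    ultimately have D: "(cnj a + 1) * (b + 1) \<noteq> 0" by simp
    have "cnj (f w) * f x = ((cnj a - 1) * (b - 1)) / ((cnj a + 1) * (b + 1))"
      by (simp add: f_def a_def b_def)
    then have "1 - cnj (f w) * f x
        = ((cnj a + 1) * (b + 1) - (cnj a - 1) * (b - 1)) / ((cnj a + 1) * (b + 1))"
      by (simp only: diff_divide_distrib divide_self[OF D])
    moreover have "(cnj a + 1) * (b + 1) - (cnj a - 1) * (b - 1) = 2 * (cnj a + b)"
      by (simp add: algebra_simps)
    ultimately show ?thesis by (simp only:)
  qed
  moreover have "cmod (cnj a + 1) = cmod (a + 1)"
    using complex_mod_cnj[of "a + 1"] by simp
  ultimately have "cmod (1 - cnj (f w) * f x) = 2 * cmod (cnj a + b) / (cmod (a + 1) * cmod (b + 1))"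
    by (simp only: norm_mult norm_divide norm_numeral)
  then have "(cmod (1 - cnj (f w) * f x))\<^sup>2 = 4 * (cmod (cnj a + b))\<^sup>2 / (A * B)"
    by (simp add: power_mult_distrib power_divide A_def B_def)
  moreover have "1 - (cmod (f w))\<^sup>2 = 4 * Re a / A" "1 - (cmod (f x))\<^sup>2 = 4 * Re b / B"
    using sq[OF w] sq[OF x] AB by (auto simp: A_def B_def a_def b_def field_simps)
  moreover note Schwarz_Pick[OF hol f1 w x]
  ultimately have "4 * (cmod (cnj a + b))\<^sup>2 / (A * B) * P
      \<le> (cmod (1 - cnj w * x))\<^sup>2 * ((4 * Re a / A) * (4 * Re b / B))"
    by (simp add: P_def)
  then have "(cmod (cnj a + b))\<^sup>2 * P \<le> 4 * (Re a * Re b) * (cmod (1 - cnj w * x))\<^sup>2"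
    using AB by (simp add: field_simps)
  \<comment> \<open>This is the half-plane counterpart of \<open>cmod_power2_diff\<close>. Expanding
    both sides by these two identities leaves a term 4 (Re a) (Re b) P on each, and subtracting it
    turns the bound into one on the difference of the values.\<close>
  moreover have "(cmod (cnj a + b))\<^sup>2 = (cmod (b - a))\<^sup>2 + 4 * (Re a * Re b)"
    unfolding cmod_power2 by (simp add: power2_eq_square algebra_simps)
  ultimately show ?thesis
    unfolding cmod_power2_diff[of w x] by (simp add: P_def a_def b_def algebra_simps)
qed

text \<open>Adding e > 0 to \<open>u\<close> makes its real part positive and does not change
  differences of values; then e tends to 0. Vanishing real parts do occur: for the unit mass at 1, z
  / eta z is 1 and its logarithm is constant and imaginary.\<close>

lemma Schwarz_Pick_half_plane:
  assumes u: "u holomorphic_on ball 0 1" and pos: "\<And>z. cmod z < 1 \<Longrightarrow> 0 \<le> Re (u z)"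
    and w: "cmod w < 1" and x: "cmod x < 1"
  shows "(cmod (u x - u w))\<^sup>2 * ((1 - (cmod w)\<^sup>2) * (1 - (cmod x)\<^sup>2))
    \<le> 4 * (Re (u w) * Re (u x)) * (cmod (x - w))\<^sup>2"
proof (rule tendsto_lowerbound)
  let ?r = "\<lambda>e::real. 4 * ((Re (u w) + e) * (Re (u x) + e)) * (cmod (x - w))\<^sup>2"
  have "(?r \<longlongrightarrow> ?r 0) (at_right 0)"
    by (intro tendsto_intros)
  then show "(?r \<longlongrightarrow> 4 * (Re (u w) * Re (u x)) * (cmod (x - w))\<^sup>2) (at_right 0)"
    by simp
  show "\<forall>\<^sub>F e in at_right 0. (cmod (u x - u w))\<^sup>2 * ((1 - (cmod w)\<^sup>2) * (1 - (cmod x)\<^sup>2)) \<le> ?r e"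
    using eventually_at_right_less[of "0::real"]
  proof eventually_elim
    case (elim e)
    have "(\<lambda>z. u z + of_real e) holomorphic_on ball 0 1" by (intro holomorphic_intros u)
    from Schwarz_Pick_half_plane_strict[OF this _ w x] show ?case
      using pos elim by (simp add: add_nonneg_pos)
  qed
qed simp

text \<open>Once one fixed point is moved to 0, the other one gives equality in the Schwarz lemma.
  The conjugated map is then a rotation, and a rotation with a nonzero fixed point is the
  identity.\<close>

lemma Schwarz_Pick_two_fixed_points:
  assumes f: "f holomorphic_on ball 0 1" and f1: "\<And>z. cmod z < 1 \<Longrightarrow> cmod (f z) < 1"
    and a: "cmod a < 1" "f a = a" and b: "cmod b < 1" "f b = b" and "a \<noteq> b" and x: "cmod x < 1"
  shows "f x = x"
proof -
  obtain \<phi> where \<phi>: "\<phi> holomorphic_on ball 0 1" "\<And>z. cmod z < 1 \<Longrightarrow> cmod (\<phi> z) < 1"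
    "\<And>z. cmod z < 1 \<Longrightarrow> \<phi> (\<phi> z) = z" "\<phi> 0 = a" "\<phi> a = 0"
    using disc_involution[OF a(1)] by metis
  define g where "g = \<phi> \<circ> (f \<circ> \<phi>)"
  have g: "g holomorphic_on ball 0 1"
    unfolding g_def by (intro holomorphic_on_compose_gen[where t="ball 0 1"] \<phi> assms)
      (auto simp: \<phi> f1)
  have g0: "g 0 = 0" by (simp add: g_def \<phi> a)
  have g1: "cmod (g z) < 1" if "cmod z < 1" for z
    using that by (simp add: g_def \<phi> f1)
  have gb: "g (\<phi> b) = \<phi> b" by (simp add: g_def \<phi> b)
  have b0: "\<phi> b \<noteq> 0" using \<phi> b \<open>a \<noteq> b\<close> by metis
  obtain \<alpha> where \<alpha>: "\<And>z. cmod z < 1 \<Longrightarrow> g z = \<alpha> * z"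
  proof -
    have "(\<exists>z. cmod z < 1 \<and> z \<noteq> 0 \<and> cmod (g z) = cmod z) \<or> cmod (deriv g 0) = 1"
      by (intro disjI1 exI[of _ "\<phi> b"]) (simp add: gb b0 \<phi>(2) b(1))
    from Schwarz_Lemma(3)[OF g g0 _ _ this, of 0] g1 show thesis
      by (auto intro: that)
  qed
  have "\<alpha> = 1" using \<alpha>[OF \<phi>(2)[OF b(1)]] gb b0 by simp
  then have "g (\<phi> x) = \<phi> x" using \<alpha> \<phi>(2)[OF x] by simp
  then have "\<phi> (g (\<phi> x)) = x" using \<phi> x by simp
  then show ?thesis using \<phi> x f1 by (simp add: g_def)
qed

section \<open>Limits of fixed points\<close>

text \<open>The last term is the defect in the convexity of the squared norm; it is what makes
  distinct centres \<tau> and \<sigma> yield a strict inequality.\<close>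

lemma weighted_norm_power2:
  fixes a b :: complex
  shows "(cmod ((1 - s) *\<^sub>R a + s *\<^sub>R b))\<^sup>2 =
    (1 - s) * (cmod a)\<^sup>2 + s * (cmod b)\<^sup>2 - s * (1 - s) * (cmod (a - b))\<^sup>2"
  unfolding cmod_power2 by (simp add: power2_eq_square algebra_simps)

text \<open>Completing the square: the weighted sum of the numerators |1 - cnj \<tau> y|^2 and |1 -
  cnj \<sigma> y|^2 equals m (1 - |y|^2) + (q + m) |y - x|^2. Divided by 1 - |y|^2 it therefore has
  the minimum m, attained at \<open>x\<close> only, and \<open>F\<close> does not increase it, so
  \<open>F x = x\<close>. The last conclusion is the equation for the critical point
  \<open>x\<close>; it is what distinguishes the minimisers for different weights.\<close>

lemma horodisc_fixed_point:
  assumes F1: "\<And>x. cmod x < 1 \<Longrightarrow> cmod (F x) < 1"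
    and \<tau>: "cmod \<tau> \<le> 1"
      "\<And>x. cmod x < 1 \<Longrightarrow> (cmod (1 - cnj \<tau> * F x))\<^sup>2 * (1 - (cmod x)\<^sup>2) \<le> (cmod (1 - cnj \<tau> * x))\<^sup>2 * (1 - (cmod (F x))\<^sup>2)"
    and \<sigma>: "cmod \<sigma> \<le> 1"
      "\<And>x. cmod x < 1 \<Longrightarrow> (cmod (1 - cnj \<sigma> * F x))\<^sup>2 * (1 - (cmod x)\<^sup>2) \<le> (cmod (1 - cnj \<sigma> * x))\<^sup>2 * (1 - (cmod (F x))\<^sup>2)"
    and "\<tau> \<noteq> \<sigma>" and s: "0 < s" "s < 1"
  obtains x where "cmod x < 1" "F x = x"
    "(1 - s) *\<^sub>R ((1 - cnj \<tau> * x) * (\<tau> - x)) + s *\<^sub>R ((1 - cnj \<sigma> * x) * (\<sigma> - x)) = 0"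
proof -
  define p where "p = (1 - s) *\<^sub>R \<tau> + s *\<^sub>R \<sigma>"
  define q where "q = (1 - s) * (cmod \<tau>)\<^sup>2 + s * (cmod \<sigma>)\<^sup>2"
  have "s * (1 - s) * (cmod (\<tau> - \<sigma>))\<^sup>2 > 0" using s \<open>\<tau> \<noteq> \<sigma>\<close> by simp
  then have pq: "(cmod p)\<^sup>2 < q"
    unfolding p_def q_def weighted_norm_power2 by simp
  \<comment> \<open>Comparing coefficients in the completed square gives p = (q + m) x and 1 = m +
    (q + m) |x|^2, hence (1 - m) (q + m) = |p|^2. This is quadratic in m with discriminant d^2. The
    larger root is positive because |p|^2 < q, and it places \<open>x\<close> inside the
    disc.\<close>
  define d where "d = sqrt ((1 - q)\<^sup>2 + 4 * (q - (cmod p)\<^sup>2))"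
  define m where "m = ((1 - q) + d) / 2"
  have "\<bar>1 - q\<bar> < d"
    unfolding d_def using pq by (intro real_less_rsqrt) simp
  then have m: "m > 0" "1 - m < q + m" by (auto simp: m_def field_simps)
  have d2: "d\<^sup>2 = (1 - q)\<^sup>2 + 4 * (q - (cmod p)\<^sup>2)"
    unfolding d_def using pq by simp
  have mq: "(1 - m) * (q + m) = (cmod p)\<^sup>2"
    using d2 by (simp add: m_def power2_eq_square field_simps)
  have "q \<ge> 0" using s by (simp add: q_def)
  then have qm: "q + m > 0" using m by simp
  define x where "x = p /\<^sub>R (q + m)"
  have px: "p = (q + m) *\<^sub>R x" using qm by (simp add: x_def)
  have x2: "(cmod x)\<^sup>2 * (q + m) = 1 - m"
    using mq qm by (simp add: px power_mult_distrib) (simp add: power2_eq_square)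
  then have "(cmod x)\<^sup>2 * (q + m) < 1 * (q + m)" using m by simp
  then have x1: "cmod x < 1"
    using qm by (metis abs_norm_cancel abs_square_less_1 mult_less_cancel_right_pos)
  have Q: "(1 - s) * (cmod (1 - cnj \<tau> * y))\<^sup>2 + s * (cmod (1 - cnj \<sigma> * y))\<^sup>2
      = m * (1 - (cmod y)\<^sup>2) + (q + m) * (cmod (y - x))\<^sup>2" for y
  proof -
    have "(1 - s) * (cmod (1 - cnj \<tau> * y))\<^sup>2 + s * (cmod (1 - cnj \<sigma> * y))\<^sup>2
      = 1 - 2 * (p \<bullet> y) + q * (cmod y)\<^sup>2"
      unfolding cmod_power2 p_def q_def inner_complex_def by (simp add: power2_eq_square algebra_simps)
    also have "\<dots> = m * (1 - (cmod y)\<^sup>2) + (q + m) * (cmod (y - x))\<^sup>2"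
    proof -
      have 1: "(cmod (y - x))\<^sup>2 = (cmod y)\<^sup>2 - 2 * (x \<bullet> y) + (cmod x)\<^sup>2"
        unfolding cmod_power2 inner_complex_def by (simp add: power2_eq_square algebra_simps)
      have 2: "p \<bullet> y = (q + m) * (x \<bullet> y)" by (simp add: px)
      show ?thesis unfolding 1 2 using x2 by (simp add: algebra_simps)
    qed
    finally show ?thesis .
  qed
  have "((1 - s) * (cmod (1 - cnj \<tau> * F x))\<^sup>2 + s * (cmod (1 - cnj \<sigma> * F x))\<^sup>2) * (1 - (cmod x)\<^sup>2)
     \<le> ((1 - s) * (cmod (1 - cnj \<tau> * x))\<^sup>2 + s * (cmod (1 - cnj \<sigma> * x))\<^sup>2) * (1 - (cmod (F x))\<^sup>2)"
    using mult_left_mono[OF \<tau>(2)[OF x1], of "1 - s"] mult_left_mono[OF \<sigma>(2)[OF x1], of s] s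
    by (simp add: algebra_simps)
  \<comment> \<open>After substituting the completed square, the terms with m agree on both sides
    and the square vanishes at y = x.\<close>
  then have "(q + m) * (cmod (F x - x))\<^sup>2 * (1 - (cmod x)\<^sup>2) \<le> 0"
    unfolding Q by (simp add: algebra_simps)
  then have "(cmod (F x - x))\<^sup>2 \<le> 0"
    using qm cmod_less_1_power2[OF x1] by (simp add: mult_le_0_iff)
  then have "F x = x" by simp
  moreover have "(1 - s) *\<^sub>R ((1 - cnj \<tau> * x) * (\<tau> - x)) + s *\<^sub>R ((1 - cnj \<sigma> * x) * (\<sigma> - x)) = 0"
  proof -
    have "(1 - s) *\<^sub>R ((1 - cnj \<tau> * x) * (\<tau> - x)) + s *\<^sub>R ((1 - cnj \<sigma> * x) * (\<sigma> - x))
      = p - x - of_real q * x + cnj p * x * x"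
      unfolding p_def q_def scaleR_conv_of_real of_real_add of_real_mult complex_norm_square
      by (simp add: algebra_simps)
    also have "cnj p * x = of_real (1 - m)"
    proof -
      have "cnj p * x = of_real (q + m) * (x * cnj x)"
        by (simp add: px scaleR_conv_of_real)
      also have "\<dots> = of_real ((cmod x)\<^sup>2 * (q + m))"
        by (simp only: of_real_mult complex_norm_square mult.commute)
      finally show ?thesis by (simp add: x2)
    qed
    finally show ?thesis by (simp add: px scaleR_conv_of_real algebra_simps)
  qed
  ultimately show thesis using that x1 by blast
qed

text \<open>The weights 1/3 and 2/3 each give a fixed point of \<open>F\<close>, and these coincide
  because \<open>F\<close> is not the identity. The two critical point equations are then
  independent linear equations for the same pair \<open>a\<close>, \<open>b\<close>, so both vanish
  and \<tau> = x = \<sigma>.\<close>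

lemma horodisc_center_unique:
  assumes F: "F holomorphic_on ball 0 1" and F1: "\<And>x. cmod x < 1 \<Longrightarrow> cmod (F x) < 1"
    and \<tau>: "cmod \<tau> \<le> 1"
      "\<And>x. cmod x < 1 \<Longrightarrow> (cmod (1 - cnj \<tau> * F x))\<^sup>2 * (1 - (cmod x)\<^sup>2) \<le> (cmod (1 - cnj \<tau> * x))\<^sup>2 * (1 - (cmod (F x))\<^sup>2)"
    and \<sigma>: "cmod \<sigma> \<le> 1"
      "\<And>x. cmod x < 1 \<Longrightarrow> (cmod (1 - cnj \<sigma> * F x))\<^sup>2 * (1 - (cmod x)\<^sup>2) \<le> (cmod (1 - cnj \<sigma> * x))\<^sup>2 * (1 - (cmod (F x))\<^sup>2)"
    and z: "cmod z < 1" "F z \<noteq> z"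
  shows "\<tau> = \<sigma>"
proof (rule ccontr)
  assume ne: "\<tau> \<noteq> \<sigma>"
  note fix_point = horodisc_fixed_point[OF F1 \<tau> \<sigma> ne]
  let ?g = "\<lambda>s x. (1 - s) *\<^sub>R ((1 - cnj \<tau> * x) * (\<tau> - x)) + s *\<^sub>R ((1 - cnj \<sigma> * x) * (\<sigma> - x))"
  obtain x where x: "cmod x < 1" "F x = x" "?g (1/3) x = 0"
    using fix_point[of "1/3"] by (metis divide_less_eq_1_pos one_less_numeral_iff semiring_norm(77) zero_less_divide_1_iff zero_less_numeral)
  obtain y where y: "cmod y < 1" "F y = y" "?g (2/3) y = 0"
    by (rule fix_point[of "2/3"]) auto
  have "x = y"
    using Schwarz_Pick_two_fixed_points[OF F F1 x(1,2) y(1,2) _ z(1)] z(2) by blast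
  define a where "a = (1 - cnj \<tau> * x) * (\<tau> - x)"
  define b where "b = (1 - cnj \<sigma> * x) * (\<sigma> - x)"
  have "(1 - 1/3) *\<^sub>R a + (1/3) *\<^sub>R b = 0" "(1 - 2/3) *\<^sub>R a + (2/3) *\<^sub>R b = 0"
    using x(3) y(3) \<open>x = y\<close> by (simp_all only: a_def b_def)
  then have "2 * a + b = 0" "a + 2 * b = 0"
    by (auto simp: scaleR_conv_of_real field_simps)
  then have "3 * a = 0" "3 * b = 0" by algebra+
  then have "a = 0" "b = 0" by auto
  moreover have "1 - cnj \<tau> * x \<noteq> 0" "1 - cnj \<sigma> * x \<noteq> 0"
    using cnj_mult_neq_1[OF x(1) \<tau>(1)] cnj_mult_neq_1[OF x(1) \<sigma>(1)]
    by (metis complex_cnj_cnj complex_cnj_mult complex_cnj_one eq_iff_diff_eq_0 mult.commute)+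
  ultimately show False using ne by (simp add: a_def b_def)
qed

text \<open>Since \<open>w n\<close> is fixed by \<open>x \<mapsto> z n * E n x\<close>, the
  Schwarz-Pick inequality between \<open>w n\<close> and \<open>x\<close> has 1 - |w n|^2 on both
  sides. It is cancelled before n tends to infinity, so the limit is informative even for |\<tau>| =
  1, as in Wolff's lemma on horodiscs.\<close>

lemma horodisc_limit:
  assumes E: "\<And>n. E n holomorphic_on ball 0 1" "\<And>n x. cmod x < 1 \<Longrightarrow> cmod (E n x) \<le> 1"
    and lim: "\<And>x. cmod x < 1 \<Longrightarrow> (\<lambda>n. E n x) \<longlonglongrightarrow> G x"
    and z: "\<And>n. cmod (z n) < 1" "z \<longlonglongrightarrow> \<zeta>"
    and w: "\<And>n. cmod (w n) < 1" "\<And>n. w n = z n * E n (w n)" "w \<longlonglongrightarrow> \<tau>"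
    and x: "cmod x < 1"
  shows "(cmod (1 - cnj \<tau> * (\<zeta> * G x)))\<^sup>2 * (1 - (cmod x)\<^sup>2)
    \<le> (cmod (1 - cnj \<tau> * x))\<^sup>2 * (1 - (cmod (\<zeta> * G x))\<^sup>2)"
proof (rule tendsto_le)
  show "(\<lambda>n. (cmod (1 - cnj (w n) * (z n * E n x)))\<^sup>2 * (1 - (cmod x)\<^sup>2))
    \<longlonglongrightarrow> (cmod (1 - cnj \<tau> * (\<zeta> * G x)))\<^sup>2 * (1 - (cmod x)\<^sup>2)"
    by (intro tendsto_intros lim x z w)
  show "(\<lambda>n. (cmod (1 - cnj (w n) * x))\<^sup>2 * (1 - (cmod (z n * E n x))\<^sup>2))
    \<longlonglongrightarrow> (cmod (1 - cnj \<tau> * x))\<^sup>2 * (1 - (cmod (\<zeta> * G x))\<^sup>2)"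
    by (intro tendsto_intros lim x z w)
  have "(cmod (1 - cnj (w n) * (z n * E n x)))\<^sup>2 * (1 - (cmod x)\<^sup>2)
    \<le> (cmod (1 - cnj (w n) * x))\<^sup>2 * (1 - (cmod (z n * E n x))\<^sup>2)" for n
  proof -
    let ?F = "\<lambda>x. z n * E n x"
    have 1: "cmod (?F y) < 1" if "cmod y < 1" for y
      using mult_left_mono[OF E(2)[OF that, of n], of "cmod (z n)"] z(1)[of n]
      by (simp add: norm_mult)
    have 2: "?F holomorphic_on ball 0 1" by (intro holomorphic_intros E)
    have "(cmod (1 - cnj (w n) * ?F x))\<^sup>2 * (1 - (cmod x)\<^sup>2) * (1 - (cmod (w n))\<^sup>2)
      \<le> (cmod (1 - cnj (w n) * x))\<^sup>2 * (1 - (cmod (?F x))\<^sup>2) * (1 - (cmod (w n))\<^sup>2)"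
      using Schwarz_Pick[OF 2 1 w(1)[of n] x] unfolding w(2)[symmetric] by (simp only: mult_ac)
    then show ?thesis
      using cmod_less_1_power2[OF w(1)[of n]] by (simp only: mult_le_cancel_right_pos)
  qed
  then show "\<forall>\<^sub>F n in sequentially. (cmod (1 - cnj (w n) * (z n * E n x)))\<^sup>2 * (1 - (cmod x)\<^sup>2)
    \<le> (cmod (1 - cnj (w n) * x))\<^sup>2 * (1 - (cmod (z n * E n x))\<^sup>2)" by simp
qed simp

text \<open>Both limits satisfy the horodisc inequality for the same map
  \<open>x \<mapsto> \<zeta> * G x\<close>. Two families \<open>E\<close> and \<open>E'\<close> are
  allowed so that one statement compares either two points under one map or a sequence of maps with
  its limit.\<close>

lemma fixed_point_limit_unique:
  assumes G: "G holomorphic_on ball 0 1" "G 0 \<noteq> 0"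
    and E: "\<And>n. E n holomorphic_on ball 0 1" "\<And>n x. cmod x < 1 \<Longrightarrow> cmod (E n x) \<le> 1"
      "\<And>x. cmod x < 1 \<Longrightarrow> (\<lambda>n. E n x) \<longlonglongrightarrow> G x"
    and E': "\<And>n. E' n holomorphic_on ball 0 1" "\<And>n x. cmod x < 1 \<Longrightarrow> cmod (E' n x) \<le> 1"
      "\<And>x. cmod x < 1 \<Longrightarrow> (\<lambda>n. E' n x) \<longlonglongrightarrow> G x"
    and z: "\<And>n. cmod (z n) < 1" "z \<longlonglongrightarrow> \<zeta>" and z': "\<And>n. cmod (z' n) < 1" "z' \<longlonglongrightarrow> \<zeta>"
    and w: "\<And>n. cmod (w n) < 1" "\<And>n. w n = z n * E n (w n)" "w \<longlonglongrightarrow> \<tau>"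
    and w': "\<And>n. cmod (w' n) < 1" "\<And>n. w' n = z' n * E' n (w' n)" "w' \<longlonglongrightarrow> \<sigma>"
  shows "\<tau> = \<sigma>"
proof -
  have \<tau>1: "cmod \<tau> \<le> 1"
    by (rule tendsto_upperbound[OF tendsto_norm[OF w(3)]]) (auto intro!: always_eventually less_imp_le w(1))
  have \<sigma>1: "cmod \<sigma> \<le> 1"
    by (rule tendsto_upperbound[OF tendsto_norm[OF w'(3)]]) (auto intro!: always_eventually less_imp_le w'(1))
  have \<zeta>1: "cmod \<zeta> \<le> 1"
    by (rule tendsto_upperbound[OF tendsto_norm[OF z(2)]]) (auto intro!: always_eventually less_imp_le z(1))
  have G1: "cmod (G x) \<le> 1" if "cmod x < 1" for x
    by (rule tendsto_upperbound[OF tendsto_norm[OF E(3)[OF that]]]) (auto intro!: always_eventually E(2) that)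
  have \<tau>: "(cmod (1 - cnj \<tau> * (\<zeta> * G x)))\<^sup>2 * (1 - (cmod x)\<^sup>2)
    \<le> (cmod (1 - cnj \<tau> * x))\<^sup>2 * (1 - (cmod (\<zeta> * G x))\<^sup>2)" if "cmod x < 1" for x
    by (rule horodisc_limit[of E G z \<zeta> w]) (rule E z w that | assumption)+
  have \<sigma>: "(cmod (1 - cnj \<sigma> * (\<zeta> * G x)))\<^sup>2 * (1 - (cmod x)\<^sup>2)
    \<le> (cmod (1 - cnj \<sigma> * x))\<^sup>2 * (1 - (cmod (\<zeta> * G x))\<^sup>2)" if "cmod x < 1" for x
    by (rule horodisc_limit[of E' G z' \<zeta> w']) (rule E' z' w' that | assumption)+
  have F1: "cmod (\<zeta> * G x) \<le> 1" if "cmod x < 1" for x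
    using \<zeta>1 G1[OF that] by (simp add: norm_mult mult_le_one)
  show ?thesis
  proof (cases "\<exists>x. cmod x < 1 \<and> cmod (\<zeta> * G x) = 1")
    case True
    then obtain x where x: "cmod x < 1" "cmod (\<zeta> * G x) = 1" by blast
    let ?c = "\<zeta> * G x"
    \<comment> \<open>In the degenerate case the limit map reaches the circle at \<open>x\<close>.
      The right-hand side of the horodisc inequality is then 0, which determines its centre
      directly.\<close>
    have *: "t = ?c" if le: "(cmod (1 - cnj t * ?c))\<^sup>2 * (1 - (cmod x)\<^sup>2)
       \<le> (cmod (1 - cnj t * x))\<^sup>2 * (1 - (cmod ?c)\<^sup>2)" for t
    proof -
      have "(cmod (1 - cnj t * ?c))\<^sup>2 \<le> 0"
        using le cmod_less_1_power2[OF x(1)] unfolding x(2) by (simp add: mult_le_0_iff)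
      then have "cnj t * ?c = 1" by simp
      moreover have "cnj ?c * ?c = 1"
        using x(2) complex_norm_square[of ?c] by (simp add: mult.commute)
      moreover have "?c \<noteq> 0" using x(2) by (metis norm_zero zero_neq_one)
      ultimately have "cnj t = cnj ?c" by (metis mult_right_cancel)
      then show "t = ?c" by (metis complex_cnj_cnj)
    qed
    show ?thesis using *[OF \<tau>[OF x(1)]] *[OF \<sigma>[OF x(1)]] by simp
  next
    case False
    then have F2: "cmod (\<zeta> * G x) < 1" if "cmod x < 1" for x
      using F1[OF that] that by force
    \<comment> \<open>The limit map is not the identity: it is constantly 0 if \<zeta> = 0, and
      otherwise it moves 0 because \<open>G 0\<close> is nonzero.\<close>
    have "\<exists>x. cmod x < 1 \<and> \<zeta> * G x \<noteq> x"
    proof (cases "\<zeta> = 0")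
      case True
      then show ?thesis by (intro exI[of _ "1/2"]) auto
    next
      case False
      then show ?thesis using G(2) by (intro exI[of _ 0]) auto
    qed
    then obtain x where "cmod x < 1" "\<zeta> * G x \<noteq> x" by blast
    moreover have "(\<lambda>x. \<zeta> * G x) holomorphic_on ball 0 1" by (intro holomorphic_intros G)
    ultimately show ?thesis
      by (intro horodisc_center_unique[of "\<lambda>x. \<zeta> * G x" \<tau> \<sigma> x] F2 \<tau>1 \<sigma>1 \<tau> \<sigma>)
  qed
qed

text \<open>If the differences stayed away from 0, compactness would give a subsequence along which
  \<open>z\<close>, \<open>w\<close> and \<open>w'\<close> converge, against
  \<open>fixed_point_limit_unique\<close>. Only \<open>z n - z' n\<close> has to converge, so the
  base points may approach the circle without settling; this is the sequential form of uniform
  continuity and of uniform convergence.\<close>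

lemma fixed_points_close:
  assumes G: "G holomorphic_on ball 0 1" "G 0 \<noteq> 0"
    and E: "\<And>n. E n holomorphic_on ball 0 1" "\<And>n x. cmod x < 1 \<Longrightarrow> cmod (E n x) \<le> 1"
      "\<And>x. cmod x < 1 \<Longrightarrow> (\<lambda>n. E n x) \<longlonglongrightarrow> G x"
    and E': "\<And>n. E' n holomorphic_on ball 0 1" "\<And>n x. cmod x < 1 \<Longrightarrow> cmod (E' n x) \<le> 1"
      "\<And>x. cmod x < 1 \<Longrightarrow> (\<lambda>n. E' n x) \<longlonglongrightarrow> G x"
    and z: "\<And>n. cmod (z n) < 1" "\<And>n. cmod (z' n) < 1" "(\<lambda>n. z n - z' n) \<longlonglongrightarrow> 0"
    and w: "\<And>n. cmod (w n) < 1" "\<And>n. w n = z n * E n (w n)"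
    and w': "\<And>n. cmod (w' n) < 1" "\<And>n. w' n = z' n * E' n (w' n)"
  shows "(\<lambda>n. w n - w' n) \<longlonglongrightarrow> 0"
proof (rule ccontr)
  assume "\<not> ?thesis"
  then obtain e where e: "e > 0" "\<not> (\<forall>\<^sub>F n in sequentially. dist (w n - w' n) 0 < e)"
    unfolding tendsto_iff by auto
  from e(2) have inf: "infinite {n. \<not> dist (w n - w' n) 0 < e}"
    unfolding cofinite_eq_sequentially[symmetric] eventually_cofinite .
  obtain r :: "nat \<Rightarrow> nat" where r: "strict_mono r" "\<forall>n. r n \<in> {n. \<not> dist (w n - w' n) 0 < e}"
    using infinite_enumerate[OF inf] by blast
  have "bounded (range (\<lambda>n. (w (r n), w' (r n), z (r n))))"
  proof (rule bounded_subset)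
    show "bounded (ball 0 1 \<times> ball 0 1 \<times> (ball 0 1 :: complex set) :: (complex \<times> complex \<times> complex) set)" by (intro bounded_Times) auto
  qed (use z(1) w(1) w'(1) in auto)
  then obtain l s where s: "strict_mono s" "((\<lambda>n. (w (r n), w' (r n), z (r n))) \<circ> s) \<longlonglongrightarrow> l"
    using bounded_imp_convergent_subsequence by blast
  obtain \<tau> \<sigma> \<zeta> where l: "l = (\<tau>, \<sigma>, \<zeta>)" by (cases l) auto
  define t where "t = r \<circ> s"
  have t: "strict_mono t" using r(1) s(1) by (simp add: t_def strict_mono_o)
  have lims: "(\<lambda>n. w (t n)) \<longlonglongrightarrow> \<tau>" "(\<lambda>n. w' (t n)) \<longlonglongrightarrow> \<sigma>" "(\<lambda>n. z (t n)) \<longlonglongrightarrow> \<zeta>"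
    using tendsto_fst[OF s(2)] tendsto_fst[OF tendsto_snd[OF s(2)]] tendsto_snd[OF tendsto_snd[OF s(2)]]
    by (auto simp: l t_def o_def)
  have "(\<lambda>n. z (t n) - z' (t n)) \<longlonglongrightarrow> 0"
    using LIMSEQ_subseq_LIMSEQ[OF z(3) t] by (simp add: o_def)
  then have z't: "(\<lambda>n. z' (t n)) \<longlonglongrightarrow> \<zeta>"
    using tendsto_diff[OF lims(3)] by force
  have Et: "(\<lambda>n. E (t n) x) \<longlonglongrightarrow> G x" "(\<lambda>n. E' (t n) x) \<longlonglongrightarrow> G x" if "cmod x < 1" for x
    using LIMSEQ_subseq_LIMSEQ[OF E(3)[OF that] t] LIMSEQ_subseq_LIMSEQ[OF E'(3)[OF that] t] by (auto simp: o_def)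
  have "\<tau> = \<sigma>"
    by (rule fixed_point_limit_unique[OF G, of "\<lambda>n. E (t n)" "\<lambda>n. E' (t n)" "\<lambda>n. z (t n)" \<zeta> "\<lambda>n. z' (t n)"
          "\<lambda>n. w (t n)" _ "\<lambda>n. w' (t n)"]) (rule E E' Et z lims z't w w' | assumption)+
  then have "(\<lambda>n. w (t n) - w' (t n)) \<longlonglongrightarrow> 0"
    using tendsto_diff[OF lims(1,2)] by simp
  then obtain n where "dist (w (t n) - w' (t n)) 0 < e"
    using e(1) unfolding tendsto_iff by (meson eventually_happens sequentially_bot)
  then show False using spec[OF r(2), of "s n"] by (simp add: t_def)
qed

section \<open>The functions psi and eta\<close>

lemma circle_probsD:
  assumes "M \<in> circle_probs"
  shows "prob_space M" "sets M = sets circle_borel" "space M = sphere 0 1"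
  using assms sets_eq_imp_space_eq[of M circle_borel]
  by (auto simp: circle_probs_def circle_borel_def space_restrict_space)

lemma borel_measurable_circle:
  fixes f :: "complex \<Rightarrow> 'b :: topological_space"
  assumes "sets M = sets circle_borel" "continuous_on (sphere 0 1) f"
  shows "f \<in> borel_measurable M"
  using borel_measurable_continuous_on_restrict[OF assms(2)]
  unfolding measurable_cong_sets[OF assms(1) refl] circle_borel_def .

lemma integrable_circle:
  fixes f :: "complex \<Rightarrow> 'b :: {banach, second_countable_topology}"
  assumes M: "finite_measure M" "sets M = sets circle_borel" and f: "continuous_on (sphere 0 1) f"
  shows "integrable M f"
proof -
  have "bounded (f ` sphere 0 1)"
    by (intro compact_imp_bounded compact_continuous_image f) simp
  then obtain B where "\<forall>y \<in> f ` sphere 0 1. norm y \<le> B"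
    unfolding bounded_iff ..
  then have B: "norm (f t) \<le> B" if "t \<in> sphere 0 1" for t using that by simp
  have sp: "space M = sphere 0 1"
    using sets_eq_imp_space_eq[OF M(2)] by (simp add: circle_borel_def space_restrict_space)
  show ?thesis
    by (rule finite_measure.integrable_const_bound[OF M(1), of _ B])
      (auto simp: sp B borel_measurable_circle[OF M(2) f])
qed

lemma integrable_circle_probs:
  fixes f :: "complex \<Rightarrow> 'b :: {banach, second_countable_topology}"
  assumes "M \<in> circle_probs" "continuous_on (sphere 0 1) f"
  shows "integrable M f"
  by (meson assms circle_probsD(1,2) integrable_circle prob_space.finite_measure)

lemma one_minus_mult_bound:
  fixes t z :: complex
  assumes "t \<in> sphere 0 1"
  shows "1 - cmod z \<le> cmod (1 - t * z)"
  using norm_triangle_ineq2[of 1 "t * z"] assms by (simp add: norm_mult)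

lemma one_minus_mult_neq_0:
  fixes t z :: complex
  assumes "t \<in> sphere 0 1" "cmod z < 1"
  shows "1 - t * z \<noteq> 0"
  using one_minus_mult_bound[OF assms(1), of z] assms(2) by auto

lemma continuous_on_psi_integrand:
  "cmod z < 1 \<Longrightarrow> continuous_on (sphere 0 1) (\<lambda>t. t * z / (1 - t * z))"
  by (intro continuous_intros) (use one_minus_mult_neq_0 in auto)

text \<open>The difference quotient of the integrand is exactly t / ((1 - t X) (1 - t z)), so the
  derivative is a limit of integrals. On the smaller disc of radius r < 1 these integrands are
  dominated by the constant 1 / (1 - r)^2.\<close>

lemma psi_has_field_derivative:
  assumes M: "M \<in> circle_probs" and z: "cmod z < 1"
  shows "(psi M has_field_derivative (LINT t|M. t / ((1 - t * z) * (1 - t * z)))) (at z)"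
proof -
  obtain r where r: "cmod z < r" "r < 1" using z dense by blast
  have "(psi M has_field_derivative (LINT t|M. t / ((1 - t * z) * (1 - t * z)))) (at z within ball 0 r)"
    unfolding has_field_derivative_iff tendsto_at_iff_sequentially
  proof (intro allI impI)
    fix X assume X: "\<forall>i. X i \<in> ball 0 r - {z}" "X \<longlonglongrightarrow> z"
    have Xr: "cmod (X i) < r" "X i \<noteq> z" for i using X(1) by auto
    have X1: "cmod (X i) < 1" for i using Xr(1)[of i] r by simp
    have eq: "(psi M (X i) - psi M z) / (X i - z) = (LINT t|M. t / ((1 - t * X i) * (1 - t * z)))" for i
    proof -
      have "psi M (X i) - psi M z = (LINT t|M. t * X i / (1 - t * X i) - t * z / (1 - t * z))"
        unfolding psi_def
        by (intro Bochner_Integration.integral_diff[symmetric] integrable_circle_probs[OF M]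
            continuous_on_psi_integrand z X1)
      also have "\<dots> = (LINT t|M. (X i - z) * (t / ((1 - t * X i) * (1 - t * z))))"
      proof (intro Bochner_Integration.integral_cong refl)
        fix t assume "t \<in> space M"
        then have "t \<in> sphere 0 1" by (simp only: circle_probsD(3)[OF M])
        then have "1 - t * X i \<noteq> 0" "1 - t * z \<noteq> 0"
          using one_minus_mult_neq_0[OF _ X1] one_minus_mult_neq_0[OF _ z] by blast+
        note diff_frac_eq[OF this, of "t * X i" "t * z"]
        also have "t * X i * (1 - t * z) - t * z * (1 - t * X i) = (X i - z) * t"
          by (simp add: algebra_simps)
        finally show "t * X i / (1 - t * X i) - t * z / (1 - t * z) = (X i - z) * (t / ((1 - t * X i) * (1 - t * z)))"
          by (simp only: times_divide_eq_right)
      qed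
      also have "\<dots> = (X i - z) * (LINT t|M. t / ((1 - t * X i) * (1 - t * z)))"
        by (rule integral_mult_right_zero)
      finally have *: "psi M (X i) - psi M z = (X i - z) * (LINT t|M. t / ((1 - t * X i) * (1 - t * z)))" .
      have "X i - z \<noteq> 0" using Xr(2)[of i] by simp
      then show ?thesis unfolding * by (rule nonzero_mult_div_cancel_left)
    qed
    have "(\<lambda>i. LINT t|M. t / ((1 - t * X i) * (1 - t * z))) \<longlonglongrightarrow> (LINT t|M. t / ((1 - t * z) * (1 - t * z)))"
    proof (rule integral_dominated_convergence[where w="\<lambda>_. 1 / ((1 - r) * (1 - r))"])
      show "AE t in M. (\<lambda>i. t / ((1 - t * X i) * (1 - t * z))) \<longlonglongrightarrow> t / ((1 - t * z) * (1 - t * z))"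
      proof (intro AE_I2 tendsto_intros X(2))
        fix t assume "t \<in> space M"
        then show "(1 - t * z) * (1 - t * z) \<noteq> 0"
          using one_minus_mult_neq_0 z by (auto simp: circle_probsD[OF M])
      qed
      show "AE t in M. cmod (t / ((1 - t * X i) * (1 - t * z))) \<le> 1 / ((1 - r) * (1 - r))" for i
      proof (intro AE_I2)
        fix t assume "t \<in> space M"
        then have t: "t \<in> sphere 0 1" by (simp add: circle_probsD[OF M])
        have "(1 - r) * (1 - r) \<le> cmod (1 - t * X i) * cmod (1 - t * z)"
          using one_minus_mult_bound[OF t, of "X i"] one_minus_mult_bound[OF t, of z] Xr(1)[of i] r
          by (intro mult_mono) auto
        moreover have "cmod (t / ((1 - t * X i) * (1 - t * z))) = 1 / (cmod (1 - t * X i) * cmod (1 - t * z))"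
          using t by (simp add: norm_divide norm_mult)
        moreover have "0 < (1 - r) * (1 - r)" using r by simp
        ultimately show "cmod (t / ((1 - t * X i) * (1 - t * z))) \<le> 1 / ((1 - r) * (1 - r))"
          by (metis frac_le order_refl zero_le_one)
      qed
      show "integrable M (\<lambda>_. 1 / ((1 - r) * (1 - r)))"
        by (intro integrable_circle_probs[OF M] continuous_intros)
      show "(\<lambda>t. t / ((1 - t * z) * (1 - t * z))) \<in> borel_measurable M"
        by (intro borel_measurable_circle circle_probsD[OF M] continuous_intros)
          (use one_minus_mult_neq_0[OF _ z] in simp)
      show "(\<lambda>t. t / ((1 - t * X i) * (1 - t * z))) \<in> borel_measurable M" for i
        by (intro borel_measurable_circle circle_probsD[OF M] continuous_intros)
          (use one_minus_mult_neq_0[OF _ z] one_minus_mult_neq_0[OF _ X1] in simp)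
    qed
    then show "((\<lambda>y. (psi M y - psi M z) / (y - z)) \<circ> X) \<longlonglongrightarrow> (LINT t|M. t / ((1 - t * z) * (1 - t * z)))"
      by (simp add: o_def eq)
  qed
  moreover have "at z within ball 0 r = at z"
    using r by (intro at_within_open) auto
  ultimately show ?thesis by (simp only:)
qed

lemma Re_Cayley:
  fixes w :: complex
  assumes "w \<noteq> 1"
  shows "Re ((1 + w) / (1 - w)) = (1 - (cmod w)\<^sup>2) / (cmod (1 - w))\<^sup>2"
  using assms unfolding Re_divide cmod_power2
  by (simp add: power2_eq_square algebra_simps)

text \<open>The function 1 + 2 \<open>psi M\<close> is the Herglotz integral of (1 + t z) / (1 - t
  z), whose real part is the Poisson kernel. Positivity follows from |1 - t z| <= 2, which bounds
  the kernel below by (1 - |z|^2) / 4.\<close>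

lemma psi_Poisson:
  assumes M: "M \<in> circle_probs" and z: "cmod z < 1"
  shows "Re (1 + 2 * psi M z) = (LINT t|M. (1 - (cmod z)\<^sup>2) / (cmod (1 - t * z))\<^sup>2)"
    and "0 < Re (1 + 2 * psi M z)"
proof -
  interpret prob_space M by (rule circle_probsD[OF M])
  have int: "integrable M (\<lambda>t. t * z / (1 - t * z))"
    by (intro integrable_circle_probs[OF M] continuous_on_psi_integrand z)
  have int2: "integrable M (\<lambda>t. (1 - (cmod z)\<^sup>2) / (cmod (1 - t * z))\<^sup>2)"
    by (intro integrable_circle_probs[OF M] continuous_intros) (use one_minus_mult_neq_0 z in auto)
  have int': "integrable M (\<lambda>t. 2 * (t * z / (1 - t * z)))"
    by (rule integrable_mult_right[OF int])
  have "(LINT t|M. 1 + 2 * (t * z / (1 - t * z))) = (LINT t|M. 1) + (LINT t|M. 2 * (t * z / (1 - t * z)))"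
    by (rule Bochner_Integration.integral_add[OF _ int']) simp
  also have "(LINT t|M. 2 * (t * z / (1 - t * z))) = 2 * psi M z"
    unfolding psi_def by (rule integral_mult_right_zero)
  also have "(LINT t|M. 1 :: complex) = 1" by (simp add: prob_space)
  finally have "1 + 2 * psi M z = (LINT t|M. 1 + 2 * (t * z / (1 - t * z)))" ..
  also have "Re \<dots> = (LINT t|M. Re (1 + 2 * (t * z / (1 - t * z))))"
    by (rule integral_Re[symmetric]) (rule Bochner_Integration.integrable_add[OF _ int'], simp)
  also have "\<dots> = (LINT t|M. (1 - (cmod z)\<^sup>2) / (cmod (1 - t * z))\<^sup>2)"
  proof (intro Bochner_Integration.integral_cong refl)
    fix t assume "t \<in> space M"
    then have t: "t \<in> sphere 0 1" by (simp add: circle_probsD[OF M])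
    have nz: "1 - t * z \<noteq> 0" using one_minus_mult_neq_0[OF t z] .
    then have "1 + 2 * (t * z / (1 - t * z)) = (1 + t * z) / (1 - t * z)"
      by (simp add: field_simps)
    then show "Re (1 + 2 * (t * z / (1 - t * z))) = (1 - (cmod z)\<^sup>2) / (cmod (1 - t * z))\<^sup>2"
      using Re_Cayley[of "t * z"] nz t by (simp add: norm_mult)
  qed
  finally show 1: "Re (1 + 2 * psi M z) = (LINT t|M. (1 - (cmod z)\<^sup>2) / (cmod (1 - t * z))\<^sup>2)" .
  have pos: "0 < 1 - (cmod z)\<^sup>2" using z by (simp add: abs_square_less_1)
  have "(1 - (cmod z)\<^sup>2) / 2\<^sup>2 \<le> (LINT t|M. (1 - (cmod z)\<^sup>2) / (cmod (1 - t * z))\<^sup>2)"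
  proof (rule integral_ge_const[OF int2], rule AE_I2)
    fix t assume "t \<in> space M"
    then have t: "t \<in> sphere 0 1" by (simp add: circle_probsD[OF M])
    have "cmod (1 - t * z) \<le> 2"
      using norm_triangle_ineq4[of 1 "t * z"] t z by (simp add: norm_mult)
    then have "(cmod (1 - t * z))\<^sup>2 \<le> 2\<^sup>2" by (intro power_mono) auto
    then show "(1 - (cmod z)\<^sup>2) / 2\<^sup>2 \<le> (1 - (cmod z)\<^sup>2) / (cmod (1 - t * z))\<^sup>2"
      using one_minus_mult_neq_0[OF t z] pos by (intro divide_left_mono) auto
  qed
  then show "0 < Re (1 + 2 * psi M z)" unfolding 1 using pos by simp
qed

lemma psi_add_1_neq_0:
  assumes "M \<in> circle_probs" "cmod z < 1"
  shows "1 + psi M z \<noteq> 0"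
  using psi_Poisson(2)[OF assms] by (auto simp: complex_eq_iff)

lemma psi_holomorphic: "M \<in> circle_probs \<Longrightarrow> psi M holomorphic_on ball 0 1"
  unfolding holomorphic_on_open[OF open_ball] mem_ball_0
  by (intro ballI exI, rule psi_has_field_derivative) simp_all

lemma eta_holomorphic: "M \<in> circle_probs \<Longrightarrow> eta M holomorphic_on ball 0 1"
  unfolding eta_def by (intro holomorphic_intros psi_holomorphic) (auto simp: psi_add_1_neq_0)

lemma eta_0: "eta M 0 = 0"
  by (simp add: eta_def psi_def)

text \<open>The inequality |\<psi>| < |1 + \<psi>| says precisely that 1 + 2 \<psi> has positive
  real part.\<close>

lemma cmod_eta_less_1:
  assumes "M \<in> circle_probs" "cmod z < 1"
  shows "cmod (eta M z) < 1"
proof -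
  have "(cmod (psi M z))\<^sup>2 < (cmod (1 + psi M z))\<^sup>2"
    using psi_Poisson(2)[OF assms] unfolding cmod_power2 by (simp add: power2_eq_square algebra_simps)
  then have "cmod (psi M z) < cmod (1 + psi M z)"
    by (rule power_less_imp_less_base) simp
  then show ?thesis by (simp add: eta_def norm_divide psi_add_1_neq_0[OF assms])
qed

lemma cmod_eta_le:
  assumes "M \<in> circle_probs" "cmod z < 1"
  shows "cmod (eta M z) \<le> cmod z"
  using Schwarz_Lemma(1)[OF eta_holomorphic[OF assms(1)] eta_0 cmod_eta_less_1[OF assms(1)] assms(2)]
  by simp

text \<open>This connects the density formula, which is written in terms of eta, with the Poisson
  integral of \<open>M\<close>.\<close>

lemma eta_Cayley:
  assumes "M \<in> circle_probs" "cmod z < 1"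
  shows "(1 + eta M z) / (1 - eta M z) = 1 + 2 * psi M z"
  using psi_add_1_neq_0[OF assms] by (simp add: eta_def field_simps)

lemma eta_has_field_derivative_0:
  assumes "M \<in> circle_probs"
  shows "(eta M has_field_derivative circle_mean M) (at 0)"
proof -
  have "psi M 0 = 0" by (simp add: psi_def)
  then show ?thesis
    using psi_has_field_derivative[OF assms, of 0] unfolding eta_def circle_mean_def
    by (auto intro!: derivative_eq_intros)
qed

section \<open>Weak convergence and pointwise convergence of eta in the disc\<close>

lemma circle_weak_conv_complex:
  fixes f :: "complex \<Rightarrow> complex"
  assumes "circle_weak_conv Ms M" and Ms: "\<And>n. Ms n \<in> circle_probs" and M: "M \<in> circle_probs"
    and f: "continuous_on (sphere 0 1) f"
  shows "(\<lambda>n. LINT t|Ms n. f t) \<longlonglongrightarrow> (LINT t|M. f t)"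
proof -
  have "(\<lambda>n. LINT t|Ms n. Re (f t)) \<longlonglongrightarrow> (LINT t|M. Re (f t))"
    "(\<lambda>n. LINT t|Ms n. Im (f t)) \<longlonglongrightarrow> (LINT t|M. Im (f t))"
    using assms(1) f unfolding circle_weak_conv_def by (auto intro!: continuous_intros)
  then show ?thesis
    unfolding tendsto_complex_iff
    using integrable_circle_probs[OF Ms f] integrable_circle_probs[OF M f] by simp
qed

lemma circle_weak_conv_eta:
  assumes "circle_weak_conv Ms M" "\<And>n. Ms n \<in> circle_probs" "M \<in> circle_probs" "cmod z < 1"
  shows "(\<lambda>n. eta (Ms n) z) \<longlonglongrightarrow> eta M z"
  unfolding eta_def psi_def
  by (intro tendsto_intros circle_weak_conv_complex[OF assms(1-3)] continuous_on_psi_integrand assms(4))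
    (use psi_add_1_neq_0[OF assms(3,4)] in \<open>simp add: psi_def\<close>)

section \<open>Poisson integrals on the circle\<close>

lemma sets_arclength: "sets arclength = sets circle_borel"
  and space_arclength: "space arclength = sphere 0 1"
  by (auto simp: arclength_def circle_borel_def space_restrict_space)

lemma cis_measurable: "cis \<in> measurable (restrict_space lborel {0..<2*pi}) circle_borel"
proof -
  have "cis \<in> borel_measurable borel"
    by (intro borel_measurable_continuous_onI continuous_intros)
  then have "cis \<in> measurable (restrict_space lborel {0..<2*pi}) borel"
    by (intro measurable_restrict_space1) simp
  then show ?thesis unfolding circle_borel_def by (intro measurable_restrict_space2) auto
qed

lemma finite_measure_arclength: "finite_measure arclength"
  unfolding arclength_def
  by (intro finite_measure.finite_measure_distr cis_measurable)
    (auto intro!: finite_measureI simp: emeasure_restrict_space space_restrict_space)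

lemma measure_arclength: "measure arclength (space arclength) = 2 * pi"
proof -
  have "measure arclength (space circle_borel) = measure (restrict_space lborel {0..<2*pi}) {0..<2*pi}"
    unfolding arclength_def
    by (subst measure_distr[OF cis_measurable sets.top])
      (auto simp: space_restrict_space circle_borel_def vimage_def intro!: arg_cong2[where f=measure])
  also have "\<dots> = 2 * pi" by (simp add: measure_restrict_space)
  finally show ?thesis by (simp add: space_arclength circle_borel_def space_restrict_space)
qed

lemma integrable_arclength:
  fixes f :: "complex \<Rightarrow> 'b :: {banach, second_countable_topology}"
  shows "continuous_on (sphere 0 1) f \<Longrightarrow> integrable arclength f"
  by (intro integrable_circle finite_measure_arclength sets_arclength)

text \<open>The half-open interval in \<open>arclength\<close> counts each angle once, whereas the
  fundamental theorem of calculus wants a closed one; they differ by a null set.\<close>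

lemma integral_arclength:
  fixes f :: "complex \<Rightarrow> 'b :: {banach, second_countable_topology}"
  assumes "f \<in> borel_measurable circle_borel"
  shows "(LINT \<xi>|arclength. f \<xi>) = (LINT \<theta>|lborel. indicator {0..2*pi} \<theta> *\<^sub>R f (cis \<theta>))"
proof -
  have "(LINT \<xi>|arclength. f \<xi>) = (LINT \<theta>|restrict_space lborel {0..<2*pi}. f (cis \<theta>))"
    unfolding arclength_def by (rule integral_distr[OF cis_measurable assms])
  also have "\<dots> = (LINT \<theta>|lborel. indicator {0..<2*pi} \<theta> *\<^sub>R f (cis \<theta>))"
    by (rule integral_restrict_space) simp
  also have "\<dots> = (LINT \<theta>|lborel. indicator {0..2*pi} \<theta> *\<^sub>R f (cis \<theta>))"
  proof (rule integral_cong_AE)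
    have m: "(\<lambda>\<theta>. f (cis \<theta>)) \<in> borel_measurable (restrict_space lborel {0..<2*pi})"
      by (rule measurable_compose[OF cis_measurable assms])
    then show 1: "(\<lambda>\<theta>. indicator {0..<2*pi} \<theta> *\<^sub>R f (cis \<theta>)) \<in> borel_measurable lborel"
      by (subst (asm) borel_measurable_restrict_space_iff) auto
    have eq: "indicator {0..2*pi} \<theta> *\<^sub>R f (cis \<theta>)
        = indicator {0..<2*pi} \<theta> *\<^sub>R f (cis \<theta>) + indicator {2*pi} \<theta> *\<^sub>R f 1" for \<theta>
      by (auto simp: indicator_def)
    show "(\<lambda>\<theta>. indicator {0..2*pi} \<theta> *\<^sub>R f (cis \<theta>)) \<in> borel_measurable lborel"
      unfolding eq using 1 by measurable
    have "AE \<theta> in lborel. \<theta> \<noteq> 2*pi" by (rule AE_lborel_singleton)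
    then show "AE \<theta> in lborel. indicator {0..<2*pi} \<theta> *\<^sub>R f (cis \<theta>) = indicator {0..2*pi} \<theta> *\<^sub>R f (cis \<theta>)"
      by eventually_elim (auto simp: indicator_def)
  qed
  finally show ?thesis .
qed

text \<open>The integrand has the antiderivative i Ln (1 - cis \<theta> z) in the angle. The
  principal branch is legitimate because 1 - cis \<theta> z has positive real part, and periodicity
  makes the boundary terms cancel.\<close>

lemma integral_arclength_psi_integrand:
  assumes z: "cmod z < 1"
  shows "(LINT \<xi>|arclength. \<xi> * z / (1 - \<xi> * z)) = 0"
proof -
  have nz: "1 - cis \<theta> * z \<noteq> 0" for \<theta>
    using one_minus_mult_neq_0[of "cis \<theta>" z] z by simp
  have pos: "1 - cis \<theta> * z \<notin> \<real>\<^sub>\<le>\<^sub>0" for \<theta>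
  proof -
    have "Re (cis \<theta> * z) \<le> cmod z"
      using complex_Re_le_cmod[of "cis \<theta> * z"] by (simp add: norm_mult)
    then have "Re (1 - cis \<theta> * z) > 0" using z by simp
    then show ?thesis using complex_nonpos_Reals_iff by force
  qed
  define G where "G = (\<lambda>\<theta>. \<i> * Ln (1 - cis \<theta> * z))"
  have "(LINT \<xi>|arclength. \<xi> * z / (1 - \<xi> * z))
      = (LINT \<theta>|lborel. indicator {0..2*pi} \<theta> *\<^sub>R (cis \<theta> * z / (1 - cis \<theta> * z)))"
    by (intro integral_arclength borel_measurable_circle continuous_on_psi_integrand z refl)
  also have "\<dots> = G (2*pi) - G 0"
  proof (rule integral_FTC_Icc)
    show "continuous_on {0..2*pi} (\<lambda>\<theta>. cis \<theta> * z / (1 - cis \<theta> * z))"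
      by (intro continuous_intros) (use nz in auto)
    show "(G has_vector_derivative cis \<theta> * z / (1 - cis \<theta> * z)) (at \<theta> within {0..2*pi})" for \<theta>
    proof -
      have "((\<lambda>w. \<i> * Ln (1 - w * z)) has_field_derivative (- \<i> * z / (1 - cis \<theta> * z))) (at (cis \<theta>))"
        using pos[of \<theta>] by (auto intro!: derivative_eq_intros simp: field_simps)
      moreover have "(cis has_vector_derivative (\<i> * cis \<theta>)) (at \<theta>)"
        unfolding has_vector_derivative_def by (auto intro!: derivative_eq_intros)
      ultimately have "(G has_vector_derivative (\<i> * cis \<theta>) * (- \<i> * z / (1 - cis \<theta> * z))) (at \<theta>)"
        using field_vector_diff_chain_at by (fastforce simp: G_def o_def)
      moreover have "(\<i> * cis \<theta>) * (- \<i> * z / (1 - cis \<theta> * z)) = cis \<theta> * z / (1 - cis \<theta> * z)"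
        by (simp add: algebra_simps)
      ultimately show ?thesis using has_vector_derivative_at_within by metis
    qed
  qed simp
  also have "\<dots> = 0" by (simp add: G_def)
  finally show ?thesis .
qed

text \<open>The conjugate on \<xi> matches the conventions: \<open>psi\<close> integrates against 1
  - t z, and the density at \<xi> is read off at z = r cnj \<xi>. In this form the kernel peaks at
  \<xi> = t.\<close>

definition Poisson :: "real \<Rightarrow> complex \<Rightarrow> complex \<Rightarrow> real" where
  "Poisson r t \<xi> = (1 - r\<^sup>2) / (cmod (1 - t * (of_real r * cnj \<xi>)))\<^sup>2"

lemma Poisson_nonneg: "0 \<le> r \<Longrightarrow> r < 1 \<Longrightarrow> 0 \<le> Poisson r t \<xi>"
  by (simp add: Poisson_def abs_square_le_1)

lemma continuous_on_Poisson:
  assumes "t \<in> sphere 0 1" "0 \<le> r" "r < 1"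
  shows "continuous_on (sphere 0 1) (Poisson r t)"
  unfolding Poisson_def
  by (intro continuous_intros)
    (use one_minus_mult_neq_0[OF assms(1)] assms in \<open>auto simp: norm_mult\<close>)

text \<open>By symmetry the roles of t and \<xi> can be exchanged: with z = r cnj t the kernel is 1
  + 2 Re (\<xi> z / (1 - \<xi> z)), and the second term integrates to 0.\<close>

lemma integral_Poisson:
  assumes t: "t \<in> sphere 0 1" and r: "0 \<le> r" "r < 1"
  shows "(LINT \<xi>|arclength. Poisson r t \<xi>) = 2 * pi"
proof -
  define z where "z = of_real r * cnj t"
  have z: "cmod z < 1" "cmod z = r" using t r by (auto simp: z_def norm_mult)
  let ?h = "\<lambda>\<xi>. \<xi> * z / (1 - \<xi> * z)"
  have int: "integrable arclength ?h"
    by (intro integrable_arclength continuous_on_psi_integrand z)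
  have eq: "Poisson r t \<xi> = 1 + 2 * Re (?h \<xi>)" if \<xi>: "\<xi> \<in> sphere 0 1" for \<xi>
  proof -
    have nz: "1 - \<xi> * z \<noteq> 0" by (rule one_minus_mult_neq_0[OF \<xi> z(1)])
    have "1 + 2 * ?h \<xi> = (1 + \<xi> * z) / (1 - \<xi> * z)"
      using nz by (simp add: field_simps)
    then have "1 + 2 * Re (?h \<xi>) = Re ((1 + \<xi> * z) / (1 - \<xi> * z))"
      by (metis Re_complex_of_real complex_Re_numeral mult_2 one_complex.sel(1) plus_complex.sel(1))
    also have "\<dots> = (1 - r\<^sup>2) / (cmod (1 - \<xi> * z))\<^sup>2"
      using Re_Cayley[of "\<xi> * z"] nz \<xi> z by (simp add: norm_mult)
    also have "cmod (1 - \<xi> * z) = cmod (1 - t * (of_real r * cnj \<xi>))"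
      unfolding z_def using complex_mod_cnj[of "1 - \<xi> * (of_real r * cnj t)"]
      by (simp add: mult_ac)
    finally show ?thesis by (simp add: Poisson_def)
  qed
  have "(LINT \<xi>|arclength. Poisson r t \<xi>) = (LINT \<xi>|arclength. 1 + 2 * Re (?h \<xi>))"
    by (intro Bochner_Integration.integral_cong refl eq) (simp add: space_arclength)
  also have "\<dots> = (LINT \<xi>|arclength. 1) + (LINT \<xi>|arclength. 2 * Re (?h \<xi>))"
    by (intro Bochner_Integration.integral_add integrable_mult_right integrable_Re int)
      (intro integrable_arclength continuous_intros)
  also have "(LINT \<xi>|arclength. 2 * Re (?h \<xi>)) = 2 * Re (LINT \<xi>|arclength. ?h \<xi>)"
    unfolding integral_mult_right_zero integral_Re[OF int] ..
  also have "(LINT \<xi>|arclength. 1) = 2 * pi"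
    by (simp add: measure_arclength)
  finally show ?thesis by (simp add: integral_arclength_psi_integrand[OF z(1)])
qed

text \<open>The kernel concentrates at \<open>t\<close>, because \<open>|\<xi> - t| \<le> 2 |1 - r t \<xi>\<^sup>-\<^sup>1|\<close> on the circle.\<close>

lemma Poisson_concentration:
  assumes t: "t \<in> sphere 0 1" and \<xi>: "\<xi> \<in> sphere 0 1" and r: "0 \<le> r" "r < 1"
  shows "(cmod (\<xi> - t))\<^sup>2 * Poisson r t \<xi> \<le> 4 * (1 - r\<^sup>2)"
proof -
  let ?a = "1 - t * (of_real r * cnj \<xi>)"
  have "cmod (t * cnj \<xi>) = 1" using t \<xi> by (simp add: norm_mult)
  have "\<xi> * cnj \<xi> = 1" using \<xi> complex_norm_square[of \<xi>] by simp
  then have "cnj \<xi> * (\<xi> - t) = 1 - t * cnj \<xi>"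
    by (simp add: algebra_simps)
  then have "cmod (\<xi> - t) = cmod (1 - t * cnj \<xi>)"
    using \<xi> by (metis complex_mod_cnj mem_sphere_0 mult_1 norm_mult)
  also have "1 - t * cnj \<xi> = ?a - of_real (1 - r) * (t * cnj \<xi>)"
    by (simp add: algebra_simps)
  also have "cmod \<dots> \<le> cmod ?a + cmod (of_real (1 - r) * (t * cnj \<xi>))"
    by (rule norm_triangle_ineq4)
  also have "cmod (of_real (1 - r) * (t * cnj \<xi>)) = 1 - r"
    unfolding norm_mult[of "of_real (1 - r)"] \<open>cmod (t * cnj \<xi>) = 1\<close> norm_of_real using r by simp
  also have "1 - r \<le> cmod ?a"
    using one_minus_mult_bound[OF t, of "of_real r * cnj \<xi>"] \<xi> r by (simp add: norm_mult)
  finally have "cmod (\<xi> - t) \<le> 2 * cmod ?a" by simp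
  then have "(cmod (\<xi> - t))\<^sup>2 \<le> (2 * cmod ?a)\<^sup>2" by (intro power_mono) auto
  then have le: "(cmod (\<xi> - t))\<^sup>2 \<le> 4 * (cmod ?a)\<^sup>2" by (simp add: power_mult_distrib)
  have "?a \<noteq> 0"
    using one_minus_mult_neq_0[OF t, of "of_real r * cnj \<xi>"] \<xi> r by (simp add: norm_mult)
  then have a: "0 < (cmod ?a)\<^sup>2" by simp
  have "(cmod (\<xi> - t))\<^sup>2 * Poisson r t \<xi> \<le> 4 * (cmod ?a)\<^sup>2 * Poisson r t \<xi>"
    by (intro mult_right_mono le Poisson_nonneg r)
  also have "\<dots> = 4 * (1 - r\<^sup>2)"
    using a by (simp add: Poisson_def)
  finally show ?thesis .
qed

text \<open>The kernel is nonnegative with total mass 2 pi. The bound does not depend on r or t, so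
  it dominates when r tends to 1 under an integral over \<open>M\<close>.\<close>

lemma Poisson_integral_bound:
  fixes f :: "complex \<Rightarrow> real"
  assumes f: "continuous_on (sphere 0 1) f" and B: "\<And>\<xi>. \<xi> \<in> sphere 0 1 \<Longrightarrow> \<bar>f \<xi>\<bar> \<le> B"
    and t: "t \<in> sphere 0 1" and r: "0 \<le> r" "r < 1"
  shows "\<bar>LINT \<xi>|arclength. f \<xi> * Poisson r t \<xi>\<bar> \<le> 2 * pi * B"
proof -
  have "norm (LINT \<xi>|arclength. f \<xi> * Poisson r t \<xi>) \<le> (LINT \<xi>|arclength. B * Poisson r t \<xi>)"
  proof (rule Bochner_Integration.integral_norm_bound_integral)
    show "integrable arclength (\<lambda>\<xi>. f \<xi> * Poisson r t \<xi>)" "integrable arclength (\<lambda>\<xi>. B * Poisson r t \<xi>)"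
      by (intro integrable_arclength continuous_intros f continuous_on_Poisson t r)+
    show "norm (f \<xi> * Poisson r t \<xi>) \<le> B * Poisson r t \<xi>" if "\<xi> \<in> space arclength" for \<xi>
      using B[of \<xi>] that Poisson_nonneg[OF r]
      by (auto simp: space_arclength abs_mult intro!: mult_right_mono)
  qed
  also have "\<dots> = 2 * pi * B"
    unfolding integral_mult_right_zero integral_Poisson[OF t r] by simp
  finally show ?thesis by simp
qed

text \<open>Instead of splitting the integral near and away from t, uniform smallness is encoded in
  the single bound |f \<xi> - f t| <= e' + C |\<xi> - t|^2. The quadratic term is absorbed pointwise
  by \<open>Poisson_concentration\<close>.\<close>

lemma Poisson_integral_tendsto:
  fixes f :: "complex \<Rightarrow> real"
  assumes f: "continuous_on (sphere 0 1) f" and t: "t \<in> sphere 0 1"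
    and r: "\<And>n. 0 \<le> r n" "\<And>n. r n < 1" "r \<longlonglongrightarrow> 1"
  shows "(\<lambda>n. LINT \<xi>|arclength. f \<xi> * Poisson (r n) t \<xi>) \<longlonglongrightarrow> 2 * pi * f t"
proof (rule LIMSEQ_I)
  fix e :: real assume "0 < e"
  have "bounded (f ` sphere 0 1)"
    by (intro compact_imp_bounded compact_continuous_image f) simp
  then obtain B where "\<forall>y \<in> f ` sphere 0 1. norm y \<le> B"
    unfolding bounded_iff ..
  then have B: "\<bar>f \<xi>\<bar> \<le> B" if "\<xi> \<in> sphere 0 1" for \<xi> using that by simp
  \<comment> \<open>The kernel has total mass 2 pi, so e' contributes e / 2.\<close>
  define e' where "e' = e / (4 * pi)"
  have "e' > 0" using \<open>0 < e\<close> by (simp add: e'_def)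
  then obtain d where d: "d > 0" "\<And>\<xi>. \<xi> \<in> sphere 0 1 \<Longrightarrow> dist \<xi> t < d \<Longrightarrow> dist (f \<xi>) (f t) < e'"
    using f t unfolding continuous_on_iff by metis
  \<comment> \<open>Beyond distance d, the trivial bound 2 B on the oscillation is C d^2 and hence
    at most C |\<xi> - t|^2.\<close>
  define C where "C = 2 * B / d\<^sup>2"
  have "B \<ge> 0" using B[OF t] by simp
  then have "C \<ge> 0" by (simp add: C_def)
  have close: "\<bar>f \<xi> - f t\<bar> \<le> e' + C * (cmod (\<xi> - t))\<^sup>2" if \<xi>: "\<xi> \<in> sphere 0 1" for \<xi>
  proof (cases "dist \<xi> t < d")
    case True
    then have "\<bar>f \<xi> - f t\<bar> \<le> e'" using d(2)[OF \<xi>] by (simp add: dist_real_def)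
    then show ?thesis using \<open>C \<ge> 0\<close> by (simp add: add_increasing2)
  next
    case False
    then have "d\<^sup>2 \<le> (cmod (\<xi> - t))\<^sup>2" using d(1) by (intro power_mono) (auto simp: dist_norm)
    then have "C * d\<^sup>2 \<le> C * (cmod (\<xi> - t))\<^sup>2" using \<open>C \<ge> 0\<close> by (rule mult_left_mono)
    moreover have "C * d\<^sup>2 = 2 * B" using d(1) by (simp add: C_def)
    ultimately show ?thesis using B[OF \<xi>] B[OF t] \<open>e' > 0\<close> by linarith
  qed
  have main: "\<bar>(LINT \<xi>|arclength. f \<xi> * Poisson (r n) t \<xi>) - 2 * pi * f t\<bar>
      \<le> e / 2 + 8 * pi * C * (1 - (r n)\<^sup>2)" for n
  proof -
    note P = continuous_on_Poisson[OF t r(1,2)[of n]]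
    have "(LINT \<xi>|arclength. f \<xi> * Poisson (r n) t \<xi>) - 2 * pi * f t
        = (LINT \<xi>|arclength. f \<xi> * Poisson (r n) t \<xi>) - (LINT \<xi>|arclength. f t * Poisson (r n) t \<xi>)"
      unfolding integral_mult_right_zero integral_Poisson[OF t r(1,2)] by simp
    also have "\<dots> = (LINT \<xi>|arclength. f \<xi> * Poisson (r n) t \<xi> - f t * Poisson (r n) t \<xi>)"
      by (intro Bochner_Integration.integral_diff[symmetric] integrable_arclength continuous_intros f P)
    also have "norm \<dots> \<le> (LINT \<xi>|arclength. e' * Poisson (r n) t \<xi> + 4 * C * (1 - (r n)\<^sup>2))"
    proof (rule Bochner_Integration.integral_norm_bound_integral)
      show "integrable arclength (\<lambda>\<xi>. f \<xi> * Poisson (r n) t \<xi> - f t * Poisson (r n) t \<xi>)"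
        "integrable arclength (\<lambda>\<xi>. e' * Poisson (r n) t \<xi> + 4 * C * (1 - (r n)\<^sup>2))"
        by (intro integrable_arclength continuous_intros f P)+
      fix \<xi> assume "\<xi> \<in> space arclength"
      then have \<xi>: "\<xi> \<in> sphere 0 1" by (simp only: space_arclength)
      have p: "0 \<le> Poisson (r n) t \<xi>" by (rule Poisson_nonneg[OF r(1,2)])
      have "norm (f \<xi> * Poisson (r n) t \<xi> - f t * Poisson (r n) t \<xi>) = \<bar>f \<xi> - f t\<bar> * Poisson (r n) t \<xi>"
        using p by (simp add: left_diff_distrib[symmetric] abs_mult)
      also have "\<dots> \<le> (e' + C * (cmod (\<xi> - t))\<^sup>2) * Poisson (r n) t \<xi>"
        by (intro mult_right_mono close \<xi> p)
      also have "\<dots> = e' * Poisson (r n) t \<xi> + C * ((cmod (\<xi> - t))\<^sup>2 * Poisson (r n) t \<xi>)"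
        by (simp only: distrib_right mult.assoc)
      also have "\<dots> \<le> e' * Poisson (r n) t \<xi> + C * (4 * (1 - (r n)\<^sup>2))"
        by (intro add_left_mono mult_left_mono Poisson_concentration t \<xi> r \<open>C \<ge> 0\<close>)
      finally show "norm (f \<xi> * Poisson (r n) t \<xi> - f t * Poisson (r n) t \<xi>)
          \<le> e' * Poisson (r n) t \<xi> + 4 * C * (1 - (r n)\<^sup>2)" by (simp only: mult_ac)
    qed
    also have "\<dots> = (LINT \<xi>|arclength. e' * Poisson (r n) t \<xi>) + (LINT \<xi>|arclength. 4 * C * (1 - (r n)\<^sup>2))"
      by (intro Bochner_Integration.integral_add integrable_arclength continuous_intros P)
    also have "(LINT \<xi>|arclength. e' * Poisson (r n) t \<xi>) = e / 2"
      unfolding integral_mult_right_zero integral_Poisson[OF t r(1,2)] by (simp add: e'_def)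
    also have "(LINT \<xi>|arclength. 4 * C * (1 - (r n)\<^sup>2)) = 8 * pi * C * (1 - (r n)\<^sup>2)"
      by (simp add: measure_arclength)
    finally show ?thesis by simp
  qed
  have "(\<lambda>n. 8 * pi * C * (1 - (r n)\<^sup>2)) \<longlonglongrightarrow> 8 * pi * C * (1 - 1\<^sup>2)"
    by (intro tendsto_intros r)
  then have "(\<lambda>n. 8 * pi * C * (1 - (r n)\<^sup>2)) \<longlonglongrightarrow> 0" by simp
  then have "\<forall>\<^sub>F n in sequentially. 8 * pi * C * (1 - (r n)\<^sup>2) < e / 2"
    by (rule order_tendstoD) (use \<open>0 < e\<close> in simp)
  then obtain N where N: "\<And>n. n \<ge> N \<Longrightarrow> 8 * pi * C * (1 - (r n)\<^sup>2) < e / 2"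
    unfolding eventually_sequentially by blast
  show "\<exists>N. \<forall>n\<ge>N. norm ((LINT \<xi>|arclength. f \<xi> * Poisson (r n) t \<xi>) - 2 * pi * f t) < e"
  proof (intro exI[of _ N] allI impI)
    fix n assume "N \<le> n"
    then show "norm ((LINT \<xi>|arclength. f \<xi> * Poisson (r n) t \<xi>) - 2 * pi * f t) < e"
      using main[of n] N[of n] by simp
  qed
qed

section \<open>Densities from boundary values\<close>

lemma Poisson_measurable_pair:
  assumes "M \<in> circle_probs"
  shows "(\<lambda>(t, \<xi>). Poisson r t \<xi>) \<in> borel_measurable (M \<Otimes>\<^sub>M arclength)"
proof -
  have "(\<lambda>t. t) \<in> borel_measurable M" "(\<lambda>t. t) \<in> borel_measurable arclength"
    by (intro borel_measurable_circle circle_probsD[OF assms] sets_arclength continuous_intros)+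
  then have [measurable]: "fst \<in> borel_measurable (M \<Otimes>\<^sub>M arclength)" "snd \<in> borel_measurable (M \<Otimes>\<^sub>M arclength)"
    using measurable_compose[OF measurable_fst] measurable_compose[OF measurable_snd] by blast+
  have [measurable]: "cnj \<in> borel_measurable borel"
    by (intro borel_measurable_continuous_onI continuous_intros)
  show ?thesis
    unfolding Poisson_def case_prod_beta' by measurable
qed

text \<open>Fubini's theorem for two finite measures; for fixed r < 1 the kernel is bounded by 1 /
  (1 - r)^2. The inner integral over \<open>M\<close> is then \<open>psi_Poisson\<close>.\<close>

lemma integral_Poisson_swap:
  fixes f :: "complex \<Rightarrow> real"
  assumes M: "M \<in> circle_probs" and f: "continuous_on (sphere 0 1) f" and r: "0 \<le> r" "r < 1"
  shows "(LINT \<xi>|arclength. f \<xi> * Re (1 + 2 * psi M (of_real r * cnj \<xi>)))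
    = (LINT t|M. LINT \<xi>|arclength. f \<xi> * Poisson r t \<xi>)"
proof -
  interpret M: prob_space M by (rule circle_probsD[OF M])
  interpret A: finite_measure arclength by (rule finite_measure_arclength)
  interpret P: pair_sigma_finite M arclength ..
  have "bounded (f ` sphere 0 1)"
    by (intro compact_imp_bounded compact_continuous_image f) simp
  then obtain B where "\<forall>y \<in> f ` sphere 0 1. norm y \<le> B"
    unfolding bounded_iff ..
  then have B: "\<bar>f \<xi>\<bar> \<le> B" if "\<xi> \<in> sphere 0 1" for \<xi> using that by simp
  have fm: "f \<in> borel_measurable arclength"
    by (intro borel_measurable_circle sets_arclength f)
  have Pb: "\<bar>Poisson r t \<xi>\<bar> \<le> 1 / (1 - r)\<^sup>2" if "t \<in> sphere 0 1" "\<xi> \<in> sphere 0 1" for t \<xi>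
  proof -
    have "1 - r \<le> cmod (1 - t * (of_real r * cnj \<xi>))"
      using one_minus_mult_bound[OF that(1), of "of_real r * cnj \<xi>"] that r by (simp add: norm_mult)
    then have "(1 - r)\<^sup>2 \<le> (cmod (1 - t * (of_real r * cnj \<xi>)))\<^sup>2"
      using r by (intro power_mono) auto
    then have "Poisson r t \<xi> \<le> 1 / (1 - r)\<^sup>2"
      unfolding Poisson_def using r by (intro frac_le) auto
    then show ?thesis using Poisson_nonneg[OF r] by simp
  qed
  interpret PM: finite_measure "M \<Otimes>\<^sub>M arclength"
    by (rule finite_measure_pair_measure) unfold_locales
  have "integrable (M \<Otimes>\<^sub>M arclength) (\<lambda>(t, \<xi>). f \<xi> * Poisson r t \<xi>)"
  proof (rule PM.integrable_const_bound[of _ "B * (1 / (1 - r)\<^sup>2)"])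
    show "AE x in M \<Otimes>\<^sub>M arclength. norm (case x of (t, \<xi>) \<Rightarrow> f \<xi> * Poisson r t \<xi>) \<le> B * (1 / (1 - r)\<^sup>2)"
    proof (rule AE_I2)
      fix x assume "x \<in> space (M \<Otimes>\<^sub>M arclength)"
      then have x: "fst x \<in> sphere 0 1" "snd x \<in> sphere 0 1"
        by (auto simp: space_pair_measure circle_probsD(3)[OF M] space_arclength)
      have "0 \<le> B" using B[OF x(2)] by simp
      then have "\<bar>f (snd x)\<bar> * \<bar>Poisson r (fst x) (snd x)\<bar> \<le> B * (1 / (1 - r)\<^sup>2)"
        by (intro mult_mono B Pb x) auto
      then show "norm (case x of (t, \<xi>) \<Rightarrow> f \<xi> * Poisson r t \<xi>) \<le> B * (1 / (1 - r)\<^sup>2)"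
        by (simp add: case_prod_beta abs_mult)
    qed
    have "(\<lambda>x. f (snd x) * (case x of (t, \<xi>) \<Rightarrow> Poisson r t \<xi>)) \<in> borel_measurable (M \<Otimes>\<^sub>M arclength)"
      by (intro borel_measurable_times Poisson_measurable_pair M measurable_compose[OF measurable_snd fm])
    then show "(\<lambda>(t, \<xi>). f \<xi> * Poisson r t \<xi>) \<in> borel_measurable (M \<Otimes>\<^sub>M arclength)"
      by (simp add: case_prod_beta')
  qed
  from P.Fubini_integral[OF this]
  have "(LINT \<xi>|arclength. LINT t|M. f \<xi> * Poisson r t \<xi>) = (LINT t|M. LINT \<xi>|arclength. f \<xi> * Poisson r t \<xi>)" .
  moreover have "(LINT \<xi>|arclength. f \<xi> * Re (1 + 2 * psi M (of_real r * cnj \<xi>)))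
      = (LINT \<xi>|arclength. LINT t|M. f \<xi> * Poisson r t \<xi>)"
  proof (intro Bochner_Integration.integral_cong refl)
    fix \<xi> assume "\<xi> \<in> space arclength"
    then have \<xi>: "cmod (of_real r * cnj \<xi>) = r" using r by (simp add: space_arclength norm_mult)
    then have "Re (1 + 2 * psi M (of_real r * cnj \<xi>)) = (LINT t|M. Poisson r t \<xi>)"
      unfolding Poisson_def using psi_Poisson(1)[OF M, of "of_real r * cnj \<xi>"] r by (simp only: \<xi>)
    then show "f \<xi> * Re (1 + 2 * psi M (of_real r * cnj \<xi>)) = (LINT t|M. f \<xi> * Poisson r t \<xi>)"
      by (simp only: integral_mult_right_zero)
  qed
  ultimately show ?thesis by simp
qed

lemma circle_density_measurable:
  assumes "continuous_on (cball 0 1) (eta_ext M)"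
  shows "circle_density M \<in> borel_measurable arclength"
proof -
  have "(\<lambda>\<xi>. eta_ext M (cnj \<xi>)) \<in> borel_measurable arclength"
    by (intro borel_measurable_circle sets_arclength continuous_on_compose2[OF assms] continuous_intros) auto
  then show ?thesis unfolding circle_density_def by measurable
qed

lemma eta_ext_disc: "cmod z < 1 \<Longrightarrow> eta_ext M z = eta M z"
  by (simp add: eta_ext_def)

lemma circle_density_eq:
  "2 * pi * circle_density M \<xi> = Re ((1 + eta_ext M (cnj \<xi>)) / (1 - eta_ext M (cnj \<xi>)))"
  by (simp add: circle_density_def)

definition radii :: "complex set \<Rightarrow> complex set" where
  "radii C = (\<lambda>(r, \<xi>). of_real r * cnj \<xi>) ` ({0..1} \<times> C)"

lemma radiiI: "0 \<le> r \<Longrightarrow> r \<le> 1 \<Longrightarrow> \<xi> \<in> C \<Longrightarrow> of_real r * cnj \<xi> \<in> radii C"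
  unfolding radii_def by force

text \<open>The radii ending in \<open>C\<close> form a compact set that avoids the value 1 of \<open>eta_ext M\<close>. So the
  Cayley transform of \<open>eta_ext M\<close> is bounded on it, which dominates the Poisson integrals.\<close>

context
  fixes M C
  assumes M: "M \<in> circle_probs" and cont: "continuous_on (cball 0 1) (eta_ext M)"
    and C: "compact C" "C \<subseteq> sphere 0 1" "\<And>\<xi>. \<xi> \<in> C \<Longrightarrow> eta_ext M (cnj \<xi>) \<noteq> 1"
begin

lemma compact_radii: "compact (radii C)"
  unfolding radii_def case_prod_beta'
  by (intro compact_continuous_image compact_Times C continuous_intros) auto

lemma radii_subset: "radii C \<subseteq> cball 0 1"
  using C(2) by (auto simp: radii_def norm_mult)

lemma eta_ext_radii: "z \<in> radii C \<Longrightarrow> eta_ext M z \<noteq> 1"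
proof -
  assume "z \<in> radii C"
  then obtain r \<xi> where z: "z = of_real r * cnj \<xi>" "0 \<le> r" "r \<le> 1" "\<xi> \<in> C"
    by (auto simp: radii_def)
  show ?thesis
  proof (cases "r = 1")
    case True
    then show ?thesis using z C(3) by simp
  next
    case False
    then have "cmod z < 1" using z C(2) by (auto simp: norm_mult)
    then show ?thesis using cmod_eta_less_1[OF M, of z] by (auto simp: eta_ext_disc)
  qed
qed

lemma continuous_on_Cayley: "continuous_on (radii C) (\<lambda>z. Re ((1 + eta_ext M z) / (1 - eta_ext M z)))"
  by (intro continuous_intros continuous_on_subset[OF cont radii_subset]) (use eta_ext_radii in auto)

lemma Cayley_bounded:
  obtains B where "\<And>z. z \<in> radii C \<Longrightarrow> \<bar>Re ((1 + eta_ext M z) / (1 - eta_ext M z))\<bar> \<le> B"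
proof -
  have "bounded ((\<lambda>z. Re ((1 + eta_ext M z) / (1 - eta_ext M z))) ` radii C)"
    by (intro compact_imp_bounded compact_continuous_image continuous_on_Cayley compact_radii)
  then obtain B where "\<forall>y \<in> (\<lambda>z. Re ((1 + eta_ext M z) / (1 - eta_ext M z))) ` radii C. norm y \<le> B"
    unfolding bounded_iff ..
  then have "\<bar>Re ((1 + eta_ext M z) / (1 - eta_ext M z))\<bar> \<le> B" if "z \<in> radii C" for z using that by simp
  then show thesis by (rule that)
qed

lemma Re_psi_tendsto:
  assumes r: "\<And>n. 0 \<le> r n" "\<And>n. r n < 1" "r \<longlonglongrightarrow> 1" and \<xi>: "\<xi> \<in> C"
  shows "(\<lambda>n. Re (1 + 2 * psi M (of_real (r n) * cnj \<xi>))) \<longlonglongrightarrow> 2 * pi * circle_density M \<xi>"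
proof -
  have lim: "(\<lambda>n. of_real (r n) * cnj \<xi>) \<longlonglongrightarrow> of_real 1 * cnj \<xi>"
    by (intro tendsto_intros r)
  have "of_real 1 * cnj \<xi> \<in> radii C" by (rule radiiI) (use \<xi> in auto)
  moreover have "\<forall>\<^sub>F n in sequentially. of_real (r n) * cnj \<xi> \<in> radii C"
    by (intro always_eventually allI radiiI r less_imp_le \<xi>)
  ultimately have "(\<lambda>n. Re ((1 + eta_ext M (of_real (r n) * cnj \<xi>)) / (1 - eta_ext M (of_real (r n) * cnj \<xi>))))
      \<longlonglongrightarrow> Re ((1 + eta_ext M (of_real 1 * cnj \<xi>)) / (1 - eta_ext M (of_real 1 * cnj \<xi>)))"
    using continuous_on_tendsto_compose[OF continuous_on_Cayley lim] by blast
  moreover have "(1 + eta_ext M (of_real (r n) * cnj \<xi>)) / (1 - eta_ext M (of_real (r n) * cnj \<xi>))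
      = 1 + 2 * psi M (of_real (r n) * cnj \<xi>)" for n
  proof -
    have "cmod (of_real (r n) * cnj \<xi>) < 1" using r(1,2)[of n] \<xi> C(2) by (auto simp: norm_mult)
    then show ?thesis by (simp only: eta_ext_disc eta_Cayley[OF M])
  qed
  ultimately show ?thesis by (simp add: circle_density_eq)
qed

lemma circle_density_nonneg:
  assumes "\<xi> \<in> C"
  shows "0 \<le> circle_density M \<xi>"
proof -
  define r where "r = (\<lambda>n. 1 - inverse (real (Suc n)))"
  have r: "0 \<le> r n" "r n < 1" for n by (auto simp: r_def inverse_le_1_iff)
  have "r \<longlonglongrightarrow> 1 - 0"
    unfolding r_def by (intro tendsto_diff tendsto_const LIMSEQ_inverse_real_of_nat)
  then have r1: "r \<longlonglongrightarrow> 1" by simp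
  from Re_psi_tendsto[OF r r1 assms] have "0 \<le> 2 * pi * circle_density M \<xi>"
  proof (rule tendsto_lowerbound)
    have "0 \<le> Re (1 + 2 * psi M (of_real (r n) * cnj \<xi>))" for n
    proof -
      have "cmod (of_real (r n) * cnj \<xi>) < 1" using r[of n] assms C(2) by (auto simp: norm_mult)
      then show ?thesis using psi_Poisson(2)[OF M] less_imp_le by blast
    qed
    then show "\<forall>\<^sub>F n in sequentially. 0 \<le> Re (1 + 2 * psi M (of_real (r n) * cnj \<xi>))" by simp
  qed simp
  then show ?thesis using pi_gt_zero by (simp add: zero_le_mult_iff not_le)
qed

text \<open>The arclength integral of f times the Poisson integral of \<open>M\<close> is evaluated
  in two ways as r tends to 1. Directly it converges to the integral against the density, the
  support of f in \<open>C\<close> providing the domination. After exchanging integrals, the kernel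
  reproduces f and leaves its integral over \<open>M\<close>.\<close>

lemma integral_eq_density:
  fixes f :: "complex \<Rightarrow> real"
  assumes f: "continuous_on (sphere 0 1) f" and f0: "\<And>\<xi>. \<xi> \<in> sphere 0 1 - C \<Longrightarrow> f \<xi> = 0"
  shows "(LINT t|M. f t) = (LINT \<xi>|arclength. f \<xi> * circle_density M \<xi>)"
proof -
  interpret M: prob_space M by (rule circle_probsD[OF M])
  interpret A: finite_measure arclength by (rule finite_measure_arclength)
  define r where "r = (\<lambda>n. 1 - inverse (real (Suc n)))"
  have r: "0 \<le> r n" "r n < 1" for n by (auto simp: r_def inverse_le_1_iff)
  have "r \<longlonglongrightarrow> 1 - 0"
    unfolding r_def by (intro tendsto_diff tendsto_const LIMSEQ_inverse_real_of_nat)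
  then have r1: "r \<longlonglongrightarrow> 1" by simp
  have "bounded (f ` sphere 0 1)"
    by (intro compact_imp_bounded compact_continuous_image f) simp
  then obtain B where "\<forall>y \<in> f ` sphere 0 1. norm y \<le> B"
    unfolding bounded_iff ..
  then have B: "\<bar>f \<xi>\<bar> \<le> B" if "\<xi> \<in> sphere 0 1" for \<xi> using that by simp
  obtain B' where B': "\<And>z. z \<in> radii C \<Longrightarrow> \<bar>Re ((1 + eta_ext M z) / (1 - eta_ext M z))\<bar> \<le> B'"
    using Cayley_bounded by metis
  have fm: "f \<in> borel_measurable arclength"
    by (intro borel_measurable_circle sets_arclength f)
  have disc: "cmod (of_real (r n) * cnj \<xi>) < 1" if "\<xi> \<in> sphere 0 1" for \<xi> n
    using r[of n] that by (auto simp: norm_mult)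
  have psi_cont: "continuous_on (sphere 0 1) (\<lambda>\<xi>. psi M (of_real (r n) * cnj \<xi>))" for n
    by (intro continuous_on_compose2[OF holomorphic_on_imp_continuous_on[OF psi_holomorphic[OF M]]]
        continuous_intros) (use disc in auto)
  have "(\<lambda>n. LINT \<xi>|arclength. f \<xi> * Re (1 + 2 * psi M (of_real (r n) * cnj \<xi>)))
      \<longlonglongrightarrow> (LINT \<xi>|arclength. f \<xi> * (2 * pi * circle_density M \<xi>))"
  proof (rule integral_dominated_convergence[where w="\<lambda>_. B * \<bar>B'\<bar>"])
    show "(\<lambda>\<xi>. f \<xi> * (2 * pi * circle_density M \<xi>)) \<in> borel_measurable arclength"
      using fm circle_density_measurable[OF cont] by measurable
    show "(\<lambda>\<xi>. f \<xi> * Re (1 + 2 * psi M (of_real (r n) * cnj \<xi>))) \<in> borel_measurable arclength" for n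
      by (intro borel_measurable_circle sets_arclength continuous_intros f psi_cont)
    show "AE \<xi> in arclength. (\<lambda>n. f \<xi> * Re (1 + 2 * psi M (of_real (r n) * cnj \<xi>)))
        \<longlonglongrightarrow> f \<xi> * (2 * pi * circle_density M \<xi>)"
    proof (rule AE_I2)
      fix \<xi> assume "\<xi> \<in> space arclength"
      then have \<xi>: "\<xi> \<in> sphere 0 1" by (simp only: space_arclength)
      show "(\<lambda>n. f \<xi> * Re (1 + 2 * psi M (of_real (r n) * cnj \<xi>))) \<longlonglongrightarrow> f \<xi> * (2 * pi * circle_density M \<xi>)"
      proof (cases "\<xi> \<in> C")
        case True
        show ?thesis by (intro tendsto_mult tendsto_const Re_psi_tendsto r r1 True)
      next
        case False
        then have "f \<xi> = 0" using f0 \<xi> by blast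
        then show ?thesis by simp
      qed
    qed
    show "AE \<xi> in arclength. norm (f \<xi> * Re (1 + 2 * psi M (of_real (r n) * cnj \<xi>))) \<le> B * \<bar>B'\<bar>" for n
    proof (rule AE_I2)
      fix \<xi> assume "\<xi> \<in> space arclength"
      then have \<xi>: "\<xi> \<in> sphere 0 1" by (simp only: space_arclength)
      have "0 \<le> B" using B[OF \<xi>] by simp
      show "norm (f \<xi> * Re (1 + 2 * psi M (of_real (r n) * cnj \<xi>))) \<le> B * \<bar>B'\<bar>"
      proof (cases "\<xi> \<in> C")
        case True
        then have "of_real (r n) * cnj \<xi> \<in> radii C" using r[of n] by (intro radiiI) auto
        from B'[OF this] have "\<bar>Re (1 + 2 * psi M (of_real (r n) * cnj \<xi>))\<bar> \<le> \<bar>B'\<bar>"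
          unfolding eta_ext_disc[OF disc[OF \<xi>]] eta_Cayley[OF M disc[OF \<xi>]] by linarith
        then show ?thesis
          unfolding real_norm_def abs_mult by (intro mult_mono B \<xi> \<open>0 \<le> B\<close>) auto
      next
        case False
        then have "f \<xi> = 0" using f0 \<xi> by blast
        then show ?thesis using \<open>0 \<le> B\<close> by simp
      qed
    qed
  qed (intro integrable_arclength continuous_intros)
  moreover have "(\<lambda>n. LINT t|M. LINT \<xi>|arclength. f \<xi> * Poisson (r n) t \<xi>) \<longlonglongrightarrow> (LINT t|M. 2 * pi * f t)"
  proof (rule integral_dominated_convergence[where w="\<lambda>_. 2 * pi * B"])
    show "(\<lambda>t. 2 * pi * f t) \<in> borel_measurable M"
      by (intro borel_measurable_circle circle_probsD(2)[OF M] continuous_intros f)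
    have "(\<lambda>x. f (snd x) * (case x of (t, \<xi>) \<Rightarrow> Poisson (r n) t \<xi>)) \<in> borel_measurable (M \<Otimes>\<^sub>M arclength)" for n
      by (intro borel_measurable_times Poisson_measurable_pair M measurable_compose[OF measurable_snd fm])
    then have "(\<lambda>(t, \<xi>). f \<xi> * Poisson (r n) t \<xi>) \<in> borel_measurable (M \<Otimes>\<^sub>M arclength)" for n
      by (simp add: case_prod_beta')
    then show "(\<lambda>t. LINT \<xi>|arclength. f \<xi> * Poisson (r n) t \<xi>) \<in> borel_measurable M" for n
      by (rule A.borel_measurable_lebesgue_integral)
    show "AE t in M. (\<lambda>n. LINT \<xi>|arclength. f \<xi> * Poisson (r n) t \<xi>) \<longlonglongrightarrow> 2 * pi * f t"
      by (intro AE_I2 Poisson_integral_tendsto f r r1) (simp only: circle_probsD(3)[OF M])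
    show "AE t in M. norm (LINT \<xi>|arclength. f \<xi> * Poisson (r n) t \<xi>) \<le> 2 * pi * B" for n
      unfolding real_norm_def
      by (intro AE_I2 Poisson_integral_bound f r B) (simp_all only: circle_probsD(3)[OF M])
  qed simp
  ultimately have "(LINT \<xi>|arclength. f \<xi> * (2 * pi * circle_density M \<xi>)) = (LINT t|M. 2 * pi * f t)"
    unfolding integral_Poisson_swap[OF M f r] by (rule LIMSEQ_unique)
  then have "(LINT \<xi>|arclength. 2 * pi * (f \<xi> * circle_density M \<xi>)) = (LINT t|M. 2 * pi * f t)"
    by (simp only: mult_ac)
  then show ?thesis
    unfolding integral_mult_right_zero by simp
qed

end

text \<open>The indicator of \<open>C\<close> is a bounded limit of continuous functions supported
  in a compact neighbourhood \<open>C'\<close> of \<open>C\<close> that still avoids the closed set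
  \<open>Z\<close> where eta takes the value 1. On \<open>C'\<close> the density is bounded, so both
  sides pass to the limit.\<close>

lemma measure_compact_eq_density:
  assumes M: "M \<in> circle_probs" and cont: "continuous_on (cball 0 1) (eta_ext M)"
    and C: "compact C" "C \<subseteq> sphere 0 1" "\<And>\<xi>. \<xi> \<in> C \<Longrightarrow> eta_ext M (cnj \<xi>) \<noteq> 1"
  shows "measure M C = (LINT \<xi>|arclength. indicator C \<xi> * circle_density M \<xi>)"
    and "integrable arclength (\<lambda>\<xi>. indicator C \<xi> * circle_density M \<xi>)"
proof -
  interpret M: prob_space M by (rule circle_probsD[OF M])
  interpret A: finite_measure arclength by (rule finite_measure_arclength)
  have Cm: "C \<in> sets circle_borel"
    using C(1,2) by (auto simp: circle_borel_def sets_restrict_space_iff compact_imp_closed)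
  have pm: "circle_density M \<in> borel_measurable arclength"
    by (rule circle_density_measurable[OF cont])
  define Z where "Z = {\<xi> \<in> sphere 0 1. eta_ext M (cnj \<xi>) = 1}"
  have "continuous_on (sphere 0 1) (\<lambda>\<xi>. eta_ext M (cnj \<xi>))"
    by (intro continuous_on_compose2[OF cont] continuous_intros) auto
  then have "closed Z" unfolding Z_def
    by (intro continuous_closed_preimage_constant) auto
  moreover have "C \<inter> Z = {}" using C(3) by (auto simp: Z_def)
  ultimately obtain d where d: "d > 0" "\<And>x y. x \<in> C \<Longrightarrow> y \<in> Z \<Longrightarrow> d \<le> dist x y"
    using separate_compact_closed[OF C(1)] by metis
  \<comment> \<open>The empty set is treated apart because \<open>infdist\<close> to it is 0 by
    convention, which would make \<open>C'\<close> the whole circle.\<close>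
  define C' where "C' = (if C = {} then {} else {\<xi> \<in> sphere 0 1. infdist \<xi> C \<le> d / 2})"
  have "closed {\<xi> :: complex. infdist \<xi> C \<le> d / 2}"
    by (intro closed_Collect_le continuous_intros)
  then have "compact (sphere 0 1 \<inter> {\<xi> :: complex. infdist \<xi> C \<le> d / 2})"
    by (intro compact_Int_closed compact_sphere)
  moreover have "{\<xi> \<in> sphere 0 1. infdist \<xi> C \<le> d / 2} = sphere 0 1 \<inter> {\<xi>. infdist \<xi> C \<le> d / 2}"
    by blast
  ultimately have "compact C'"
    unfolding C'_def by (simp only: compact_empty if_split simp_thms)
  have C'1: "C' \<subseteq> sphere 0 1" by (auto simp: C'_def)
  have C'Z: "eta_ext M (cnj \<xi>) \<noteq> 1" if \<xi>: "\<xi> \<in> C'" for \<xi>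
  proof
    assume "eta_ext M (cnj \<xi>) = 1"
    then have "\<xi> \<in> Z" using \<xi> C'1 by (auto simp: Z_def)
    have "C \<noteq> {}" using \<xi> by (auto simp: C'_def)
    then obtain c where c: "c \<in> C" "infdist \<xi> C = dist \<xi> c"
      using infdist_attains_inf[OF compact_imp_closed[OF C(1)]] by metis
    then have "dist c \<xi> \<le> d / 2" using \<xi> \<open>C \<noteq> {}\<close> by (auto simp: C'_def dist_commute)
    then show False using d(2)[OF c(1) \<open>\<xi> \<in> Z\<close>] d(1) by linarith
  qed
  note ctx = M cont \<open>compact C'\<close> C'1 C'Z
  obtain B where B: "\<And>z. z \<in> radii C' \<Longrightarrow> \<bar>Re ((1 + eta_ext M z) / (1 - eta_ext M z))\<bar> \<le> B"
    using Cayley_bounded[OF ctx] by metis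
  have pB: "\<bar>circle_density M \<xi>\<bar> \<le> \<bar>B\<bar> / (2 * pi)" if "\<xi> \<in> C'" for \<xi>
  proof -
    have "cnj \<xi> \<in> radii C'" using radiiI[of 1 \<xi> C'] that by simp
    from B[OF this] have "\<bar>2 * pi * circle_density M \<xi>\<bar> \<le> \<bar>B\<bar>"
      unfolding circle_density_eq by linarith
    then show ?thesis by (simp add: abs_mult field_simps)
  qed
  have "C \<subseteq> C'" using C(2) d(1) by (auto simp: C'_def)
  \<comment> \<open>The slope is at least 2 / d, so f n vanishes once the distance to
    \<open>C\<close> exceeds d / 2, that is, outside \<open>C'\<close>; the summand n makes f n
    shrink to the indicator.\<close>
  define f where "f = (\<lambda>n \<xi>. if C = {} then 0 else max 0 (1 - (real n + 2 / d) * infdist \<xi> C))"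
  have f_cont: "continuous_on (sphere 0 1) (f n)" for n
    unfolding f_def by (cases "C = {}") (auto intro!: continuous_intros)
  have f01: "0 \<le> f n \<xi>" "f n \<xi> \<le> 1" for n \<xi>
    using d(1) by (auto simp: f_def infdist_nonneg)
  have f0: "f n \<xi> = 0" if "\<xi> \<in> sphere 0 1 - C'" for n \<xi>
  proof (cases "C = {}")
    case False
    then have "infdist \<xi> C > d / 2" using that by (auto simp: C'_def)
    then have "2 / d * infdist \<xi> C \<ge> 2 / d * (d / 2)" using d(1) by (intro mult_left_mono) auto
    then have "2 / d * infdist \<xi> C \<ge> 1" using d(1) by simp
    moreover have "real n * infdist \<xi> C \<ge> 0" by (simp add: infdist_nonneg)
    ultimately have "(real n + 2 / d) * infdist \<xi> C \<ge> 1" by (simp only: distrib_right)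
    then show ?thesis using False by (simp add: f_def)
  qed (simp add: f_def)
  have f_lim: "(\<lambda>n. f n \<xi>) \<longlonglongrightarrow> indicator C \<xi>" for \<xi>
  proof (cases "\<xi> \<in> C")
    case True
    then have "f n \<xi> = 1" for n by (auto simp: f_def)
    then show ?thesis using True by simp
  next
    case False
    show ?thesis
    proof (cases "C = {}")
      case True
      then show ?thesis by (simp add: f_def)
    next
      case ne: False
      have pos: "infdist \<xi> C > 0"
        using False ne C(1) compact_imp_closed infdist_pos_not_in_closed by blast
      obtain N where N: "1 / infdist \<xi> C < real N" using reals_Archimedean2 by blast
      have "f n \<xi> = 0" if "n \<ge> N" for n
      proof -
        have "1 / infdist \<xi> C \<le> real n + 2 / d"
          using N that d(1) by (simp add: add_increasing2 order_trans[of _ "real N"])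
        then have "1 \<le> (real n + 2 / d) * infdist \<xi> C"
          using pos by (simp only: pos_divide_le_eq)
        then show ?thesis using ne by (simp add: f_def)
      qed
      then have "\<forall>\<^sub>F n in sequentially. f n \<xi> = indicator C \<xi>"
        using False by (auto simp: eventually_sequentially)
      then show ?thesis by (rule tendsto_eventually)
    qed
  qed
  have "(\<lambda>n. LINT t|M. f n t) \<longlonglongrightarrow> (LINT t|M. indicator C t)"
  proof (rule integral_dominated_convergence[where w="\<lambda>_. 1"])
    show "(indicator C :: complex \<Rightarrow> real) \<in> borel_measurable M"
      by (intro borel_measurable_indicator) (simp only: Cm circle_probsD(2)[OF M])
    show "f n \<in> borel_measurable M" for n
      by (intro borel_measurable_circle circle_probsD(2)[OF M] f_cont)
    show "AE t in M. norm (f n t) \<le> 1" for n using f01 by (intro AE_I2) simp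
    show "AE t in M. (\<lambda>n. f n t) \<longlonglongrightarrow> indicator C t" by (intro AE_I2 f_lim)
  qed simp
  moreover have "(LINT t|M. indicator C t) = measure M C"
    using Cm by (simp add: circle_probsD(2)[OF M] sets.Int_space_eq2[symmetric])
  ultimately have 1: "(\<lambda>n. LINT t|M. f n t) \<longlonglongrightarrow> measure M C" by simp
  have lims: "AE \<xi> in arclength. (\<lambda>n. f n \<xi> * circle_density M \<xi>) \<longlonglongrightarrow> indicator C \<xi> * circle_density M \<xi>"
    by (intro AE_I2 tendsto_intros f_lim)
  have meas: "(\<lambda>\<xi>. indicator C \<xi> * circle_density M \<xi>) \<in> borel_measurable arclength"
    by (intro borel_measurable_times pm borel_measurable_indicator) (use Cm in \<open>simp add: sets_arclength\<close>)
  have measf: "(\<lambda>\<xi>. f n \<xi> * circle_density M \<xi>) \<in> borel_measurable arclength" for n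
    by (intro borel_measurable_times pm borel_measurable_circle sets_arclength f_cont)
  have bound: "AE \<xi> in arclength. norm (f n \<xi> * circle_density M \<xi>) \<le> \<bar>B\<bar> / (2 * pi)" for n
  proof (rule AE_I2)
    fix \<xi> assume "\<xi> \<in> space arclength"
    then have \<xi>: "\<xi> \<in> sphere 0 1" by (simp only: space_arclength)
    show "norm (f n \<xi> * circle_density M \<xi>) \<le> \<bar>B\<bar> / (2 * pi)"
    proof (cases "\<xi> \<in> C'")
      case True
      have "\<bar>f n \<xi>\<bar> * \<bar>circle_density M \<xi>\<bar> \<le> 1 * (\<bar>B\<bar> / (2 * pi))"
        using f01[of n \<xi>] by (intro mult_mono pB True) auto
      then show ?thesis by (simp add: abs_mult)
    next
      case False
      then show ?thesis using f0 \<xi> by simp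
    qed
  qed
  have w: "integrable arclength (\<lambda>_. \<bar>B\<bar> / (2 * pi))" by (intro integrable_arclength continuous_intros)
  show "integrable arclength (\<lambda>\<xi>. indicator C \<xi> * circle_density M \<xi>)"
    by (rule integrable_dominated_convergence[OF meas measf w lims bound])
  have "(\<lambda>n. LINT \<xi>|arclength. f n \<xi> * circle_density M \<xi>)
      \<longlonglongrightarrow> (LINT \<xi>|arclength. indicator C \<xi> * circle_density M \<xi>)"
    by (rule integral_dominated_convergence[OF meas measf w lims bound])
  then have "(\<lambda>n. LINT t|M. f n t) \<longlonglongrightarrow> (LINT \<xi>|arclength. indicator C \<xi> * circle_density M \<xi>)"
    using integral_eq_density[OF ctx f_cont f0] by (simp only:)
  with 1 show "measure M C = (LINT \<xi>|arclength. indicator C \<xi> * circle_density M \<xi>)"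
    by (rule LIMSEQ_unique)
qed

text \<open>Supplies an intersection-stable generator consisting of the sets on which
  \<open>measure_compact_eq_density\<close> computes the measure.\<close>

lemma sets_restrict_space_circle:
  assumes K: "compact K" "K \<subseteq> sphere 0 1" and N: "sets N = sets circle_borel"
  shows "sets (restrict_space N K) = sigma_sets K {C. compact C \<and> C \<subseteq> K}"
proof -
  have "sets (restrict_space N K) = (\<inter>) K ` (\<inter>) (sphere 0 1) ` sets borel"
    by (simp add: sets_restrict_space N circle_borel_def)
  also have "\<dots> = (\<inter>) K ` sets borel"
    using K(2) by (auto simp: image_image Int_assoc[symmetric] Int_absorb2)
  also have "sets borel = sigma_sets UNIV (Collect closed :: complex set set)"
    by (simp add: borel_eq_closed)
  also have "(\<inter>) K ` \<dots> = sigma_sets K ((\<inter>) K ` Collect closed)"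
    using K(1) by (intro sigma_sets_Int sigma_sets.Basic) (auto simp: compact_imp_closed)
  also have "(\<inter>) K ` Collect closed = {C. compact C \<and> C \<subseteq> K}"
  proof (intro equalityI subsetI)
    fix C assume "C \<in> {C. compact C \<and> C \<subseteq> K}"
    then have "C = K \<inter> C" "closed C" by (auto simp: compact_imp_closed)
    then show "C \<in> (\<inter>) K ` Collect closed" by blast
  qed (use K(1) in \<open>auto intro: compact_Int_closed\<close>)
  finally show ?thesis .
qed

text \<open>Both measures agree on the compact subsets of \<open>K\<close>. These are stable under
  intersection and include \<open>K\<close> itself, which has finite measure, so the uniqueness
  theorem for measures applies with a constant exhaustion.\<close>

lemma has_arclength_density_on_compact:
  assumes M: "M \<in> circle_probs" and cont: "continuous_on (cball 0 1) (eta_ext M)"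
    and K: "compact K" "K \<subseteq> sphere 0 1" "\<And>\<xi>. \<xi> \<in> K \<Longrightarrow> eta_ext M (cnj \<xi>) \<noteq> 1"
  shows "has_arclength_density_on K M (circle_density M)" and "abs_cont_on K M"
proof -
  interpret M: prob_space M by (rule circle_probsD[OF M])
  let ?A = "restrict_space arclength K" and ?p = "circle_density M"
  have nonneg: "0 \<le> ?p \<xi>" if "\<xi> \<in> K" for \<xi>
    by (rule circle_density_nonneg[OF M cont K that])
  have pm: "?p \<in> borel_measurable arclength"
    by (rule circle_density_measurable[OF cont])
  then have pA: "?p \<in> borel_measurable ?A" by (rule measurable_restrict_space1)
  have Csets: "C \<in> sets circle_borel" if "compact C" "C \<subseteq> K" for C
    using that K(2) by (auto simp: circle_borel_def sets_restrict_space_iff compact_imp_closed)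
  have KA: "K \<inter> space arclength \<in> sets arclength" and KM: "K \<inter> space M \<in> sets M"
    using Csets[OF K(1)] by (auto simp: sets_arclength circle_probsD(2)[OF M])
  have eq: "restrict_space M K = density ?A (\<lambda>\<xi>. ennreal (?p \<xi>))"
  proof (rule measure_eqI_generator_eq[where E="{C. compact C \<and> C \<subseteq> K}" and \<Omega>=K and A="\<lambda>_. K"])
    show "Int_stable {C. compact C \<and> C \<subseteq> K}"
      by (auto simp: Int_stable_def compact_Int)
    show "sets (restrict_space M K) = sigma_sets K {C. compact C \<and> C \<subseteq> K}"
      by (rule sets_restrict_space_circle[OF K(1,2) circle_probsD(2)[OF M]])
    show "sets (density ?A (\<lambda>\<xi>. ennreal (?p \<xi>))) = sigma_sets K {C. compact C \<and> C \<subseteq> K}"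
      unfolding sets_density by (rule sets_restrict_space_circle[OF K(1,2) sets_arclength])
    show "emeasure (restrict_space M K) K \<noteq> \<infinity>"
      by (simp add: emeasure_restrict_space[OF KM])
    fix C assume "C \<in> {C. compact C \<and> C \<subseteq> K}"
    then have C: "compact C" "C \<subseteq> K" by auto
    have Ceta: "eta_ext M (cnj \<xi>) \<noteq> 1" if "\<xi> \<in> C" for \<xi> using K(3) C(2) that by blast
    have "C \<subseteq> sphere 0 1" using C K(2) by blast
    note mc = measure_compact_eq_density[OF M cont C(1) this Ceta]
    have "C \<in> sets ?A" using KA Csets[OF C] C(2) by (simp add: sets_restrict_space_iff sets_arclength)
    then have "emeasure (density ?A (\<lambda>\<xi>. ennreal (?p \<xi>))) C = (\<integral>\<^sup>+\<xi>. ennreal (?p \<xi>) * indicator C \<xi> \<partial>?A)"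
      using pA by (intro emeasure_density) auto
    also have "\<dots> = (\<integral>\<^sup>+\<xi>. ennreal (?p \<xi>) * indicator C \<xi> * indicator K \<xi> \<partial>arclength)"
      by (rule nn_integral_restrict_space[OF KA])
    also have "\<dots> = (\<integral>\<^sup>+\<xi>. ennreal (indicator C \<xi> * ?p \<xi>) \<partial>arclength)"
      using C(2) by (intro nn_integral_cong) (auto simp: indicator_def)
    also have "\<dots> = ennreal (LINT \<xi>|arclength. indicator C \<xi> * ?p \<xi>)"
      using C(2) nonneg by (intro nn_integral_eq_integral mc(2) AE_I2) (auto simp: indicator_def)
    also have "\<dots> = emeasure M C" by (simp only: mc(1)[symmetric] M.emeasure_eq_measure)
    finally show "emeasure (restrict_space M K) C = emeasure (density ?A (\<lambda>\<xi>. ennreal (?p \<xi>))) C"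
      by (simp add: emeasure_restrict_space[OF KM C(2)])
  qed (use K(1) in auto)
  show "has_arclength_density_on K M (circle_density M)"
    unfolding has_arclength_density_on_def using nonneg pA eq by blast
  show "abs_cont_on K M"
    unfolding abs_cont_on_def eq by (intro absolutely_continuousI_density measurable_compose[OF pA]) simp
qed

section \<open>Structure of convolution powers\<close>

text \<open>The imaginary part is a multiple of 2 pi. This is used to discard phases left open by
  the choice of a logarithm.\<close>

lemma pos_real_exp:
  assumes "pos_real (exp x)"
  shows "exp (\<i> * of_real (Im x)) = 1"
proof -
  have "sin (Im x) = 0" "0 < cos (Im x)"
    using assms by (auto simp: pos_real_def Re_exp Im_exp zero_less_mult_iff)
  then have "cos (Im x) = 1" using sin_cos_squared_add[of "Im x"] by (auto simp: power2_eq_1_iff)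
  then show ?thesis
    using \<open>sin (Im x) = 0\<close> by (simp add: cis_conv_exp[symmetric] complex_eq_iff)
qed

lemma eta_div_tendsto_mean:
  assumes "M \<in> circle_probs"
  shows "((\<lambda>z. eta M z / z) \<longlongrightarrow> circle_mean M) (at 0)"
  using DERIV_D[OF eta_has_field_derivative_0[OF assms]] by (simp add: eta_0)

lemma cmod_circle_mean_le_1:
  assumes "M \<in> circle_probs"
  shows "cmod (circle_mean M) \<le> 1"
  using Schwarz_Lemma(2)[OF eta_holomorphic[OF assms] eta_0 cmod_eta_less_1[OF assms], of 0]
  by (simp add: DERIV_imp_deriv[OF eta_has_field_derivative_0[OF assms]])

text \<open>With L a logarithm of z / eta of the square N2, one has eta N2 x = x exp (- L x) and
  \<Phi> x = x exp (\<kappa> L x). The exponent \<kappa> = k/2 - 1 appears because N2 is raised to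
  the power k/2. Up to a phase, u is \<kappa> L.\<close>

lemma free_power_structure:
  assumes "is_free_power N k M" and k: "k > 2"
  obtains u w where "u holomorphic_on ball 0 1" "\<And>z. cmod z < 1 \<Longrightarrow> 0 \<le> Re (u z)" "Im (u 0) = 0"
    "\<And>z. cmod z < 1 \<Longrightarrow> cmod (w z) < 1" "\<And>z. cmod z < 1 \<Longrightarrow> w z * exp (u (w z)) = z"
    "\<And>z. cmod z < 1 \<Longrightarrow> eta M z = w z * exp (- (u (w z) / of_real (k / 2 - 1)))"
    "circle_mean M = exp (- (u 0 * of_real (1 + 1 / (k / 2 - 1))))" "M \<in> circle_probs"
proof -
  define \<kappa> where "\<kappa> = k / 2 - 1"
  have \<kappa>: "\<kappa> > 0" using k by (simp add: \<kappa>_def)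
  obtain N2 where "is_free_power_zero_free N2 (k / 2) M"
    using assms by (auto simp: is_free_power_def)
  then obtain L \<Phi> \<rho> where N2: "N2 \<in> circle_probs" "pos_real (circle_mean N2)"
    and eta_nz: "\<And>z. z \<in> ball 0 1 - {0} \<Longrightarrow> eta N2 z \<noteq> 0" and M: "M \<in> circle_probs"
    and L: "L holomorphic_on ball 0 1" "\<And>z. z \<in> ball 0 1 - {0} \<Longrightarrow> exp (L z) = z / eta N2 z"
    and \<Phi>: "\<Phi> = (\<lambda>z. z * exp (of_real \<kappa> * L z))" "pos_real (deriv \<Phi> 0)"
    and \<rho>: "\<rho> \<in> circle_probs" "\<forall>\<^sub>F z in nhds 0. \<Phi> (eta \<rho> z) = z"
    and M_eq: "\<And>z. z \<in> ball 0 1 \<Longrightarrow> eta M z = eta N2 (eta \<rho> z)"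
    unfolding is_free_power_zero_free_def free_inf_divisible_def eta_inverse_near_0_def
      circle_probs_nz_def \<kappa>_def by auto
  have \<Phi>_hol: "\<Phi> holomorphic_on ball 0 1"
    unfolding \<Phi> by (intro holomorphic_intros L)
  have L0: "(L \<longlongrightarrow> L 0) (at 0)"
    using holomorphic_on_imp_continuous_on[OF L(1)] by (simp add: continuous_on_eq_continuous_at isCont_def)
  have nz: "\<forall>\<^sub>F z in at 0. z \<in> ball 0 1 - {0 :: complex}"
    by (intro eventually_at_in_open) auto
  \<comment> \<open>L is tied to eta only away from 0, so its value at 0 is found by a limit: exp (L
    0) is the reciprocal of the mean of N2, hence positive.\<close>
  have "((\<lambda>z. exp (L z) * (eta N2 z / z)) \<longlongrightarrow> exp (L 0) * circle_mean N2) (at 0)"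
    by (intro tendsto_intros L0 eta_div_tendsto_mean N2)
  moreover have "\<forall>\<^sub>F z in at 0. exp (L z) * (eta N2 z / z) = 1"
    using nz by eventually_elim (use L(2) eta_nz in simp)
  then have "((\<lambda>z. exp (L z) * (eta N2 z / z)) \<longlongrightarrow> 1) (at 0)" by (rule tendsto_eventually)
  ultimately have expL0: "exp (L 0) * circle_mean N2 = 1"
    using tendsto_unique by (metis trivial_limit_at)
  obtain m where m: "circle_mean N2 = of_real m" "m > 0"
    using N2(2) unfolding pos_real_def by (metis complex_is_Real_iff Reals_cases Re_complex_of_real)
  have "exp (L 0) = of_real (1 / m)" using expL0 m by (simp add: field_simps)
  then have "pos_real (exp (L 0))" using m(2) by (simp add: pos_real_def)
  from pos_real_exp[OF this] have I1: "exp (\<i> * of_real (Im (L 0))) = 1" .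
  have "(\<Phi> has_field_derivative exp (of_real \<kappa> * L 0)) (at 0)"
  proof -
    have "((\<lambda>z. (\<Phi> (0 + z) - \<Phi> 0) / z) \<longlongrightarrow> exp (of_real \<kappa> * L 0)) (at 0)"
    proof (rule Lim_transform_eventually)
      show "((\<lambda>z. exp (of_real \<kappa> * L z)) \<longlongrightarrow> exp (of_real \<kappa> * L 0)) (at 0)"
        by (intro tendsto_intros L0)
      show "\<forall>\<^sub>F z in at 0. exp (of_real \<kappa> * L z) = (\<Phi> (0 + z) - \<Phi> 0) / z"
        using nz by eventually_elim (simp add: \<Phi>)
    qed
    then show ?thesis by (simp add: DERIV_def)
  qed
  then have "pos_real (exp (of_real \<kappa> * L 0))" using \<Phi>(2) by (simp add: DERIV_imp_deriv)
  from pos_real_exp[OF this] have I2: "exp (\<i> * of_real (\<kappa> * Im (L 0))) = 1" by simp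
  \<comment> \<open>Positivity of the mean and of the derivative of \<Phi> at 0 make both Im (L 0)
    and \<kappa> Im (L 0) multiples of 2 pi. Subtracting the phase therefore changes neither exp
    (\<kappa> L) nor exp L, and it makes u real at 0.\<close>
  define u where "u = (\<lambda>z. of_real \<kappa> * (L z - \<i> * of_real (Im (L 0))))"
  define w where "w = eta \<rho>"
  have u_div: "u z / of_real \<kappa> = L z - \<i> * of_real (Im (L 0))" for z
    using \<kappa> by (simp add: u_def)
  have exp_u: "exp (u z) = exp (of_real \<kappa> * L z)" for z
  proof -
    have "u z = of_real \<kappa> * L z - \<i> * of_real (\<kappa> * Im (L 0))" by (simp add: u_def algebra_simps)
    then show ?thesis using I2 by (simp only: exp_diff div_by_1)
  qed
  \<comment> \<open>This is the Schwarz lemma |eta N2 z| <= |z|, with the bound |mean| <= 1 in its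
    place at the origin.\<close>
  have ReL: "0 \<le> Re (L z)" if z: "cmod z < 1" for z
  proof -
    have "1 \<le> cmod (exp (L z))"
    proof (cases "z = 0")
      case True
      have "m \<le> 1" using cmod_circle_mean_le_1[OF N2(1)] m by simp
      then show ?thesis
        using True \<open>exp (L 0) = of_real (1 / m)\<close> m(2) by (simp del: norm_exp_eq_Re add: norm_divide)
    next
      case False
      then have "exp (L z) = z / eta N2 z" "eta N2 z \<noteq> 0" using L(2) eta_nz z by auto
      then show ?thesis
        using cmod_eta_le[OF N2(1) z] by (simp del: norm_exp_eq_Re add: norm_divide)
    qed
    then show ?thesis by simp
  qed
  have Re_u: "0 \<le> Re (u z)" if "cmod z < 1" for z
    using ReL[OF that] \<kappa> by (simp add: u_def)
  have w1: "cmod (w z) < 1" if "cmod z < 1" for z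
    using cmod_eta_less_1[OF \<rho>(1) that] by (simp add: w_def)
  obtain S where S: "open S" "0 \<in> S" "\<And>z. z \<in> S \<Longrightarrow> \<Phi> (eta \<rho> z) = z"
    using \<rho>(2) unfolding eventually_nhds by blast
  \<comment> \<open>The inverse relation is given near 0 only; the identity theorem extends it to
    the disc.\<close>
  have inv: "\<Phi> (w z) = z" if z: "cmod z < 1" for z
  proof (rule analytic_continuation_open[of "S \<inter> ball 0 1" "ball 0 1" "\<lambda>z. \<Phi> (w z)" "\<lambda>z. z"])
    show "(\<lambda>z. \<Phi> (w z)) holomorphic_on ball 0 1"
      unfolding w_def using holomorphic_on_compose_gen[OF eta_holomorphic[OF \<rho>(1)] \<Phi>_hol]
        cmod_eta_less_1[OF \<rho>(1)] by (force simp: o_def)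
  qed (use S z in \<open>auto simp: w_def\<close>)
  have wu: "w z * exp (u (w z)) = z" if "cmod z < 1" for z
    using inv[OF that] unfolding exp_u by (simp add: \<Phi>)
  have eta_M: "eta M z = w z * exp (- (u (w z) / of_real \<kappa>))" if z: "cmod z < 1" for z
  proof (cases "w z = 0")
    case True
    then show ?thesis using M_eq z by (simp add: w_def[symmetric] eta_0)
  next
    case False
    have "exp (- (u (w z) / of_real \<kappa>)) = exp (\<i> * of_real (Im (L 0)) - L (w z))"
      by (simp only: u_div minus_diff_eq)
    also have "\<dots> = 1 / exp (L (w z))" by (simp only: exp_diff I1)
    also have "\<dots> = eta N2 (w z) / w z" using L(2)[of "w z"] False w1[OF z] by simp
    finally show ?thesis using M_eq z False by (simp add: w_def)
  qed
  \<comment> \<open>The mean is the limit of eta z / z at 0. In that quotient w z / z contributes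
    exp (- u (w z)), and w z tends to 0.\<close>
  have "circle_mean M = exp (- (u 0 * of_real (1 + 1 / \<kappa>)))"
  proof (rule tendsto_unique[OF trivial_limit_at])
    show "((\<lambda>z. eta M z / z) \<longlongrightarrow> circle_mean M) (at 0)" by (rule eta_div_tendsto_mean[OF M])
    have "(w has_field_derivative circle_mean \<rho>) (at 0)"
      unfolding w_def by (rule eta_has_field_derivative_0[OF \<rho>(1)])
    then have "isCont w 0" by (rule DERIV_isCont)
    then have "(w \<longlongrightarrow> 0) (at 0)" by (simp add: isCont_def w_def eta_0)
    moreover have "isCont u 0"
      using holomorphic_on_imp_continuous_on[OF L(1)]
      unfolding u_def by (intro continuous_intros) (simp add: continuous_on_eq_continuous_at)
    ultimately have "((\<lambda>z. u (w z)) \<longlongrightarrow> u 0) (at 0)" by (rule isCont_tendsto_compose[rotated])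
    then have lim: "((\<lambda>z. exp (- (u (w z) * of_real (1 + 1 / \<kappa>)))) \<longlongrightarrow> exp (- (u 0 * of_real (1 + 1 / \<kappa>)))) (at 0)"
      by (intro tendsto_intros)
    show "((\<lambda>z. eta M z / z) \<longlongrightarrow> exp (- (u 0 * of_real (1 + 1 / \<kappa>)))) (at 0)"
    proof (rule Lim_transform_eventually[OF lim])
      show "\<forall>\<^sub>F z in at 0. exp (- (u (w z) * of_real (1 + 1 / \<kappa>))) = eta M z / z"
        using nz
      proof eventually_elim
        case (elim z)
        then have z: "cmod z < 1" "z \<noteq> 0" by auto
        have "w z = z * exp (- u (w z))"
          using wu[OF z(1)] by (metis exp_minus_inverse mult.assoc mult.right_neutral)
        then have "w z / z = exp (- u (w z))" using z(2) by (metis nonzero_mult_div_cancel_left)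
        then have "eta M z / z = exp (- u (w z)) * exp (- (u (w z) / of_real \<kappa>))"
          unfolding eta_M[OF z(1)] by (metis times_divide_eq_left)
        also have "\<dots> = exp (- (u (w z) * of_real (1 + 1 / \<kappa>)))"
          by (simp add: exp_add[symmetric] algebra_simps)
        finally show ?case by simp
      qed
    qed
  qed
  moreover have "u holomorphic_on ball 0 1" unfolding u_def by (intro holomorphic_intros L)
  moreover have "Im (u 0) = 0" by (simp add: u_def)
  ultimately show thesis
    using that[of u w] Re_u w1 wu eta_M M unfolding \<kappa>_def by blast
qed

section \<open>Estimates for half-plane valued functions at fixed points\<close>

lemma cmod_exp_minus_diff_le:
  assumes "0 \<le> Re a" "0 \<le> Re b"
  shows "cmod (exp (- a) - exp (- b)) \<le> cmod (a - b)"
proof -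
  have "cmod (exp (- a) - exp (- b)) \<le> 1 * cmod (a - b)"
  proof (rule field_differentiable_bound[of "{z. 0 \<le> Re z}" "\<lambda>z. exp (- z)" "\<lambda>z. - exp (- z)"])
    show "convex {z. 0 \<le> Re z}" using convex_halfspace_Re_ge[of 0] by simp
    show "((\<lambda>z. exp (- z)) has_field_derivative - exp (- z)) (at z within {z. 0 \<le> Re z})" for z
      by (auto intro!: derivative_eq_intros)
  qed (use assms in auto)
  then show ?thesis by simp
qed

text \<open>Applied with r = |x| and a = Re (u x) at a point where x exp (u x) = z. From exp a >= 1
  + a it follows that a decays linearly in 1 - r near the circle.\<close>

lemma Re_le_of_fixed_point:
  fixes a r :: real
  assumes "0 < r" "r * exp a \<le> 1"
  shows "a \<le> (1 - r) / r"
proof -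
  have "exp a \<le> 1 / r" using assms by (simp add: field_simps)
  moreover have "1 + a \<le> exp a" by (rule exp_ge_add_one_self)
  ultimately have "a \<le> 1 / r - 1" by linarith
  then show ?thesis using assms(1) by (simp add: diff_divide_distrib)
qed

text \<open>In the Schwarz-Pick inequality between 0 and x, the left side carries 1 - r^2 and the
  right side Re (u x) <= (1 - r) / r. The two cancel because 2 r <= 1 + r, leaving a bound that does
  not degenerate at the circle.\<close>

lemma half_plane_fixed_point_bound:
  assumes u: "u holomorphic_on ball 0 1" "\<And>z. cmod z < 1 \<Longrightarrow> 0 \<le> Re (u z)"
    and x: "cmod x < 1" "cmod x * exp (Re (u x)) \<le> 1"
  shows "(cmod (u x - u 0))\<^sup>2 \<le> 2 * Re (u 0)"
proof (cases "x = 0")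
  case True
  then show ?thesis using u(2)[of 0] by simp
next
  case False
  define r where "r = cmod x"
  have r: "0 < r" "r < 1" using False x by (auto simp: r_def)
  have u0: "0 \<le> Re (u 0)" using u(2)[of 0] by simp
  have "(cmod (u x - u 0))\<^sup>2 * (1 - r\<^sup>2) \<le> 4 * (Re (u 0) * Re (u x)) * r\<^sup>2"
    using Schwarz_Pick_half_plane[OF u _ x(1), of 0] by (simp add: r_def)
  also have "\<dots> \<le> 4 * (Re (u 0) * ((1 - r) / r)) * r\<^sup>2"
    using Re_le_of_fixed_point[of r "Re (u x)"] r x(2) u0
    by (intro mult_right_mono mult_left_mono) (auto simp: r_def)
  also have "\<dots> = 2 * Re (u 0) * (2 * r * (1 - r))"
    using r by (simp add: power2_eq_square)
  also have "\<dots> \<le> 2 * Re (u 0) * ((1 + r) * (1 - r))"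
    using r u0 by (intro mult_left_mono mult_right_mono) auto
  also have "(1 + r) * (1 - r) = 1 - r\<^sup>2" by (simp add: power2_eq_square algebra_simps)
  finally show ?thesis
    using r by (simp add: mult_le_cancel_right abs_square_less_1 not_less abs_square_le_1)
qed

text \<open>The map x \<mapsto> x exp (- u x / \<kappa>) takes w to eta. It is Lipschitz on the
  range of w up to the circle, although \<open>u\<close> itself need not extend there, so uniform
  continuity passes from w to eta.\<close>

lemma half_plane_fixed_point_lipschitz:
  assumes u: "u holomorphic_on ball 0 1" "\<And>z. cmod z < 1 \<Longrightarrow> 0 \<le> Re (u z)" and \<kappa>: "0 < \<kappa>"
    and x: "cmod x < 1" "cmod x * exp (Re (u x)) \<le> 1"
    and y: "cmod y < 1" "cmod y * exp (Re (u y)) \<le> 1"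
  shows "cmod (x * exp (- (u x / of_real \<kappa>)) - y * exp (- (u y / of_real \<kappa>))) \<le> (1 + 2 / \<kappa>) * cmod (x - y)"
proof -
  let ?e = "\<lambda>x. exp (- (u x / of_real \<kappa>))"
  have wlog: "cmod (x * ?e x - y * ?e y) \<le> (1 + 2 / \<kappa>) * cmod (x - y)"
    if x: "cmod x < 1" "cmod x * exp (Re (u x)) \<le> 1"
      and y: "cmod y < 1" "cmod y * exp (Re (u y)) \<le> 1" and le: "cmod x \<le> cmod y" for x y
  proof -
    have pos: "0 \<le> Re (u x / of_real \<kappa>)" "0 \<le> Re (u y / of_real \<kappa>)"
      using u(2) x(1) y(1) \<kappa> by auto
    \<comment> \<open>The Schwarz-Pick inequality between x and y has (1 - s^2) (1 - r^2) on the
      left. Bounding both real parts gives (1 - s) (1 - r) / (s r) on the right, and cancelling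
      leaves s r |u x - u y|^2 <= 4 |x - y|^2. As r <= s, the product s r may be replaced by
      r^2.\<close>
    have key: "cmod x * cmod (u x - u y) \<le> 2 * cmod (x - y)"
    proof (cases "x = 0")
      case False
      define r s where "r = cmod x" and "s = cmod y"
      have r: "0 < r" "r < 1" and s: "0 < s" "s < 1" and rs: "r \<le> s"
        using False x y le by (auto simp: r_def s_def)
      have "(cmod (u x - u y))\<^sup>2 * ((1 - s\<^sup>2) * (1 - r\<^sup>2)) \<le> 4 * (Re (u y) * Re (u x)) * (cmod (x - y))\<^sup>2"
        using Schwarz_Pick_half_plane[OF u y(1) x(1)] by (simp add: r_def s_def)
      also have "\<dots> \<le> 4 * ((1 - s) / s * ((1 - r) / r)) * (cmod (x - y))\<^sup>2"
        using Re_le_of_fixed_point[of r "Re (u x)"] Re_le_of_fixed_point[of s "Re (u y)"] r s x y u(2)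
        by (intro mult_right_mono mult_left_mono mult_mono) (auto simp: r_def s_def)
      also have "\<dots> = (1 - s) * (1 - r) * (4 * (cmod (x - y))\<^sup>2) / (s * r)" by simp
      finally have "(cmod (u x - u y))\<^sup>2 * ((1 - s\<^sup>2) * (1 - r\<^sup>2)) * (s * r)
          \<le> (1 - s) * (1 - r) * (4 * (cmod (x - y))\<^sup>2)"
        using r s by (simp only: pos_le_divide_eq mult_pos_pos)
      moreover have "(cmod (u x - u y))\<^sup>2 * ((1 - s\<^sup>2) * (1 - r\<^sup>2)) * (s * r)
          = (1 - s) * (1 - r) * ((cmod (u x - u y))\<^sup>2 * ((1 + s) * (1 + r)) * (s * r))"
        by (simp add: power2_eq_square algebra_simps)
      ultimately have "(1 - s) * (1 - r) * ((cmod (u x - u y))\<^sup>2 * ((1 + s) * (1 + r)) * (s * r))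
          \<le> (1 - s) * (1 - r) * (4 * (cmod (x - y))\<^sup>2)" by simp
      then have le4: "(cmod (u x - u y))\<^sup>2 * ((1 + s) * (1 + r)) * (s * r) \<le> 4 * (cmod (x - y))\<^sup>2"
        by (rule mult_left_le_imp_le) (use r s in simp)
      have "(r * cmod (u x - u y))\<^sup>2 = (cmod (u x - u y))\<^sup>2 * (1 * 1) * (r * r)"
        by (simp add: power2_eq_square)
      also have "\<dots> \<le> (cmod (u x - u y))\<^sup>2 * ((1 + s) * (1 + r)) * (s * r)"
        using r s rs by (intro mult_mono) auto
      also have "\<dots> \<le> (2 * cmod (x - y))\<^sup>2" using le4 by (simp add: power_mult_distrib)
      finally show ?thesis unfolding r_def by (rule power2_le_imp_le) simp
    qed simp
    \<comment> \<open>The difference of exponentials is paired with x, the point of smaller modulus,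
      because \<open>key\<close> controls exactly that product.\<close>
    have "x * ?e x - y * ?e y = x * (?e x - ?e y) + (x - y) * ?e y"
      by (simp add: algebra_simps)
    also have "cmod \<dots> \<le> cmod x * cmod (?e x - ?e y) + cmod (x - y) * cmod (?e y)"
      by (metis norm_mult norm_triangle_ineq)
    also have "\<dots> \<le> cmod x * (cmod (u x - u y) / \<kappa>) + cmod (x - y) * 1"
    proof (intro add_mono mult_left_mono)
      have "cmod (?e x - ?e y) \<le> cmod (u x / of_real \<kappa> - u y / of_real \<kappa>)"
        by (rule cmod_exp_minus_diff_le[OF pos])
      also have "\<dots> = cmod (u x - u y) / \<kappa>"
        using \<kappa> by (simp add: diff_divide_distrib[symmetric] norm_divide)
      finally show "cmod (?e x - ?e y) \<le> cmod (u x - u y) / \<kappa>" .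
      show "cmod (?e y) \<le> 1" using pos(2) by simp
    qed auto
    also have "\<dots> = (cmod x * cmod (u x - u y)) / \<kappa> + cmod (x - y)" by simp
    also have "\<dots> \<le> (2 * cmod (x - y)) / \<kappa> + cmod (x - y)"
      using key \<kappa> by (intro add_right_mono divide_right_mono) auto
    also have "\<dots> = (1 + 2 / \<kappa>) * cmod (x - y)" by (simp add: distrib_right)
    finally show ?thesis .
  qed
  show ?thesis
    using wlog[OF x y] wlog[OF y x] by (cases "cmod x \<le> cmod y") (simp_all add: norm_minus_commute)
qed

text \<open>On the circle \<open>eta_ext\<close> is a \<open>Lim\<close>, which means something only
  where the limit exists. Uniform continuity provides a continuous extension to the closure, and its
  values are these limits.\<close>

lemma continuous_on_eta_ext:
  assumes "uniformly_continuous_on (ball 0 1) (eta M)"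
  shows "continuous_on (cball 0 1) (eta_ext M)"
proof -
  obtain g where g: "uniformly_continuous_on (closure (ball 0 1)) g" "\<And>x. x \<in> ball 0 1 \<Longrightarrow> eta M x = g x"
    using uniformly_continuous_on_extension_on_closure[OF assms] by metis
  have cont: "continuous_on (cball 0 1) g"
    using uniformly_continuous_imp_continuous[OF g(1)] by simp
  have "eta_ext M z = g z" if z: "z \<in> cball 0 1" for z
  proof (cases "z \<in> ball 0 1")
    case True
    then show ?thesis using g(2) by (simp add: eta_ext_def)
  next
    case False
    have "(g \<longlongrightarrow> g z) (at z within ball 0 1)"
      using cont z ball_subset_cball by (meson continuous_on_def tendsto_within_subset)
    then have "(eta M \<longlongrightarrow> g z) (at z within ball 0 1)"
      by (rule Lim_transform_eventually) (auto simp: eventually_at_filter g(2))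
    moreover have "\<not> trivial_limit (at z within ball 0 1)"
      using z by (simp add: trivial_limit_within islimpt_ball)
    ultimately have "Lim (at z within ball 0 1) (eta M) = g z" by (intro tendsto_Lim)
    then show ?thesis using False unfolding eta_ext_def by (simp only: if_False)
  qed
  then show ?thesis using cont continuous_on_cong by (metis (no_types, lifting))
qed

section \<open>Convergence of densities\<close>

text \<open>\<open>fixed_points_close\<close> with both families constantly equal to exp (- u) gives
  uniform continuity of w, and the Lipschitz estimate transfers it to eta.\<close>

lemma eta_uniformly_continuous:
  assumes M: "M \<in> circle_probs"
    and u: "u holomorphic_on ball 0 1" "\<And>z. cmod z < 1 \<Longrightarrow> 0 \<le> Re (u z)" and \<kappa>: "0 < \<kappa>"
    and w: "\<And>z. cmod z < 1 \<Longrightarrow> cmod (w z) < 1" "\<And>z. cmod z < 1 \<Longrightarrow> w z * exp (u (w z)) = z"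
    and eta: "\<And>z. cmod z < 1 \<Longrightarrow> eta M z = w z * exp (- (u (w z) / of_real \<kappa>))"
  shows "uniformly_continuous_on (ball 0 1) (eta M)"
  unfolding uniformly_continuous_on_sequentially
proof (intro allI impI, elim conjE)
  fix x y assume xy: "\<forall>n. x n \<in> ball (0::complex) 1" "\<forall>n. y n \<in> ball 0 1" "(\<lambda>n. dist (x n) (y n)) \<longlonglongrightarrow> 0"
  have x: "cmod (x n) < 1" and y: "cmod (y n) < 1" for n using xy by auto
  let ?E = "\<lambda>z. exp (- u z)"
  have E: "?E holomorphic_on ball 0 1" "?E 0 \<noteq> 0" by (intro holomorphic_intros u) simp
  have E1: "cmod (?E z) \<le> 1" if "cmod z < 1" for z using u(2)[OF that] by simp
  have fix_w: "w z = z * ?E (w z)" if "cmod z < 1" for z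
    using w(2)[OF that] by (metis exp_minus_inverse mult.assoc mult.right_neutral)
  have lim0: "(\<lambda>n. x n - y n) \<longlonglongrightarrow> 0"
    using xy(3) by (simp add: dist_norm tendsto_norm_zero_iff)
  have "(\<lambda>n. w (x n) - w (y n)) \<longlonglongrightarrow> 0"
    by (rule fixed_points_close[OF E, of "\<lambda>_. ?E" "\<lambda>_. ?E" x y])
      (rule E E1 tendsto_const x y lim0 w(1) fix_w | assumption)+
  then have lim: "(\<lambda>n. (1 + 2 / \<kappa>) * cmod (w (x n) - w (y n))) \<longlonglongrightarrow> 0"
    by (intro tendsto_mult_right_zero tendsto_norm_zero)
  have small: "cmod (w z) * exp (Re (u (w z))) \<le> 1" if "cmod z < 1" for z
    using w(2)[OF that] that by (metis less_imp_le norm_exp_eq_Re norm_mult)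
  have "dist (eta M (x n)) (eta M (y n)) \<le> (1 + 2 / \<kappa>) * cmod (w (x n) - w (y n))" for n
    unfolding dist_norm eta[OF x] eta[OF y]
    by (rule half_plane_fixed_point_lipschitz[OF u \<kappa>]) (rule w(1) small x y | assumption)+
  then show "(\<lambda>n. dist (eta M (x n)) (eta M (y n))) \<longlonglongrightarrow> 0"
    using tendsto_sandwich[OF _ _ tendsto_const lim] by simp
qed

section \<open>Uniform limits: moving arguments and passage to the closure\<close>

lemma uniform_limit_compose_point:
  fixes f :: "nat \<Rightarrow> complex \<Rightarrow> complex"
  assumes unif: "\<And>K. compact K \<Longrightarrow> K \<subseteq> S \<Longrightarrow> uniform_limit K f g sequentially" and S: "open S"
    and g: "continuous_on S g" and x: "x \<longlonglongrightarrow> a" "a \<in> S"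
  shows "(\<lambda>n. f n (x n)) \<longlonglongrightarrow> g a"
proof -
  obtain e where e: "e > 0" "cball a e \<subseteq> S" using S x(2) open_contains_cball by blast
  have ev: "\<forall>\<^sub>F n in sequentially. x n \<in> cball a e"
    using tendstoD[OF x(1) e(1)] by eventually_elim (simp add: dist_commute less_imp_le)
  have "(\<lambda>n. f n (x n) - g (x n)) \<longlonglongrightarrow> 0"
  proof (rule tendstoI)
    fix d :: real assume "0 < d"
    have "\<forall>\<^sub>F n in sequentially. \<forall>y\<in>cball a e. dist (f n y) (g y) < d"
      using uniform_limitD[OF unif[OF compact_cball e(2)] \<open>0 < d\<close>] .
    with ev show "\<forall>\<^sub>F n in sequentially. dist (f n (x n) - g (x n)) 0 < d"
      by eventually_elim (simp add: dist_norm)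
  qed
  moreover have "(\<lambda>n. g (x n)) \<longlonglongrightarrow> g a"
    using ev e(2) by (intro continuous_on_tendsto_compose[OF g x]) (auto elim!: eventually_mono)
  ultimately show ?thesis using tendsto_add by fastforce
qed

lemma uniform_limit_closure_dist:
  fixes f :: "nat \<Rightarrow> complex \<Rightarrow> complex"
  assumes "uniform_limit S f g sequentially" and f: "\<And>n. continuous_on (closure S) (f n)"
    and g: "continuous_on (closure S) g"
  shows "uniform_limit (closure S) f g sequentially"
proof (rule uniform_limitI)
  fix e :: real assume "0 < e"
  then have "\<forall>\<^sub>F n in sequentially. \<forall>x\<in>S. dist (f n x) (g x) < e / 2"
    using uniform_limitD[OF assms(1), of "e / 2"] by simp
  then show "\<forall>\<^sub>F n in sequentially. \<forall>x\<in>closure S. dist (f n x) (g x) < e"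
  proof eventually_elim
    case (elim n)
    have "dist (f n x) (g x) \<le> e / 2" if "x \<in> closure S" for x
      by (rule continuous_le_on_closure[OF _ that])
        (use elim in \<open>auto intro!: continuous_intros f g less_imp_le\<close>)
    then show ?case using \<open>0 < e\<close> by force
  qed
qed

text \<open>\<open>w n\<close> plays the role of the subordination function \<open>eta \<rho>\<close> of the \<open>n\<close>th convolution power.
  Montel's theorem applied to \<open>exp (- u n)\<close> replaces the representation theorem for infinitely
  divisible laws: a subsequential limit yields the fixed point equation for \<open>eta \<mu>\<close>.\<close>

locale convergent_powers =
  fixes Ms :: "nat \<Rightarrow> complex measure" and \<mu> :: "complex measure"
    and u w :: "nat \<Rightarrow> complex \<Rightarrow> complex" and \<kappa> :: "nat \<Rightarrow> real" and B :: real
  assumes Ms: "\<And>n. Ms n \<in> circle_probs" and \<mu>: "\<mu> \<in> circle_probs"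
    and u: "\<And>n. u n holomorphic_on ball 0 1" "\<And>n z. cmod z < 1 \<Longrightarrow> 0 \<le> Re (u n z)"
      "\<And>n. Im (u n 0) = 0" "\<And>n. Re (u n 0) \<le> B"
    and \<kappa>: "\<And>n. 0 < \<kappa> n" "filterlim \<kappa> at_top sequentially"
    and w: "\<And>n z. cmod z < 1 \<Longrightarrow> cmod (w n z) < 1"
      "\<And>n z. cmod z < 1 \<Longrightarrow> w n z * exp (u n (w n z)) = z"
    and eta_Ms: "\<And>n z. cmod z < 1 \<Longrightarrow> eta (Ms n) z = w n z * exp (- (u n (w n z) / of_real (\<kappa> n)))"
    and lim: "\<And>z. cmod z < 1 \<Longrightarrow> (\<lambda>n. eta (Ms n) z) \<longlonglongrightarrow> eta \<mu> z"
begin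

abbreviation E :: "nat \<Rightarrow> complex \<Rightarrow> complex" where
  "E n z \<equiv> exp (- u n z)"

lemma E_holomorphic: "E n holomorphic_on ball 0 1"
  by (intro holomorphic_intros u)

lemma cmod_E_le_1: "cmod z < 1 \<Longrightarrow> cmod (E n z) \<le> 1"
  using u(2) by simp

lemma w_fixed_point: "cmod z < 1 \<Longrightarrow> w n z = z * E n (w n z)"
  using w(2) by (metis exp_minus_inverse mult.assoc mult.right_neutral)

text \<open>The constant does not depend on z: u(0) is real and between 0 and B, and at a fixed
  point u differs from u(0) by at most sqrt (2 B).\<close>

lemma cmod_eta_diff_w:
  assumes z: "cmod z < 1"
  shows "cmod (eta (Ms n) z - w n z) \<le> (B + sqrt (2 * B)) / \<kappa> n"
proof -
  define x where "x = w n z"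
  have x: "cmod x < 1" "cmod x * exp (Re (u n x)) \<le> 1"
    using w[OF z] z unfolding x_def by (metis, metis less_imp_le norm_exp_eq_Re norm_mult)
  have "(cmod (u n x - u n 0))\<^sup>2 \<le> 2 * Re (u n 0)"
    by (rule half_plane_fixed_point_bound[OF u(1,2) x])
  also have "\<dots> \<le> 2 * B" using u(4) by simp
  finally have "cmod (u n x - u n 0) \<le> sqrt (2 * B)" by (rule real_le_rsqrt)
  moreover have "cmod (u n 0) \<le> B"
    using u(4)[of n] u(2)[of 0 n] u(3)[of n] by (simp add: cmod_eq_Re)
  ultimately have "cmod (u n x) \<le> B + sqrt (2 * B)"
    using norm_triangle_ineq2[of "u n x" "u n 0"] by linarith
  have Re0: "0 \<le> Re (u n x / of_real (\<kappa> n))"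
    using u(2)[OF x(1)] \<kappa>(1)[of n] by simp
  have "eta (Ms n) z - w n z = x * (exp (- (u n x / of_real (\<kappa> n))) - exp (- 0))"
    by (simp add: eta_Ms[OF z] x_def algebra_simps)
  also have "cmod \<dots> \<le> 1 * cmod (u n x / of_real (\<kappa> n) - 0)"
    unfolding norm_mult using x(1) Re0 by (intro mult_mono cmod_exp_minus_diff_le) auto
  also have "\<dots> = cmod (u n x) / \<kappa> n" using \<kappa>(1)[of n] by (simp add: norm_divide)
  also have "\<dots> \<le> (B + sqrt (2 * B)) / \<kappa> n"
    using \<open>cmod (u n x) \<le> _\<close> \<kappa>(1)[of n] by (simp add: divide_right_mono)
  finally show ?thesis .
qed

lemma bound_tendsto: "(\<lambda>n. (B + sqrt (2 * B)) / \<kappa> n) \<longlonglongrightarrow> 0"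
  by (rule tendsto_divide_0[OF tendsto_const]) (rule filterlim_mono[OF \<kappa>(2) at_top_le_at_infinity order_refl])

lemma eta_diff_w_tendsto:
  assumes "strict_mono r" "\<And>n. cmod (z n) < 1"
  shows "(\<lambda>n. eta (Ms (r n)) (z n) - w (r n) (z n)) \<longlonglongrightarrow> 0"
proof (rule Lim_null_comparison)
  show "(\<lambda>n. (B + sqrt (2 * B)) / \<kappa> (r n)) \<longlonglongrightarrow> 0"
    using LIMSEQ_subseq_LIMSEQ[OF bound_tendsto assms(1)] by (simp add: o_def)
qed (use cmod_eta_diff_w assms(2) in auto)

lemma w_tendsto:
  assumes "cmod z < 1"
  shows "(\<lambda>n. w n z) \<longlonglongrightarrow> eta \<mu> z"
proof -
  have "(\<lambda>n. eta (Ms n) z - w n z) \<longlonglongrightarrow> 0"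
    using eta_diff_w_tendsto[of "\<lambda>n. n" "\<lambda>_. z"] assms by (simp add: strict_mono_def)
  from tendsto_diff[OF lim[OF assms] this] show ?thesis by simp
qed

lemma subsequence_limit:
  assumes r: "strict_mono (r :: nat \<Rightarrow> nat)"
  obtains s G where "strict_mono (s :: nat \<Rightarrow> nat)" "G holomorphic_on ball 0 1" "G 0 \<noteq> 0"
    "\<And>z. cmod z < 1 \<Longrightarrow> cmod (G z) \<le> 1"
    "\<And>z. cmod z < 1 \<Longrightarrow> (\<lambda>n. E (r (s n)) z) \<longlonglongrightarrow> G z"
    "\<And>z. cmod z < 1 \<Longrightarrow> eta \<mu> z = z * G (eta \<mu> z)"
proof -
  have hol: "h holomorphic_on ball 0 1" if "h \<in> range (\<lambda>n. E (r n))" for h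
    using that E_holomorphic by auto
  have bnd: "\<exists>b. \<forall>h \<in> range (\<lambda>n. E (r n)). \<forall>z \<in> K. norm (h z) \<le> b" if "K \<subseteq> ball 0 1" for K
  proof (intro exI[of _ 1] ballI)
    fix h z assume "h \<in> range (\<lambda>n. E (r n))" "z \<in> K"
    then show "norm (h z) \<le> 1" using cmod_E_le_1[of z] that by auto
  qed
  obtain G s where G: "G holomorphic_on ball 0 1" and s: "strict_mono (s :: nat \<Rightarrow> nat)"
    and Glim: "\<And>z. z \<in> ball 0 1 \<Longrightarrow> (\<lambda>n. E (r (s n)) z) \<longlonglongrightarrow> G z"
    and Gunif: "\<And>K. compact K \<Longrightarrow> K \<subseteq> ball 0 1 \<Longrightarrow> uniform_limit K ((\<lambda>n. E (r n)) \<circ> s) G sequentially"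
    by (rule Montel[of "ball 0 1" "range (\<lambda>n. E (r n))" "\<lambda>n. E (r n)"])
      (use hol bnd in \<open>blast intro: open_ball\<close>)+
  have t: "strict_mono (\<lambda>n. r (s n))" using r s by (simp add: strict_mono_def)
  show thesis
  proof
    \<comment> \<open>The uniform bound Re (u n 0) <= B keeps the values at 0 away from zero, and
      this survives the limit.\<close>
    have "exp (- B) \<le> cmod (G 0)"
    proof (rule tendsto_lowerbound[OF tendsto_norm[OF Glim[of 0]]])
      show "\<forall>\<^sub>F n in sequentially. exp (- B) \<le> cmod (E (r (s n)) 0)"
        using u(4) by simp
    qed simp_all
    then show "G 0 \<noteq> 0" by (metis exp_gt_zero norm_zero not_le)
    show "cmod (G z) \<le> 1" if "cmod z < 1" for z
      by (rule tendsto_upperbound[OF tendsto_norm[OF Glim]])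
        (use that cmod_E_le_1 in auto)
    show "(\<lambda>n. E (r (s n)) z) \<longlonglongrightarrow> G z" if "cmod z < 1" for z using Glim that by simp
    show "eta \<mu> z = z * G (eta \<mu> z)" if z: "cmod z < 1" for z
    proof -
      have wt: "(\<lambda>n. w (r (s n)) z) \<longlonglongrightarrow> eta \<mu> z"
        using LIMSEQ_subseq_LIMSEQ[OF w_tendsto[OF z] t] by (simp add: o_def)
      \<comment> \<open>Function and argument both vary here. The limit of the arguments is inside
        the disc, so locally uniform convergence suffices.\<close>
      have "(\<lambda>n. ((\<lambda>n. E (r n)) \<circ> s) n (w (r (s n)) z)) \<longlonglongrightarrow> G (eta \<mu> z)"
        by (rule uniform_limit_compose_point[OF Gunif open_ball])
          (use holomorphic_on_imp_continuous_on[OF G] wt cmod_eta_less_1[OF \<mu> z] in auto)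
      then have "(\<lambda>n. z * E (r (s n)) (w (r (s n)) z)) \<longlonglongrightarrow> z * G (eta \<mu> z)"
        by (intro tendsto_mult tendsto_const) (simp add: o_def)
      then have "(\<lambda>n. w (r (s n)) z) \<longlonglongrightarrow> z * G (eta \<mu> z)"
        by (simp only: w_fixed_point[OF z, symmetric])
      then show ?thesis using wt LIMSEQ_unique by blast
    qed
  qed (use G s in auto)
qed

text \<open>A failure would produce points z n with distance at least e along a subsequence. On a
  further one the maps converge to some G, and w n (z n) and eta \<mu> (z n) are fixed points for
  the same z n under maps with common limit G, so they approach each other. G may depend on the
  subsequence.\<close>

lemma uniform_limit_eta: "uniform_limit (ball 0 1) (\<lambda>n. eta (Ms n)) (eta \<mu>) sequentially"
proof (rule ccontr)
  assume "\<not> ?thesis"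
  then obtain e where e: "e > 0"
    "\<not> (\<forall>\<^sub>F n in sequentially. \<forall>z\<in>ball 0 1. dist (eta (Ms n) z) (eta \<mu> z) < e)"
    unfolding uniform_limit_iff by blast
  then have inf: "infinite {n. \<not> (\<forall>z\<in>ball 0 1. dist (eta (Ms n) z) (eta \<mu> z) < e)}"
    unfolding cofinite_eq_sequentially[symmetric] eventually_cofinite by simp
  obtain r :: "nat \<Rightarrow> nat" where r: "strict_mono r"
    "\<forall>n. r n \<in> {n. \<not> (\<forall>z\<in>ball 0 1. dist (eta (Ms n) z) (eta \<mu> z) < e)}"
    using infinite_enumerate[OF inf] by blast
  then have "\<forall>n. \<exists>z\<in>ball 0 1. \<not> dist (eta (Ms (r n)) z) (eta \<mu> z) < e" by simp
  then obtain z where z_ball: "\<And>n. z n \<in> ball 0 1"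
    and z_far: "\<And>n. \<not> dist (eta (Ms (r n)) (z n)) (eta \<mu> (z n)) < e"
    by metis
  have z: "cmod (z n) < 1" for n using z_ball[of n] by simp
  obtain s G where s: "strict_mono (s :: nat \<Rightarrow> nat)"
    and G: "G holomorphic_on ball 0 1" "G 0 \<noteq> 0" "\<And>z. cmod z < 1 \<Longrightarrow> cmod (G z) \<le> 1"
      "\<And>z. cmod z < 1 \<Longrightarrow> (\<lambda>n. E (r (s n)) z) \<longlonglongrightarrow> G z"
      "\<And>z. cmod z < 1 \<Longrightarrow> eta \<mu> z = z * G (eta \<mu> z)"
    by (rule subsequence_limit[OF r(1)]) blast
  have t: "strict_mono (\<lambda>n. r (s n))" using r(1) s by (simp add: strict_mono_def)
  have zero: "(\<lambda>n. z (s n) - z (s n)) \<longlonglongrightarrow> 0" by simp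
  have "(\<lambda>n. w (r (s n)) (z (s n)) - eta \<mu> (z (s n))) \<longlonglongrightarrow> 0"
    by (rule fixed_points_close[OF G(1,2), of "\<lambda>n. E (r (s n))" "\<lambda>_. G" "\<lambda>n. z (s n)" "\<lambda>n. z (s n)"])
      (rule E_holomorphic cmod_E_le_1 G tendsto_const z zero w(1) w_fixed_point cmod_eta_less_1[OF \<mu>]
        | assumption)+
  from tendsto_add[OF eta_diff_w_tendsto[OF t, of "\<lambda>n. z (s n)", OF z] this]
  have "(\<lambda>n. eta (Ms (r (s n))) (z (s n)) - eta \<mu> (z (s n))) \<longlonglongrightarrow> 0" by simp
  then have "\<forall>\<^sub>F n in sequentially. dist (eta (Ms (r (s n))) (z (s n)) - eta \<mu> (z (s n))) 0 < e"
    using e(1) by (rule tendstoD)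
  then obtain n where "dist (eta (Ms (r (s n))) (z (s n)) - eta \<mu> (z (s n))) 0 < e"
    by (auto simp: eventually_sequentially)
  then show False using z_far[of "s n"] by (simp add: dist_norm)
qed

lemma continuous_on_eta_ext_Ms: "continuous_on (cball 0 1) (eta_ext (Ms n))"
  by (intro continuous_on_eta_ext eta_uniformly_continuous[of _ "u n" "\<kappa> n" "w n"])
    (rule Ms u \<kappa> w eta_Ms | assumption)+

text \<open>The values of eta \<mu> solve a fixed point equation with a limit map G, so
  \<open>fixed_points_close\<close> applies with G in both families.\<close>

lemma continuous_on_eta_ext_limit: "continuous_on (cball 0 1) (eta_ext \<mu>)"
proof (rule continuous_on_eta_ext)
  obtain G where G: "G holomorphic_on ball 0 1" "G 0 \<noteq> 0" "\<And>z. cmod z < 1 \<Longrightarrow> cmod (G z) \<le> 1"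
      "\<And>z. cmod z < 1 \<Longrightarrow> eta \<mu> z = z * G (eta \<mu> z)"
    by (rule subsequence_limit[of "\<lambda>n. n"]) (auto simp: strict_mono_def)
  show "uniformly_continuous_on (ball 0 1) (eta \<mu>)"
    unfolding uniformly_continuous_on_sequentially
  proof (intro allI impI, elim conjE)
    fix x y assume xy: "\<forall>n. x n \<in> ball (0::complex) 1" "\<forall>n. y n \<in> ball 0 1" "(\<lambda>n. dist (x n) (y n)) \<longlonglongrightarrow> 0"
    have x: "cmod (x n) < 1" and y: "cmod (y n) < 1" for n using xy by auto
    have lim0: "(\<lambda>n. x n - y n) \<longlonglongrightarrow> 0"
      using xy(3) by (simp add: dist_norm tendsto_norm_zero_iff)
    have "(\<lambda>n. eta \<mu> (x n) - eta \<mu> (y n)) \<longlonglongrightarrow> 0"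
      by (rule fixed_points_close[OF G(1,2), of "\<lambda>_. G" "\<lambda>_. G" x y])
        (rule G tendsto_const x y lim0 cmod_eta_less_1[OF \<mu>] | assumption)+
    then show "(\<lambda>n. dist (eta \<mu> (x n)) (eta \<mu> (y n))) \<longlonglongrightarrow> 0"
      by (simp add: dist_norm tendsto_norm_zero_iff)
  qed
qed

lemma uniform_limit_eta_ext:
  "uniform_limit (cball 0 1) (\<lambda>n. eta_ext (Ms n)) (eta_ext \<mu>) sequentially"
proof -
  have "uniform_limit (ball 0 1) (\<lambda>n. eta_ext (Ms n)) (eta_ext \<mu>) sequentially"
    using uniform_limit_eta by (rule uniform_limit_cong'[THEN iffD1, rotated 2]) (auto simp: eta_ext_def)
  then show ?thesis
    using uniform_limit_closure_dist[where S="ball 0 1"] continuous_on_eta_ext_Ms continuous_on_eta_ext_limit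
    by simp
qed

lemma densities_converge:
  assumes K: "compact K" "K \<subseteq> sphere 0 1 - exceptional_set \<mu>"
  shows "\<forall>\<^sub>F n in sequentially. abs_cont_on K (Ms n) \<and>
      has_arclength_density_on K (Ms n) (circle_density (Ms n))"
    and "uniform_limit K (\<lambda>n. circle_density (Ms n)) (circle_density \<mu>) sequentially"
proof -
  have K1: "cnj \<xi> \<in> cball 0 1" if "\<xi> \<in> K" for \<xi> using that K(2) by auto
  have ne1: "eta_ext \<mu> (cnj \<xi>) \<noteq> 1" if \<xi>: "\<xi> \<in> K" for \<xi>
  proof
    assume "eta_ext \<mu> (cnj \<xi>) = 1"
    moreover have "cnj \<xi> \<in> sphere 0 1" using K(2) \<xi> by auto
    ultimately have "cnj (cnj \<xi>) \<in> exceptional_set \<mu>" unfolding exceptional_set_def by blast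
    then show False using K(2) \<xi> by auto
  qed
  have contK: "continuous_on K (\<lambda>\<xi>. cmod (1 - eta_ext \<mu> (cnj \<xi>)))"
    by (intro continuous_intros continuous_on_compose2[OF continuous_on_eta_ext_limit]) (use K1 in auto)
  \<comment> \<open>By compactness eta \<mu> keeps a distance d from 1 over K; an empty K has no
    minimiser, and any positive number serves.\<close>
  obtain d where d: "d > 0" "\<And>\<xi>. \<xi> \<in> K \<Longrightarrow> d \<le> cmod (1 - eta_ext \<mu> (cnj \<xi>))"
  proof (cases "K = {}")
    case True
    then show thesis using that[of 1] by simp
  next
    case False
    then obtain \<zeta> where "\<zeta> \<in> K" "\<forall>\<xi>\<in>K. cmod (1 - eta_ext \<mu> (cnj \<zeta>)) \<le> cmod (1 - eta_ext \<mu> (cnj \<xi>))"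
      using continuous_attains_inf[OF K(1) _ contK] by blast
    then show thesis using that[of "cmod (1 - eta_ext \<mu> (cnj \<zeta>))"] ne1[of \<zeta>] by auto
  qed
  have close: "\<forall>\<^sub>F n in sequentially. \<forall>\<xi>\<in>K. cmod (eta_ext (Ms n) (cnj \<xi>) - eta_ext \<mu> (cnj \<xi>)) < e"
    if "e > 0" for e
    using uniform_limitD[OF uniform_limit_eta_ext that]
    by eventually_elim (use K1 in \<open>auto simp: dist_norm\<close>)
  have away: "d / 2 \<le> cmod (1 - eta_ext (Ms n) (cnj \<xi>))"
    if "cmod (eta_ext (Ms n) (cnj \<xi>) - eta_ext \<mu> (cnj \<xi>)) < d / 2" "\<xi> \<in> K" for n \<xi>
  proof -
    have "cmod (1 - eta_ext \<mu> (cnj \<xi>)) \<le> cmod (1 - eta_ext (Ms n) (cnj \<xi>))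
        + cmod (eta_ext (Ms n) (cnj \<xi>) - eta_ext \<mu> (cnj \<xi>))"
      using norm_triangle_ineq[of "1 - eta_ext (Ms n) (cnj \<xi>)" "eta_ext (Ms n) (cnj \<xi>) - eta_ext \<mu> (cnj \<xi>)"]
      by simp
    then show ?thesis using d(2)[OF that(2)] that(1) by linarith
  qed
  show "\<forall>\<^sub>F n in sequentially. abs_cont_on K (Ms n) \<and>
      has_arclength_density_on K (Ms n) (circle_density (Ms n))"
    using close[OF half_gt_zero[OF d(1)]]
  proof eventually_elim
    case (elim n)
    have "eta_ext (Ms n) (cnj \<xi>) \<noteq> 1" if "\<xi> \<in> K" for \<xi>
      using away[of n \<xi>] elim that d(1) by auto
    moreover have "K \<subseteq> sphere 0 1" using K(2) by blast
    ultimately show ?case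
      using has_arclength_density_on_compact[OF Ms continuous_on_eta_ext_Ms K(1)] by blast
  qed
  show "uniform_limit K (\<lambda>n. circle_density (Ms n)) (circle_density \<mu>) sequentially"
  proof (rule uniform_limitI)
    fix e :: real assume "0 < e"
    \<comment> \<open>The first term keeps the approximating values at distance d / 2 from 1. The
      second offsets the factor 4 / d^2 by which the Cayley transform then expands distances; the
      factor 1 / (2 pi) is estimated by 1.\<close>
    define e' where "e' = min (d / 2) (e * d\<^sup>2 / 4)"
    have "0 < e'" using d(1) \<open>0 < e\<close> by (simp add: e'_def)
    from close[OF this]
    show "\<forall>\<^sub>F n in sequentially. \<forall>\<xi>\<in>K. dist (circle_density (Ms n) \<xi>) (circle_density \<mu> \<xi>) < e"
    proof eventually_elim
      case (elim n)
      show ?case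
      proof
        fix \<xi> assume \<xi>: "\<xi> \<in> K"
        define a b where "a = eta_ext (Ms n) (cnj \<xi>)" and "b = eta_ext \<mu> (cnj \<xi>)"
        have ab: "cmod (a - b) < e'" using elim \<xi> by (simp add: a_def b_def)
        have a: "d / 2 \<le> cmod (1 - a)" using away[of n \<xi>] ab \<xi> by (simp add: a_def b_def e'_def)
        have b: "d \<le> cmod (1 - b)" using d(2)[OF \<xi>] by (simp add: b_def)
        have nz: "1 - a \<noteq> 0" "1 - b \<noteq> 0" using a b d(1) by auto
        have "(1 + a) / (1 - a) - (1 + b) / (1 - b) = ((1 + a) * (1 - b) - (1 + b) * (1 - a)) / ((1 - a) * (1 - b))"
          by (rule diff_frac_eq[OF nz])
        also have "(1 + a) * (1 - b) - (1 + b) * (1 - a) = 2 * (a - b)" by (simp add: algebra_simps)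
        finally have eq: "cmod ((1 + a) / (1 - a) - (1 + b) / (1 - b)) = 2 * cmod (a - b) / (cmod (1 - a) * cmod (1 - b))"
          by (simp only: norm_divide norm_mult norm_numeral)
        have "circle_density (Ms n) \<xi> - circle_density \<mu> \<xi> = Re ((1 + a) / (1 - a) - (1 + b) / (1 - b)) / (2 * pi)"
          unfolding circle_density_def a_def[symmetric] b_def[symmetric] minus_complex.sel
          by (simp add: diff_divide_distrib)
        then have "dist (circle_density (Ms n) \<xi>) (circle_density \<mu> \<xi>)
            = \<bar>Re ((1 + a) / (1 - a) - (1 + b) / (1 - b))\<bar> / (2 * pi)"
          by (simp only: dist_real_def abs_divide) simp
        also have "\<dots> \<le> \<bar>Re ((1 + a) / (1 - a) - (1 + b) / (1 - b))\<bar> / 1"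
          using pi_gt3 by (intro divide_left_mono) auto
        also have "\<dots> \<le> cmod ((1 + a) / (1 - a) - (1 + b) / (1 - b))"
          unfolding div_by_1 by (rule abs_Re_le_cmod)
        also have "\<dots> \<le> 2 * cmod (a - b) / (d / 2 * d)"
          unfolding eq using a b d(1) by (intro divide_left_mono mult_mono) (auto intro!: mult_pos_pos)
        also have "\<dots> = cmod (a - b) * (4 / d\<^sup>2)" by (simp add: power2_eq_square)
        also have "\<dots> < e * d\<^sup>2 / 4 * (4 / d\<^sup>2)"
          using ab d(1) by (intro mult_strict_right_mono) (auto simp: e'_def)
        also have "\<dots> = e" using d(1) by simp
        finally show "dist (circle_density (Ms n) \<xi>) (circle_density \<mu> \<xi>) < e" .
      qed
    qed
  qed
qed

end

theorem theorem6p4: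
  fixes k :: "nat \<Rightarrow> real" and \<mu> :: "complex measure"
    and \<nu> \<nu>pow :: "nat \<Rightarrow> complex measure"
  assumes "\<And>n. k n \<ge> 2" and "filterlim k at_top sequentially"
    and "\<mu> \<in> circle_probs_nz" and "\<And>n. \<nu> n \<in> circle_probs_nz"
    and "free_inf_divisible \<mu>"
    and "\<And>n. pos_real (circle_mean (\<nu> n))"
    and "\<And>n. is_free_power (\<nu> n) (k n) (\<nu>pow n)"
    and "circle_weak_conv \<nu>pow \<mu>"
  shows "(\<forall>K. compact K \<and> K \<subseteq> sphere 0 1 - exceptional_set \<mu> \<longrightarrow>
            (\<forall>\<^sub>F n in sequentially. abs_cont_on K (\<nu>pow n) \<and>
               has_arclength_density_on K (\<nu>pow n) (circle_density (\<nu>pow n))) \<and>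
            uniform_limit K (\<lambda>n. circle_density (\<nu>pow n)) (circle_density \<mu>) sequentially) \<and>
         (exceptional_set \<mu> = {} \<longrightarrow>
            (\<forall>\<^sub>F n in sequentially. abs_cont_on (sphere 0 1) (\<nu>pow n) \<and>
               has_arclength_density_on (sphere 0 1) (\<nu>pow n) (circle_density (\<nu>pow n))) \<and>
            uniform_limit (sphere 0 1) (\<lambda>n. circle_density (\<nu>pow n)) (circle_density \<mu>)
              sequentially)"
proof -
  have \<mu>: "\<mu> \<in> circle_probs" "circle_mean \<mu> \<noteq> 0"
    using assms(3) by (auto simp: circle_probs_nz_def)
  have probs: "\<nu>pow n \<in> circle_probs" for n
    using assms(7)[of n] by (auto simp: is_free_power_def is_free_conv_def is_free_power_zero_free_def circle_probs_nz_def)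
  \<comment> \<open>A lower bound for the modulus of the means becomes an upper bound for Re (u 0),
    since the modulus is exp (- (1 + 1/\<kappa>) Re (u 0)).\<close>
  define \<delta> where "\<delta> = cmod (circle_mean \<mu>) / 2"
  have \<delta>: "0 < \<delta>" "\<delta> < cmod (circle_mean \<mu>)" using \<mu>(2) by (auto simp: \<delta>_def)
  have "(\<lambda>n. circle_mean (\<nu>pow n)) \<longlonglongrightarrow> circle_mean \<mu>"
    unfolding circle_mean_def
    by (intro circle_weak_conv_complex[OF assms(8) probs \<mu>(1)] continuous_intros)
  then have "\<forall>\<^sub>F n in sequentially. \<delta> < cmod (circle_mean (\<nu>pow n))"
    using order_tendstoD(1)[OF tendsto_norm \<delta>(2)] by blast
  \<comment> \<open>For k = 2 the power is the convolution itself, with no subordination function in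
    its definition, and \<kappa> would be 0.\<close>
  moreover have "\<forall>\<^sub>F n in sequentially. 2 < k n"
    using assms(2) by (simp add: filterlim_at_top_dense)
  ultimately have "\<forall>\<^sub>F n in sequentially. \<delta> < cmod (circle_mean (\<nu>pow n)) \<and> 2 < k n"
    by (rule eventually_conj)
  then obtain n0 where n0: "\<And>n. n \<ge> n0 \<Longrightarrow> \<delta> < cmod (circle_mean (\<nu>pow n))" "\<And>n. n \<ge> n0 \<Longrightarrow> 2 < k n"
    unfolding eventually_sequentially by blast
  \<comment> \<open>The locale requires its bounds at every index, so the sequence starts at n0. The
    shift is undone in \<open>main\<close>, where only asymptotic statements remain.\<close>
  define Ms where "Ms = (\<lambda>n. \<nu>pow (n + n0))"
  define \<kappa> where "\<kappa> = (\<lambda>n. k (n + n0) / 2 - 1)"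
  have \<kappa>: "0 < \<kappa> n" for n using n0(2)[of "n + n0"] by (simp add: \<kappa>_def)
  have "\<exists>u w. u holomorphic_on ball 0 1 \<and> (\<forall>z. cmod z < 1 \<longrightarrow> 0 \<le> Re (u z)) \<and> Im (u 0) = 0 \<and>
    Re (u 0) \<le> - ln \<delta> \<and>
    (\<forall>z. cmod z < 1 \<longrightarrow> cmod (w z) < 1) \<and> (\<forall>z. cmod z < 1 \<longrightarrow> w z * exp (u (w z)) = z) \<and>
    (\<forall>z. cmod z < 1 \<longrightarrow> eta (Ms n) z = w z * exp (- (u (w z) / of_real (\<kappa> n))))" for n
  proof -
    have "2 < k (n + n0)" using n0(2) by simp
    from free_power_structure[OF assms(7) this]
    obtain u w where uw: "u holomorphic_on ball 0 1" "\<And>z. cmod z < 1 \<Longrightarrow> 0 \<le> Re (u z)" "Im (u 0) = 0"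
      "\<And>z. cmod z < 1 \<Longrightarrow> cmod (w z) < 1" "\<And>z. cmod z < 1 \<Longrightarrow> w z * exp (u (w z)) = z"
      "\<And>z. cmod z < 1 \<Longrightarrow> eta (Ms n) z = w z * exp (- (u (w z) / of_real (\<kappa> n)))"
      "circle_mean (Ms n) = exp (- (u 0 * of_real (1 + 1 / \<kappa> n)))"
      unfolding Ms_def \<kappa>_def by metis
    have "\<delta> < cmod (circle_mean (Ms n))" using n0(1) by (simp add: Ms_def)
    also have "\<dots> = exp (- (Re (u 0) * (1 + 1 / \<kappa> n)))"
      unfolding uw(7) norm_exp_eq_Re by (simp del: of_real_add of_real_divide)
    finally have "ln \<delta> < - (Re (u 0) * (1 + 1 / \<kappa> n))"
      using \<delta>(1) by (metis exp_gt_zero ln_exp ln_less_cancel_iff)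
    \<comment> \<open>The factor 1 + 1/\<kappa> is at least 1, so dropping it gives a bound that is
      independent of n.\<close>
    moreover have "Re (u 0) * 1 \<le> Re (u 0) * (1 + 1 / \<kappa> n)"
      using uw(2)[of 0] \<kappa>[of n] by (intro mult_left_mono) auto
    ultimately have "Re (u 0) \<le> - ln \<delta>" by simp
    then show ?thesis using uw by blast
  qed
  then obtain u w where uw: "\<And>n. u n holomorphic_on ball 0 1" "\<And>n z. cmod z < 1 \<Longrightarrow> 0 \<le> Re (u n z)"
    "\<And>n. Im (u n 0) = 0" "\<And>n. Re (u n 0) \<le> - ln \<delta>"
    "\<And>n z. cmod z < 1 \<Longrightarrow> cmod (w n z) < 1" "\<And>n z. cmod z < 1 \<Longrightarrow> w n z * exp (u n (w n z)) = z"
    "\<And>n z. cmod z < 1 \<Longrightarrow> eta (Ms n) z = w n z * exp (- (u n (w n z) / of_real (\<kappa> n)))"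
    by metis
  have k_lim: "filterlim (\<lambda>n. k (n + n0)) at_top sequentially"
    using assms(2) by (rule filterlim_compose) (rule filterlim_add_const_nat_at_top)
  interpret convergent_powers Ms \<mu> u w \<kappa> "- ln \<delta>"
  proof
    show "filterlim \<kappa> at_top sequentially"
      unfolding \<kappa>_def filterlim_at_top
    proof
      fix Z :: real
      show "\<forall>\<^sub>F n in sequentially. Z \<le> k (n + n0) / 2 - 1"
        using filterlim_at_top[THEN iffD1, OF k_lim, rule_format, of "2 * Z + 2"]
        by eventually_elim simp
    qed
    show "(\<lambda>n. eta (Ms n) z) \<longlonglongrightarrow> eta \<mu> z" if "cmod z < 1" for z
      unfolding Ms_def using circle_weak_conv_eta[OF assms(8) probs \<mu>(1) that] by (rule LIMSEQ_ignore_initial_segment)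
  qed (use uw \<mu> \<kappa> probs in \<open>simp_all add: Ms_def\<close>)
  have main: "(\<forall>\<^sub>F n in sequentially. abs_cont_on K (\<nu>pow n) \<and>
               has_arclength_density_on K (\<nu>pow n) (circle_density (\<nu>pow n))) \<and>
            uniform_limit K (\<lambda>n. circle_density (\<nu>pow n)) (circle_density \<mu>) sequentially"
    if "compact K" "K \<subseteq> sphere 0 1 - exceptional_set \<mu>" for K
    using densities_converge[OF that] unfolding Ms_def uniform_limit_iff
      eventually_sequentially_seg[where P="\<lambda>n. abs_cont_on K (\<nu>pow n) \<and> has_arclength_density_on K (\<nu>pow n) (circle_density (\<nu>pow n))"]
      eventually_sequentially_seg[where P="\<lambda>n. \<forall>\<xi>\<in>K. dist (circle_density (\<nu>pow n) \<xi>) (circle_density \<mu> \<xi>) < e" for e]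
    by blast
  show ?thesis
    using main main[of "sphere 0 1"] by auto
qed

end
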